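(* Let $m$ be a positive integer, let $H$ be an invertible Hermitian $n\times n$ complex matrix and let $B$ be an $n\times n$ complex $H$-selfadjoint matrix. Let $(J,H_B)$ be the canonical form of $(B,H)$, partitioned as $J=J_0\oplus J_1\oplus J_2$, $H_B=H_0\oplus H_1\oplus H_2$ (zero eigenvalue; negative eigenvalues; eigenvalues not in $(-\infty,0]$) as described in the context. Then there exists an $H$-selfadjoint matrix $A$ such that $A^m=B$ if and only if $(J,H_B)$ has the following properties: 1. There exists a reordering $n'_1,n'_2,\ldots,n'_{pm},0,\ldots$ of the Segre characteristic of $B$ corresponding to the eigenvalue zero such that for all $k$ the $m$-tuple $(n'_{m(k-1)+1},\ldots,n'_{mk})$ is descending (i.e. non-increasing) and the difference between $n'_{m(k-1)+1}$ and $n'_{mk}$ is at most one. 2. For some reordering satisfying Property 1, there are numbers $\eta_1,\ldots,\eta_p\in\{1,-1\}$ such that for every positive integer $\nu$ occurring in the Segre characteristic, the number of positive blocks in $H_0$ of size $\nu$ is equal to $\sum_{k=1}^p\pi_{\nu,k}$, where $$\pi_{\nu,k}=\begin{cases}\frac12\big|\mathcal{B}_\nu^{(k)}\big| & \text{if }\big|\mathcal{B}_\nu^{(k)}\big|\text{ is even},\\[2pt] \frac12\left(\big|\mathcal{B}_\nu^{(k)}\big|+\eta_k\right) & \text{if }\big|\mathcal{B}_\nu^{(k)}\big|\text{ is odd}.\end{cases}$$ 3. If $m$ is even, the blocks in $J_1$ and $H_1$ can be (simultaneously) reordered so that $$J_1=\bigoplus_{j=1}^t\left(J_{k_j}(\alpha_j)\oplus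 J_{k_j}(\alpha_j)\right)\quad\text{and}\quad H_1=\bigoplus_{j=1}^t\left(Q_{k_j}\oplus(-Q_{k_j})\right),$$ with each $\alpha_j<0$.
   Context: All matrices are complex. For an invertible Hermitian $n\times n$ matrix $H$, an $n\times n$ matrix $A$ is called $H$-selfadjoint if $HA=A^*H$. $J_n(\lambda)$ denotes the $n\times n$ upper triangular Jordan block with eigenvalue $\lambda$ (ones on the superdiagonal). $Q_n$ denotes the $n\times n$ matrix with ones on the main anti-diagonal and zeros elsewhere. Canonical form: if $B$ is $H$-selfadjoint, there is an invertible $S$ such that $$J=S^{-1}BS=J_{k_1}(\lambda_1)\oplus\cdots\oplus J_{k_\alpha}(\lambda_\alpha)\oplus[J_{k_{\alpha+1}}(\lambda_{\alpha+1})\oplus J_{k_{\alpha+1}}(\overline{\lambda}_{\alpha+1})]\oplus\cdots\oplus[J_{k_\beta}(\lambda_\beta)\oplus J_{k_\beta}(\overline{\lambda}_\beta)],$$ with $\lambda_1,\ldots,\lambda_\alpha$ real and $\lambda_{\alpha+1},\ldots,\lambda_\beta$ nonreal with positive imaginary parts, and $$H_B=S^*HS=\varepsilon_1Q_{k_1}\oplus\cdots\oplus\varepsilon_\alpha Q_{k_\alpha}\oplus Q_{2k_{\alpha+1}}\oplus\cdots\oplus Q_{2k_\beta},$$ with each $\varepsilon_i\in\{1,-1\}$. The pair $(J,H_B)$ is unique up to simultaneous permutation of corresponding blocks and is called the canonical form of $(B,H)$. A summand $\varepsilon_iQ_{k_i}$ with $\varepsilon_i=1$ (resp. $\varepsilon_i=-1$)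 is called a positive (resp. negative) block of size $k_i$. Partition: after a simultaneous permutation of blocks, $J=J_0\oplus J_1\oplus J_2$ and $H_B=H_0\oplus H_1\oplus H_2$, where $J_0$ is the direct sum of the blocks $J_{k_j}(0)$, $J_1$ is the direct sum of the blocks $J_{k_j}(\alpha_j)$ with $\alpha_j<0$, $J_2$ consists of the blocks with eigenvalues not in $(-\infty,0]$, and $H_0,H_1,H_2$ are the corresponding parts of $H_B$. Any of these parts may be empty. Segre characteristic: if the Jordan blocks of $B$ at the eigenvalue $0$ have sizes $n_1\ge n_2\ge\cdots\ge n_r>0$, the Segre characteristic of $B$ corresponding to zero is the infinite sequence $n_1,n_2,\ldots,n_r,0,0,\ldots$. A reordering of it is written $n'_1,n'_2,\ldots,n'_{pm},0,\ldots$, where it is divided into consecutive $m$-tuples, the $k$th $m$-tuple being $(n'_{m(k-1)+1},n'_{m(k-1)+2},\ldots,n'_{mk})$, and $p$ is the number of nonzero $m$-tuples (those not consisting only of zeros); these are the first $p$ tuples, so all entries after $n'_{pm}$ are $0$. (Individual entries of the first $p$ tuples may be $0$.) For such a reordering, for $k=1,\ldots,p$ and a positive integer $\nu$, $$\mathcal{B}_\nu^{(k)}:=\{i\mid n'_i=\nu,\ m(k-1)+1\le i\le mk\}.$$ *)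

theory Defs
  imports Complex_Main
    "HOL-Library.Multiset"
    "Jordan_Normal_Form.Schur_Decomposition"
    "Jordan_Normal_Form.Jordan_Normal_Form_Existence"
    "Jordan_Normal_Form.Jordan_Normal_Form_Uniqueness"
begin

definition hermitian_mat :: "complex mat \<Rightarrow> bool" where
  "hermitian_mat H \<longleftrightarrow> square_mat H \<and> mat_adjoint H = H"

definition selfadjoint_wrt :: "complex mat \<Rightarrow> complex mat \<Rightarrow> bool" where
  "selfadjoint_wrt H A \<longleftrightarrow> H * A = mat_adjoint A * H"

definition antidiag_mat :: "nat \<Rightarrow> complex mat" where
  "antidiag_mat n = mat n n (\<lambda>(i, j). if i + j + 1 = n then 1 else 0)"


text \<open>
  A pair \<open>(J, H\<^sub>B)\<close> in canonical form is represented by the list of its corresponding blocks: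
  \<open>Real_Block k a \<epsilon>\<close> stands for \<open>J\<^sub>k(a)\<close> together with \<open>\<epsilon> Q\<^sub>k\<close>, and
  \<open>Pair_Block k z\<close> stands for \<open>J\<^sub>k(z) \<oplus> J\<^sub>k(cnj z)\<close> together with \<open>Q\<close> of size \<open>2k\<close>.
  Permuting the list is a simultaneous permutation of the blocks of \<open>J\<close> and \<open>H\<^sub>B\<close>.
\<close>

datatype canon_block = Real_Block nat real int | Pair_Block nat complex

fun valid_block :: "canon_block \<Rightarrow> bool" where
  "valid_block (Real_Block k a \<epsilon>) \<longleftrightarrow> 0 < k \<and> \<epsilon> \<in> {1, -1}"
| "valid_block (Pair_Block k z) \<longleftrightarrow> 0 < k \<and> 0 < Im z"

fun block_J :: "canon_block \<Rightarrow> complex mat" where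
  "block_J (Real_Block k a \<epsilon>) = jordan_block k (complex_of_real a)"
| "block_J (Pair_Block k z) = diag_block_mat [jordan_block k z, jordan_block k (cnj z)]"

fun block_H :: "canon_block \<Rightarrow> complex mat" where
  "block_H (Real_Block k a \<epsilon>) = of_int \<epsilon> \<cdot>\<^sub>m antidiag_mat k"
| "block_H (Pair_Block k z) = antidiag_mat (2 * k)"

definition canon_J :: "canon_block list \<Rightarrow> complex mat" where
  "canon_J bs = diag_block_mat (map block_J bs)"

definition canon_H :: "canon_block list \<Rightarrow> complex mat" where
  "canon_H bs = diag_block_mat (map block_H bs)"

text \<open>
  \<open>similar_mat_wit J B S' S\<close> says that \<open>S'\<close> is the inverse of \<open>S\<close> and \<open>J = S' * B * S\<close>.
  The canonical form is unique only up to the order of the blocks, so this is a relation.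
\<close>

definition is_canonical_form ::
    "complex mat \<Rightarrow> complex mat \<Rightarrow> canon_block list \<Rightarrow> bool" where
  "is_canonical_form B H bs \<longleftrightarrow>
     (\<forall>b \<in> set bs. valid_block b) \<and>
     (\<exists>S S'. similar_mat_wit (canon_J bs) B S' S \<and> canon_H bs = mat_adjoint S * H * S)"

text \<open>The blocks of \<open>(J\<^sub>0, H\<^sub>0)\<close> and of \<open>(J\<^sub>1, H\<^sub>1)\<close>; the remaining ones form \<open>(J\<^sub>2, H\<^sub>2)\<close>.\<close>

fun is_zero_block :: "canon_block \<Rightarrow> bool" where
  "is_zero_block (Real_Block k a \<epsilon>) \<longleftrightarrow> a = 0"
| "is_zero_block (Pair_Block k z) \<longleftrightarrow> False"

fun is_neg_block :: "canon_block \<Rightarrow> bool" where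
  "is_neg_block (Real_Block k a \<epsilon>) \<longleftrightarrow> a < 0"
| "is_neg_block (Pair_Block k z) \<longleftrightarrow> False"

definition zero_part :: "canon_block list \<Rightarrow> canon_block list" where
  "zero_part bs = filter is_zero_block bs"

definition neg_part :: "canon_block list \<Rightarrow> canon_block list" where
  "neg_part bs = filter is_neg_block bs"

fun is_positive_of_size :: "nat \<Rightarrow> canon_block \<Rightarrow> bool" where
  "is_positive_of_size \<nu> (Real_Block k a \<epsilon>) \<longleftrightarrow> k = \<nu> \<and> \<epsilon> = 1"
| "is_positive_of_size \<nu> (Pair_Block k z) \<longleftrightarrow> False"

definition num_positive_blocks :: "nat \<Rightarrow> canon_block list \<Rightarrow> nat" where
  "num_positive_blocks \<nu> bs = length (filter (is_positive_of_size \<nu>) bs)"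


definition jordan_sizes :: "(nat \<times> complex) list \<Rightarrow> complex \<Rightarrow> nat list" where
  "jordan_sizes n_as ev = map fst (filter (\<lambda>(k, a). a = ev) n_as)"

definition padded_desc :: "nat list \<Rightarrow> nat \<Rightarrow> nat" where
  "padded_desc ks i = (if i < length ks then rev (sort ks) ! i else 0)"

text \<open>The Segre characteristic, as a sequence indexed from 0.\<close>

definition segre_char :: "complex mat \<Rightarrow> complex \<Rightarrow> nat \<Rightarrow> nat" where
  "segre_char B ev =
     (THE s. \<exists>n_as. jordan_nf B n_as \<and> s = padded_desc (jordan_sizes n_as ev))"

lemma mset_jordan_sizes_unique:
  assumes "jordan_nf B n_as" "jordan_nf B m_bs"
  shows "mset (jordan_sizes n_as ev) = mset (jordan_sizes m_bs ev)"
proof (rule multiset_eqI)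
  fix k
  have cnt: "count (mset (jordan_sizes xs ev)) k = length (filter ((=) (k, ev)) xs)"
    for xs :: "(nat \<times> complex) list"
    unfolding jordan_sizes_def by (induction xs) auto
  show "count (mset (jordan_sizes n_as ev)) k = count (mset (jordan_sizes m_bs ev)) k"
  proof (cases "k = 0")
    case True
    have "(0, ev) \<notin> set n_as" "(0, ev) \<notin> set m_bs"
      using assms unfolding jordan_nf_def by (metis fst_conv imageI)+
    then have "filter ((=) (0, ev)) n_as = []" "filter ((=) (0, ev)) m_bs = []"
      by (simp_all add: filter_empty_conv) blast+
    then show ?thesis unfolding cnt by (simp add: True)
  next
    case False
    then show ?thesis
      unfolding cnt compute_nr_of_jordan_blocks[OF assms(1) False, symmetric]
        compute_nr_of_jordan_blocks[OF assms(2) False, symmetric] by simp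
  qed
qed

lemma segre_char_eq:
  assumes "jordan_nf B n_as"
  shows "segre_char B ev = padded_desc (jordan_sizes n_as ev)"
proof -
  have "padded_desc (jordan_sizes m_bs ev) = padded_desc (jordan_sizes n_as ev)"
    if "jordan_nf B m_bs" for m_bs
  proof -
    have m: "mset (jordan_sizes m_bs ev) = mset (jordan_sizes n_as ev)"
      by (rule mset_jordan_sizes_unique[OF that assms])
    then have "sort (jordan_sizes m_bs ev) = sort (jordan_sizes n_as ev)"
      by (intro properties_for_sort) simp_all
    then show ?thesis
      using mset_eq_length[OF m] unfolding padded_desc_def by auto
  qed
  then show ?thesis
    unfolding segre_char_def using assms by (intro the_equality) blast+
qed


text \<open>
  Sequences, tuples and signs are indexed from 0: the \<open>k\<close>th \<open>m\<close>-tuple of \<open>n'\<close>, for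
  \<open>k = 0, 1, \<dots>\<close>, consists of the entries \<open>n' i\<close> with \<open>i \<in> tuple_indices m k\<close>.
\<close>

definition tuple_indices :: "nat \<Rightarrow> nat \<Rightarrow> nat set" where
  "tuple_indices m k = {m * k ..< m * (k + 1)}"

definition is_tuple_reordering ::
    "nat \<Rightarrow> (nat \<Rightarrow> nat) \<Rightarrow> nat \<Rightarrow> (nat \<Rightarrow> nat) \<Rightarrow> bool" where
  "is_tuple_reordering m s p n' \<longleftrightarrow>
     (\<exists>\<sigma>. bij \<sigma> \<and> n' = s \<circ> \<sigma>) \<and>
     (\<forall>k < p. \<exists>i \<in> tuple_indices m k. n' i \<noteq> 0) \<and>
     (\<forall>i \<ge> m * p. n' i = 0)"

definition property1_for :: "nat \<Rightarrow> (nat \<Rightarrow> nat) \<Rightarrow> bool" where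
  "property1_for m n' \<longleftrightarrow>
     (\<forall>k. (\<forall>i \<in> tuple_indices m k. \<forall>j \<in> tuple_indices m k. i \<le> j \<longrightarrow> n' j \<le> n' i) \<and>
          int (n' (m * k)) - int (n' (m * k + m - 1)) \<le> 1)"

definition size_indices :: "nat \<Rightarrow> (nat \<Rightarrow> nat) \<Rightarrow> nat \<Rightarrow> nat \<Rightarrow> nat set" where
  "size_indices m n' \<nu> k = {i \<in> tuple_indices m k. n' i = \<nu>}"

text \<open>Both divisions are exact when the sign is \<open>1\<close> or \<open>-1\<close>.\<close>

definition pos_count :: "nat \<Rightarrow> (nat \<Rightarrow> nat) \<Rightarrow> (nat \<Rightarrow> int) \<Rightarrow> nat \<Rightarrow> nat \<Rightarrow> int" where
  "pos_count m n' \<eta> \<nu> k =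
     (let c = int (card (size_indices m n' \<nu> k))
      in if even c then c div 2 else (c + \<eta> k) div 2)"

definition property1 :: "nat \<Rightarrow> complex mat \<Rightarrow> bool" where
  "property1 m B \<longleftrightarrow>
     (\<exists>p n'. is_tuple_reordering m (segre_char B 0) p n' \<and> property1_for m n')"

definition property2 :: "nat \<Rightarrow> complex mat \<Rightarrow> canon_block list \<Rightarrow> bool" where
  "property2 m B bs \<longleftrightarrow>
     (\<exists>p n'. is_tuple_reordering m (segre_char B 0) p n' \<and> property1_for m n' \<and>
        (\<exists>\<eta>. (\<forall>k < p. \<eta> k \<in> {1, -1}) \<and>
           (\<forall>\<nu> > 0. \<nu> \<in> range (segre_char B 0) \<longrightarrow>
              int (num_positive_blocks \<nu> (zero_part bs)) = (\<Sum>k < p. pos_count m n' \<eta> \<nu> k))))"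

definition property3 :: "nat \<Rightarrow> canon_block list \<Rightarrow> bool" where
  "property3 m bs \<longleftrightarrow>
     (even m \<longrightarrow>
       (\<exists>cs ts. mset cs = mset (neg_part bs) \<and>
          (\<forall>(k, a) \<in> set ts. 0 < k \<and> a < 0) \<and>
          canon_J cs = diag_block_mat (map (\<lambda>(k, a :: real).
             diag_block_mat [jordan_block k (complex_of_real a),
                             jordan_block k (complex_of_real a)]) ts) \<and>
          canon_H cs = diag_block_mat (map (\<lambda>(k, a :: real).
             diag_block_mat [antidiag_mat k, - antidiag_mat k]) ts)))"

end

theory Submission
  imports Defs "HOL-Computational_Algebra.Formal_Power_Series" "HOL-Library.Infinite_Set"
begin

text \<open>
  For a real number \<open>\<alpha>\<close> and \<open>\<nu> > 0\<close>, the number of blocks of size \<open>\<nu>\<close>, eigenvalue \<open>\<alpha>\<close> and sign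
  \<open>\<delta>\<close> in the canonical form of \<open>(B, H)\<close> is the positive index of the Hermitian form
  \<open>\<delta> x\<^sup>* H (B - \<alpha>)\<^sup>\<nu>\<^sup>-\<^sup>1 x\<close> on the kernel of \<open>(B - \<alpha>)\<^sup>\<nu>\<close>. This index is invariant under congruence
  and additive over direct sums, and on \<open>(J\<^sub>n(0)\<^sup>m, \<epsilon> Q\<^sub>n)\<close> the form is an antidiagonal one, whose size is
  the number of entries \<open>\<nu>\<close> in the balanced \<open>m\<close>-tuple with sum \<open>n\<close>.

  Given a root \<open>A\<close> of \<open>B\<close>, splitting off the nilpotent part of \<open>(A, H)\<close> as a sum of pairs
  \<open>(J\<^sub>n(0), \<epsilon> Q\<^sub>n)\<close> and comparing indices yields one tuple with sign \<open>\<eta> = \<epsilon>\<close> for each summand.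
  If \<open>m\<close> is even, then \<open>B = C\<^sup>2\<close> with \<open>C\<close> selfadjoint, and for \<open>\<alpha> < 0\<close> the map \<open>C\<close> interchanges
  positive and negative subspaces, so that the signs are balanced.

  Conversely, each tuple with sum \<open>n\<close> and sign \<open>\<eta>\<close> gives the summand \<open>(J\<^sub>n(0), \<eta> Q\<^sub>n)\<close> of the root,
  whose power has the right canonical form because the indices agree. At nonzero eigenvalues the
  roots are Toeplitz matrices of \<open>m\<close>-th roots of the power series \<open>\<lambda> + x\<close>.
\<close>

subsection \<open>Congruence of pairs and direct sums\<close>

text \<open>A canonical form is given for \<open>(B, H)\<close> only. Nothing is known about a root
  \<open>A\<close>, so its chains at 0 have to be constructed, while the rest of \<open>A\<close> is
  merely injective: an injective summand has index 0, so it can be left without a normal form. The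
  same splitting serves the converse, where the power of the constructed root must first be put in
  canonical form before it can be compared with \<open>B\<close>.

  The tuples come from residue classes modulo \<open>m\<close>. The matrix J_n(0)^m shifts indices
  by \<open>m\<close>, so the \<open>n\<close> basis vectors fall into chains whose lengths form the
  balanced \<open>m\<close>-tuple with sum \<open>n\<close>. The form Q_n reverses the indices and
  thereby exchanges chains of equal length. An exchanged pair is hyperbolic and gives one positive
  and one negative block; when the number of chains of some length is odd, one chain is mapped to
  itself and carries the sign of the block. This is where the halves and the correction by \<eta> in
  Property 2 come from.\<close>

lemma adj_index [simp]:
  fixes A :: "complex mat"
  shows "i < dim_col A \<Longrightarrow> j < dim_row A \<Longrightarrow> mat_adjoint A $$ (i, j) = cnj (A $$ (j, i))"
    and "dim_row (mat_adjoint A) = dim_col A" and "dim_col (mat_adjoint A) = dim_row A"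
  unfolding mat_adjoint_def by (auto simp: mat_of_rows_def conjugate_vec_def)

lemma adj_carrier [simp]:
  fixes A :: "complex mat"
  shows "mat_adjoint A \<in> carrier_mat c r \<longleftrightarrow> A \<in> carrier_mat r c"
  by (metis adj_index(2,3) carrier_matD carrier_matI)

lemma sq_mult_carrier [simp]:
  "A \<in> carrier_mat n n \<Longrightarrow> B \<in> carrier_mat n n \<Longrightarrow> A * B \<in> carrier_mat n n"
  by (rule mult_carrier_mat)

lemma adj_adj [simp]: "mat_adjoint (mat_adjoint A) = (A :: complex mat)"
  by (rule eq_matI) auto

lemma adj_one [simp]: "mat_adjoint (1\<^sub>m n) = (1\<^sub>m n :: complex mat)"
  by (rule eq_matI) auto

lemma adj_mult:
  fixes A B :: "complex mat"
  assumes "A \<in> carrier_mat a b" "B \<in> carrier_mat b c"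
  shows "mat_adjoint (A * B) = mat_adjoint B * mat_adjoint A"
  using assms by (intro eq_matI) (auto simp: scalar_prod_def mult.commute)

lemma adj_smult [simp]: "mat_adjoint (c \<cdot>\<^sub>m A) = cnj c \<cdot>\<^sub>m mat_adjoint A"
  by (rule eq_matI) auto

lemma adj_minus:
  fixes A B :: "complex mat"
  assumes "A \<in> carrier_mat a b" "B \<in> carrier_mat a b"
  shows "mat_adjoint (A - B) = mat_adjoint A - mat_adjoint B"
  using assms by (intro eq_matI) auto

lemma pow_mat_add:
  fixes A :: "complex mat"
  assumes "A \<in> carrier_mat n n"
  shows "A ^\<^sub>m (i + j) = A ^\<^sub>m i * A ^\<^sub>m j"
  using assms
proof (induction j)
  case (Suc j)
  then show ?case by (simp add: assoc_mult_mat[of _ n n _ n _ n])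
qed auto

lemma pow_mat_mult:
  fixes A :: "complex mat"
  assumes "A \<in> carrier_mat n n"
  shows "A ^\<^sub>m (i * j) = (A ^\<^sub>m i) ^\<^sub>m j"
proof (induction j)
  case (Suc j)
  have "i * Suc j = i * j + i" by simp
  then show ?case using Suc assms by (simp only: pow_mat_add[OF assms] pow_mat.simps)
qed (use assms in auto)

lemma pow_mat_Suc_left:
  fixes A :: "complex mat"
  assumes "A \<in> carrier_mat n n"
  shows "A ^\<^sub>m Suc i = A * A ^\<^sub>m i"
  using pow_mat_add[OF assms, of 1 i] assms by simp

lemma pow_mat_commute:
  fixes A X :: "complex mat"
  assumes A: "A \<in> carrier_mat n n" and X: "X \<in> carrier_mat n n" and AX: "A * X = X * A"
  shows "A ^\<^sub>m i * X = X * A ^\<^sub>m i"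
proof (induction i)
  case (Suc i)
  have "A ^\<^sub>m Suc i * X = A ^\<^sub>m i * (A * X)"
    using A X by (simp add: assoc_mult_mat[of _ n n _ n _ n])
  also have "\<dots> = (A ^\<^sub>m i * X) * A"
    using A X by (simp add: AX assoc_mult_mat[of _ n n _ n _ n])
  also have "\<dots> = X * A ^\<^sub>m Suc i"
    using A X by (simp add: Suc assoc_mult_mat[of _ n n _ n _ n])
  finally show ?case .
qed (use A X in auto)

section \<open>Direct sums of two matrices\<close>

definition mat_dsum :: "'a :: zero mat \<Rightarrow> 'a mat \<Rightarrow> 'a mat" (infixr "\<oplus>\<^sub>m" 65) where
  "A \<oplus>\<^sub>m B = four_block_mat A (0\<^sub>m (dim_row A) (dim_col B)) (0\<^sub>m (dim_row B) (dim_col A)) B"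

lemma dsum_dim [simp]:
  "dim_row (A \<oplus>\<^sub>m B) = dim_row A + dim_row B" "dim_col (A \<oplus>\<^sub>m B) = dim_col A + dim_col B"
  by (auto simp: mat_dsum_def)

lemma dsum_carrier [simp]:
  "A \<in> carrier_mat a b \<Longrightarrow> B \<in> carrier_mat c d \<Longrightarrow> A \<oplus>\<^sub>m B \<in> carrier_mat (a + c) (b + d)"
  by (intro carrier_matI) auto

lemma dsum_index:
  "i < dim_row A + dim_row B \<Longrightarrow> j < dim_col A + dim_col B \<Longrightarrow> (A \<oplus>\<^sub>m B) $$ (i, j) =
    (if i < dim_row A then if j < dim_col A then A $$ (i, j) else 0
     else if j < dim_col A then 0 else B $$ (i - dim_row A, j - dim_col A))"
  by (auto simp: mat_dsum_def)

lemma dsum_one [simp]: "1\<^sub>m a \<oplus>\<^sub>m 1\<^sub>m b = (1\<^sub>m (a + b) :: 'a :: semiring_1 mat)"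
  by (simp add: mat_dsum_def)

lemma dsum_zero [simp]: "0\<^sub>m a b \<oplus>\<^sub>m 0\<^sub>m c d = 0\<^sub>m (a + c) (b + d)"
  by (simp add: mat_dsum_def)

lemma dsum_empty_left [simp]: "0\<^sub>m 0 0 \<oplus>\<^sub>m A = A"
  by (rule eq_matI) (auto simp: dsum_index)

lemma dsum_empty_right [simp]: "A \<oplus>\<^sub>m 0\<^sub>m 0 0 = A"
  by (rule eq_matI) (auto simp: dsum_index)

lemma dsum_assoc: "(A \<oplus>\<^sub>m B) \<oplus>\<^sub>m C = A \<oplus>\<^sub>m (B \<oplus>\<^sub>m C)"
  using assoc_four_block_mat[of A B C] by (simp add: mat_dsum_def Let_def)

lemma diag_block_mat_Cons: "diag_block_mat (A # As) = A \<oplus>\<^sub>m diag_block_mat As"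
  by (simp add: mat_dsum_def Let_def)

declare diag_block_mat.simps(2) [simp del]
declare diag_block_mat_Cons [simp]

lemma diag_block_mat_app: "diag_block_mat (As @ Bs) = diag_block_mat As \<oplus>\<^sub>m diag_block_mat Bs"
  by (simp add: diag_block_mat_append Let_def mat_dsum_def)

lemma dsum_mult:
  fixes A1 :: "'a :: semiring_1 mat"
  assumes "A1 \<in> carrier_mat a b" "B1 \<in> carrier_mat b c" "A2 \<in> carrier_mat d e" "B2 \<in> carrier_mat e f"
  shows "(A1 \<oplus>\<^sub>m A2) * (B1 \<oplus>\<^sub>m B2) = (A1 * B1) \<oplus>\<^sub>m (A2 * B2)"
  unfolding mat_dsum_def using assms
  by (subst mult_four_block_mat[of _ a b _ e _ d _ _ c _ f]) auto

lemma dsum_diff: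
  fixes A1 :: "'a :: group_add mat"
  assumes "A1 \<in> carrier_mat a b" "B1 \<in> carrier_mat a b" "A2 \<in> carrier_mat c d" "B2 \<in> carrier_mat c d"
  shows "(A1 \<oplus>\<^sub>m A2) - (B1 \<oplus>\<^sub>m B2) = (A1 - B1) \<oplus>\<^sub>m (A2 - B2)"
  using assms by (intro eq_matI) (auto simp: dsum_index)

lemma dsum_smult: "c \<cdot>\<^sub>m (A \<oplus>\<^sub>m B) = (c \<cdot>\<^sub>m A) \<oplus>\<^sub>m (c \<cdot>\<^sub>m (B :: 'a :: semiring_1 mat))"
  by (rule eq_matI) (auto simp: dsum_index)

lemma dsum_adj: "mat_adjoint (A \<oplus>\<^sub>m B) = mat_adjoint A \<oplus>\<^sub>m mat_adjoint (B :: complex mat)"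
  by (rule eq_matI) (auto simp: dsum_index)

lemma dsum_pow:
  fixes A :: "'a :: semiring_1 mat"
  assumes "A \<in> carrier_mat a a" "B \<in> carrier_mat b b"
  shows "(A \<oplus>\<^sub>m B) ^\<^sub>m k = A ^\<^sub>m k \<oplus>\<^sub>m B ^\<^sub>m k"
  unfolding mat_dsum_def using pow_four_block_mat[OF assms, of k] assms by simp

lemma dsum_eqD:
  assumes "A \<oplus>\<^sub>m B = A' \<oplus>\<^sub>m B'" "A \<in> carrier_mat a b" "A' \<in> carrier_mat a b"
    "B \<in> carrier_mat c d" "B' \<in> carrier_mat c d"
  shows "A = A'" "B = B'"
proof -
  show "A = A'"
  proof (rule eq_matI)
    fix i j assume "i < dim_row A'" "j < dim_col A'"
    then show "A $$ (i, j) = A' $$ (i, j)"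
      using arg_cong[OF assms(1), of "\<lambda>M. M $$ (i, j)"] assms(2-) by (simp add: dsum_index)
  qed (use assms in auto)
  show "B = B'"
  proof (rule eq_matI)
    fix i j assume "i < dim_row B'" "j < dim_col B'"
    then show "B $$ (i, j) = B' $$ (i, j)"
      using arg_cong[OF assms(1), of "\<lambda>M. M $$ (a + i, b + j)"] assms(2-) by (simp add: dsum_index)
  qed (use assms in auto)
qed

section \<open>Change of basis for a matrix together with a form\<close>

definition cong_pair :: "complex mat \<Rightarrow> complex mat \<Rightarrow> complex mat \<Rightarrow> complex mat \<Rightarrow> bool" where
  "cong_pair A H A' H' \<longleftrightarrow> (\<exists>n S T. {A, H, A', H', S, T} \<subseteq> carrier_mat n n \<and>
     S * T = 1\<^sub>m n \<and> T * S = 1\<^sub>m n \<and> A' = T * A * S \<and> H' = mat_adjoint S * H * S)"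

lemma cong_pairI:
  assumes "A \<in> carrier_mat n n" "H \<in> carrier_mat n n" "S \<in> carrier_mat n n" "T \<in> carrier_mat n n"
    "S * T = 1\<^sub>m n" "T * S = 1\<^sub>m n" "A' = T * A * S" "H' = mat_adjoint S * H * S"
  shows "cong_pair A H A' H'"
  unfolding cong_pair_def using assms by (intro exI[of _ n] exI[of _ S] exI[of _ T]) auto

lemma cong_pairE:
  assumes "cong_pair A H A' H'"
  obtains n S T where "A \<in> carrier_mat n n" "H \<in> carrier_mat n n" "A' \<in> carrier_mat n n"
    "H' \<in> carrier_mat n n" "S \<in> carrier_mat n n" "T \<in> carrier_mat n n"
    "S * T = 1\<^sub>m n" "T * S = 1\<^sub>m n" "A' = T * A * S" "H' = mat_adjoint S * H * S"
  using assms unfolding cong_pair_def by auto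

lemma cong_pair_refl:
  "A \<in> carrier_mat n n \<Longrightarrow> H \<in> carrier_mat n n \<Longrightarrow> cong_pair A H A H"
  by (rule cong_pairI[of _ n _ "1\<^sub>m n" "1\<^sub>m n"]) auto

lemma cancel_left_mat:
  fixes S :: "'a :: semiring_1 mat"
  assumes "S * T = 1\<^sub>m n" "S \<in> carrier_mat n n" "T \<in> carrier_mat n n" "X \<in> carrier_mat n n"
  shows "S * (T * X) = X"
  using assms assoc_mult_mat[of S n n T n X n] by auto

lemma adj_inverse:
  fixes S :: "complex mat"
  assumes "S * T = 1\<^sub>m n" "S \<in> carrier_mat n n" "T \<in> carrier_mat n n"
  shows "mat_adjoint T * mat_adjoint S = 1\<^sub>m n"
  using arg_cong[OF assms(1), of mat_adjoint] assms(2-) by (simp add: adj_mult[of _ n n _ n])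

lemma cong_pair_sym:
  assumes "cong_pair A H A' H'"
  shows "cong_pair A' H' A H"
  using assms
proof (rule cong_pairE)
  fix n S T
  assume c: "A \<in> carrier_mat n n" "H \<in> carrier_mat n n" "A' \<in> carrier_mat n n"
    "H' \<in> carrier_mat n n" "S \<in> carrier_mat n n" "T \<in> carrier_mat n n"
    and ST: "S * T = 1\<^sub>m n" and TS: "T * S = 1\<^sub>m n"
    and A': "A' = T * A * S" and H': "H' = mat_adjoint S * H * S"
  show ?thesis
  proof (rule cong_pairI[of _ n _ T S])
    show "A = S * A' * T" unfolding A' using c ST
      by (simp add: assoc_mult_mat[of _ n n _ n _ n] cancel_left_mat[OF ST])
    show "H = mat_adjoint T * H' * T" unfolding H' using c ST
      by (simp add: assoc_mult_mat[of _ n n _ n _ n] cancel_left_mat[OF adj_inverse[OF ST]])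
  qed (use c ST TS in auto)
qed

lemma cong_pair_trans:
  assumes "cong_pair A H A' H'" "cong_pair A' H' A'' H''"
  shows "cong_pair A H A'' H''"
proof -
  obtain n S T where c: "A \<in> carrier_mat n n" "H \<in> carrier_mat n n" "A' \<in> carrier_mat n n"
    "H' \<in> carrier_mat n n" "S \<in> carrier_mat n n" "T \<in> carrier_mat n n"
    and ST: "S * T = 1\<^sub>m n" and TS: "T * S = 1\<^sub>m n"
    and A': "A' = T * A * S" and H': "H' = mat_adjoint S * H * S"
    using assms(1) by (rule cong_pairE)
  obtain n' S' T' where c': "A' \<in> carrier_mat n' n'" "S' \<in> carrier_mat n' n'" "T' \<in> carrier_mat n' n'"
    and ST': "S' * T' = 1\<^sub>m n'" and TS': "T' * S' = 1\<^sub>m n'"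
    and A'': "A'' = T' * A' * S'" and H'': "H'' = mat_adjoint S' * H' * S'"
    using assms(2) by (rule cong_pairE) auto
  have n': "n' = n" using c(3) c'(1) by auto
  note c' = c'[unfolded n'] note ST' = ST'[unfolded n'] note TS' = TS'[unfolded n']
  show ?thesis
  proof (rule cong_pairI[of _ n _ "S * S'" "T' * T"])
    show "S * S' * (T' * T) = 1\<^sub>m n"
      using c c' ST by (simp add: assoc_mult_mat[of _ n n _ n _ n] cancel_left_mat[OF ST'])
    show "T' * T * (S * S') = 1\<^sub>m n"
      using c c' TS' by (simp add: assoc_mult_mat[of _ n n _ n _ n] cancel_left_mat[OF TS])
    show "A'' = T' * T * A * (S * S')"
      unfolding A'' A' using c c' by (simp add: assoc_mult_mat[of _ n n _ n _ n])
    show "H'' = mat_adjoint (S * S') * H * (S * S')"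
      unfolding H'' H' using c c' by (simp add: assoc_mult_mat[of _ n n _ n _ n] adj_mult[of _ n n _ n])
  qed (use c c' in auto)
qed

lemma cong_pair_dsum:
  assumes "cong_pair A H A' H'" "cong_pair B K B' K'"
  shows "cong_pair (A \<oplus>\<^sub>m B) (H \<oplus>\<^sub>m K) (A' \<oplus>\<^sub>m B') (H' \<oplus>\<^sub>m K')"
proof -
  obtain n S T where c: "A \<in> carrier_mat n n" "H \<in> carrier_mat n n" 
    "S \<in> carrier_mat n n" "T \<in> carrier_mat n n"
    and ST: "S * T = 1\<^sub>m n" and TS: "T * S = 1\<^sub>m n"
    and A': "A' = T * A * S" and H': "H' = mat_adjoint S * H * S"
    using assms(1) by (rule cong_pairE)
  obtain n' S' T' where c': "B \<in> carrier_mat n' n'" "K \<in> carrier_mat n' n'"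
    "S' \<in> carrier_mat n' n'" "T' \<in> carrier_mat n' n'"
    and ST': "S' * T' = 1\<^sub>m n'" and TS': "T' * S' = 1\<^sub>m n'"
    and B': "B' = T' * B * S'" and K': "K' = mat_adjoint S' * K * S'"
    using assms(2) by (rule cong_pairE)
  show ?thesis
    using c c' ST TS ST' TS'
    by (intro cong_pairI[of _ "n + n'" _ "S \<oplus>\<^sub>m S'" "T \<oplus>\<^sub>m T'"])
       (auto simp: dsum_adj dsum_mult[of _ n n _ n _ n' n' _ n'] A' H' B' K')
qed

lemma conj_mat_pow:
  fixes A :: "complex mat"
  assumes "A \<in> carrier_mat n n" "S \<in> carrier_mat n n" "T \<in> carrier_mat n n"
    "S * T = 1\<^sub>m n" "T * S = 1\<^sub>m n"
  shows "(T * A * S) ^\<^sub>m k = T * A ^\<^sub>m k * S"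
proof (induction k)
  case (Suc k)
  then show ?case using assms
    by (simp add: assoc_mult_mat[of _ n n _ n _ n] cancel_left_mat[OF assms(4)])
qed (use assms in simp)

lemma cong_pair_pow:
  assumes "cong_pair A H A' H'"
  shows "cong_pair (A ^\<^sub>m k) H (A' ^\<^sub>m k) H'"
  using assms
proof (rule cong_pairE)
  fix n S T
  assume c: "A \<in> carrier_mat n n" "H \<in> carrier_mat n n"
    "S \<in> carrier_mat n n" "T \<in> carrier_mat n n" "S * T = 1\<^sub>m n" "T * S = 1\<^sub>m n" 
    "A' = T * A * S" "H' = mat_adjoint S * H * S"
  then show ?thesis
    by (intro cong_pairI[of _ n _ S T]) (auto simp del: assoc_mult_mat simp: conj_mat_pow)
qed

lemma cong_pair_shift:
  assumes "cong_pair A H A' H'"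
  shows "cong_pair (A - c \<cdot>\<^sub>m 1\<^sub>m (dim_row A)) H (A' - c \<cdot>\<^sub>m 1\<^sub>m (dim_row A')) H'"
  using assms
proof (rule cong_pairE)
  fix n S T
  assume c: "A \<in> carrier_mat n n" "H \<in> carrier_mat n n" "A' \<in> carrier_mat n n" 
    "S \<in> carrier_mat n n" "T \<in> carrier_mat n n" "S * T = 1\<^sub>m n" "T * S = 1\<^sub>m n" 
    "A' = T * A * S" "H' = mat_adjoint S * H * S"
  have "T * (A - c \<cdot>\<^sub>m 1\<^sub>m n) * S = T * A * S - T * (c \<cdot>\<^sub>m 1\<^sub>m n) * S"
    using c by (simp add: mult_minus_distrib_mat[of _ n n _ n] minus_mult_distrib_mat[of _ n n _ _ n])
  also have "T * (c \<cdot>\<^sub>m 1\<^sub>m n) * S = c \<cdot>\<^sub>m 1\<^sub>m n"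
    using c(1-7) by (simp add: mult_smult_distrib[of _ n n _ n] mult_smult_assoc_mat[of _ n n _ n])
  finally show ?thesis using c
    by (intro cong_pairI[of _ n _ S T]) auto
qed

text \<open>The block permutation \<open>S\<close> is unitary, so similarity by \<open>S\<close> and
  congruence by \<open>S\<close> are the same product; the single computation \<open>main\<close>
  therefore treats matrices and forms alike.\<close>

lemma cong_pair_swap:
  assumes "A \<in> carrier_mat a a" "H \<in> carrier_mat a a" "B \<in> carrier_mat b b" "K \<in> carrier_mat b b"
  shows "cong_pair (A \<oplus>\<^sub>m B) (H \<oplus>\<^sub>m K) (B \<oplus>\<^sub>m A) (K \<oplus>\<^sub>m H)"
proof -
  define S :: "complex mat" where "S = four_block_mat (0\<^sub>m a b) (1\<^sub>m a) (1\<^sub>m b) (0\<^sub>m b a)"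
  define T :: "complex mat" where "T = four_block_mat (0\<^sub>m b a) (1\<^sub>m b) (1\<^sub>m a) (0\<^sub>m a b)"
  have ab: "a + b = b + a" by simp
  have S: "S \<in> carrier_mat (a + b) (a + b)" and T: "T \<in> carrier_mat (a + b) (a + b)"
    unfolding S_def T_def by (auto intro!: carrier_matI)
  have adj: "mat_adjoint S = T"
    unfolding S_def T_def by (rule eq_matI) auto
  have ST: "S * T = 1\<^sub>m (a + b)"
    unfolding S_def T_def by (subst mult_four_block_mat[of _ a b _ a _ b _ _ a _ b]) auto
  have TS: "T * S = 1\<^sub>m (a + b)"
    unfolding S_def T_def
    by (subst mult_four_block_mat[of _ b a _ b _ a _ _ b _ a]) (auto simp: ab)
  have main: "T * (X \<oplus>\<^sub>m Y) * S = Y \<oplus>\<^sub>m X"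
    if "X \<in> carrier_mat a a" "Y \<in> carrier_mat b b" for X Y :: "complex mat"
    unfolding S_def T_def mat_dsum_def using that
    by (simp, subst mult_four_block_mat[of _ b a _ b _ a _ _ a _ b], auto)
       (subst mult_four_block_mat[of _ b a _ b _ a _ _ b _ a], auto)
  show ?thesis
    using S T ST TS assms by (intro cong_pairI[of _ "a + b" _ S T]) (auto simp: main adj)
qed

text \<open>Adjacent transpositions generate all permutations: a transitive relation that contains
  them and is stable under adding a common head can move any element past any prefix.\<close>

lemma mset_eq_perm_induct [consumes 1, case_names refl trans swap cons]:
  assumes "mset xs = mset ys"
    and refl: "\<And>xs. P xs xs"
    and trans: "\<And>xs ys zs. P xs ys \<Longrightarrow> P ys zs \<Longrightarrow> P xs zs"
    and swap: "\<And>x y xs. P (x # y # xs) (y # x # xs)"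
    and cons: "\<And>x xs ys. P xs ys \<Longrightarrow> P (x # xs) (x # ys)"
  shows "P xs ys"
proof -
  have move: "P (x # as @ bs) (as @ x # bs)" for x as bs
  proof (induction as)
    case (Cons a as)
    then show ?case using trans[OF swap cons[OF Cons]] by simp
  qed (simp add: refl)
  show ?thesis using assms(1)
  proof (induction xs arbitrary: ys)
    case (Cons x xs)
    then have "x \<in> set ys" by (metis list.set_intros(1) set_mset_mset)
    then obtain as bs where ys: "ys = as @ x # bs" by (meson split_list)
    with Cons have "P xs (as @ bs)" by auto
    then show ?case unfolding ys using trans[OF cons move] by blast
  qed (simp add: refl)
qed

definition square_pairs :: "(complex mat \<times> complex mat) list \<Rightarrow> bool" where
  "square_pairs ps \<longleftrightarrow> (\<forall>(A, H) \<in> set ps. \<exists>n. A \<in> carrier_mat n n \<and> H \<in> carrier_mat n n)"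

lemma square_pairs_Cons [simp]:
  "square_pairs ((A, H) # ps) \<longleftrightarrow> (\<exists>n. A \<in> carrier_mat n n \<and> H \<in> carrier_mat n n) \<and> square_pairs ps"
  "square_pairs []"
  by (auto simp: square_pairs_def)

lemma diag_square_pairs:
  "square_pairs ps \<Longrightarrow> \<exists>n. diag_block_mat (map fst ps) \<in> carrier_mat n n \<and> diag_block_mat (map snd ps) \<in> carrier_mat n n"
proof (induction ps)
  case (Cons p ps)
  then show ?case by (cases p) (auto intro: dsum_carrier)
qed (auto intro: exI[of _ 0])

lemma cong_pair_perm:
  assumes "mset ps = mset qs" "square_pairs ps"
  shows "cong_pair (diag_block_mat (map fst ps)) (diag_block_mat (map snd ps))
    (diag_block_mat (map fst qs)) (diag_block_mat (map snd qs))"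
proof -
  \<comment> \<open>Squareness occurs both as a premise and in the conclusion, because the
    transitivity case has to hand it on to the middle list.\<close>
  have "square_pairs ps \<longrightarrow> square_pairs qs \<and> cong_pair (diag_block_mat (map fst ps)) (diag_block_mat (map snd ps))
    (diag_block_mat (map fst qs)) (diag_block_mat (map snd qs))"
    using assms(1)
  proof (induction rule: mset_eq_perm_induct)
    case (refl xs)
    then show ?case using diag_square_pairs cong_pair_refl by blast
  next
    case (trans xs ys zs)
    then show ?case using cong_pair_trans by blast
  next
    case (swap x y xs)
    show ?case
    proof
      obtain A H B K where [simp]: "x = (A, H)" "y = (B, K)" by (cases x, cases y)
      assume sq: "square_pairs (x # y # xs)"
      then have sq': "square_pairs xs" by auto
      let ?D = "diag_block_mat (map fst xs)" and ?E = "diag_block_mat (map snd xs)"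
      have "cong_pair ((A \<oplus>\<^sub>m B) \<oplus>\<^sub>m ?D) ((H \<oplus>\<^sub>m K) \<oplus>\<^sub>m ?E) ((B \<oplus>\<^sub>m A) \<oplus>\<^sub>m ?D) ((K \<oplus>\<^sub>m H) \<oplus>\<^sub>m ?E)"
        using sq sq' diag_square_pairs[OF sq']
        by (intro cong_pair_dsum[of "_ \<oplus>\<^sub>m _"]) (auto intro: cong_pair_swap cong_pair_refl)
      then show "square_pairs (y # x # xs) \<and>
        cong_pair (diag_block_mat (map fst (x # y # xs))) (diag_block_mat (map snd (x # y # xs)))
          (diag_block_mat (map fst (y # x # xs))) (diag_block_mat (map snd (y # x # xs)))"
        using sq by (simp add: dsum_assoc)
    qed
  next
    case (cons x xs ys)
    then show ?case by (cases x) (auto intro!: cong_pair_dsum cong_pair_refl)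
  qed
  then show ?thesis using assms(2) by blast
qed

section \<open>Selfadjoint roots under change of basis and direct sums\<close>

definition has_root :: "nat \<Rightarrow> complex mat \<Rightarrow> complex mat \<Rightarrow> bool" where
  "has_root m B H \<longleftrightarrow> (\<exists>n A. {A, B, H} \<subseteq> carrier_mat n n \<and> selfadjoint_wrt H A \<and> A ^\<^sub>m m = B)"

lemma has_rootI:
  "A \<in> carrier_mat n n \<Longrightarrow> H \<in> carrier_mat n n \<Longrightarrow> H * A = mat_adjoint A * H \<Longrightarrow> A ^\<^sub>m m = B \<Longrightarrow> has_root m B H"
  unfolding has_root_def selfadjoint_wrt_def by (intro exI[of _ n] exI[of _ A]) auto

lemma has_rootE:
  assumes "has_root m B H"
  obtains n A where "A \<in> carrier_mat n n" "B \<in> carrier_mat n n" "H \<in> carrier_mat n n"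
    "H * A = mat_adjoint A * H" "A ^\<^sub>m m = B"
  using assms unfolding has_root_def selfadjoint_wrt_def by auto

lemma cong_selfadjoint:
  fixes A :: "complex mat"
  assumes "A \<in> carrier_mat n n" "H \<in> carrier_mat n n" "S \<in> carrier_mat n n" "T \<in> carrier_mat n n"
    and ST: "S * T = 1\<^sub>m n" and HA: "H * A = mat_adjoint A * H"
  shows "(mat_adjoint S * H * S) * (T * A * S) = mat_adjoint (T * A * S) * (mat_adjoint S * H * S)"
proof -
  have "(mat_adjoint S * H * S) * (T * A * S) = mat_adjoint S * (H * A) * S"
    using assms(1-4) by (simp add: assoc_mult_mat[of _ n n _ n _ n] cancel_left_mat[OF ST])
  also have "\<dots> = mat_adjoint (T * A * S) * (mat_adjoint S * H * S)"
    unfolding HA using assms(1-4)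
    by (simp add: assoc_mult_mat[of _ n n _ n _ n] adj_mult[of _ n n _ n]
        cancel_left_mat[OF adj_inverse[OF ST]])
  finally show ?thesis .
qed

lemma has_root_cong:
  assumes "cong_pair B H B' H'" "has_root m B H"
  shows "has_root m B' H'"
proof -
  obtain n S T where c: "B \<in> carrier_mat n n" "H \<in> carrier_mat n n" 
    "S \<in> carrier_mat n n" "T \<in> carrier_mat n n"
    and ST: "S * T = 1\<^sub>m n" and TS: "T * S = 1\<^sub>m n"
    and B': "B' = T * B * S" and H': "H' = mat_adjoint S * H * S"
    using assms(1) by (rule cong_pairE)
  obtain n' A where "A \<in> carrier_mat n' n'" "B \<in> carrier_mat n' n'"
    and HA: "H * A = mat_adjoint A * H" and AB: "A ^\<^sub>m m = B"
    using assms(2) by (rule has_rootE)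
  then have A: "A \<in> carrier_mat n n" using c(1) by auto
  show ?thesis
  proof (rule has_rootI[of "T * A * S" n])
    show "H' * (T * A * S) = mat_adjoint (T * A * S) * H'"
      unfolding H' using A c ST HA by (intro cong_selfadjoint[of _ n])
    show "(T * A * S) ^\<^sub>m m = B'"
      unfolding B' AB[symmetric] using A c ST TS by (intro conj_mat_pow)
  qed (use A c H' in auto)
qed

lemma has_root_dsum:
  assumes "has_root m B H" "has_root m C K"
  shows "has_root m (B \<oplus>\<^sub>m C) (H \<oplus>\<^sub>m K)"
proof -
  obtain a A where A: "A \<in> carrier_mat a a" "B \<in> carrier_mat a a" "H \<in> carrier_mat a a"
    "H * A = mat_adjoint A * H" "A ^\<^sub>m m = B" using assms(1) by (rule has_rootE)
  obtain d D where D: "D \<in> carrier_mat d d" "C \<in> carrier_mat d d" "K \<in> carrier_mat d d"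
    "K * D = mat_adjoint D * K" "D ^\<^sub>m m = C" using assms(2) by (rule has_rootE)
  show ?thesis
    using A D by (intro has_rootI[of "A \<oplus>\<^sub>m D" "a + d"])
      (auto simp: dsum_pow dsum_adj dsum_mult[of _ a a _ a _ d d _ d])
qed

lemma has_root_list:
  assumes "\<And>x. x \<in> set xs \<Longrightarrow> has_root m (f x) (g x)"
  shows "has_root m (diag_block_mat (map f xs)) (diag_block_mat (map g xs))"
  using assms
proof (induction xs)
  case Nil
  show ?case by (auto intro!: has_rootI[of "0\<^sub>m 0 0" 0])
qed (auto intro: has_root_dsum)

subsection \<open>The positive index of a Hermitian form on a kernel\<close>

text \<open>Padding \<open>M\<close> with zero rows to a square matrix keeps its kernel. The last
  row of the padded matrix is zero, so its transpose kills the last unit vector, the determinant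
  vanishes, and a nonzero kernel vector exists.\<close>

lemma wide_mat_kernel:
  fixes M :: "complex mat"
  assumes M: "M \<in> carrier_mat q p" and "q < p"
  obtains c where "c \<in> carrier_vec p" "c \<noteq> 0\<^sub>v p" "M *\<^sub>v c = 0\<^sub>v q"
proof -
  define M' where "M' = mat p p (\<lambda>(i, j). if i < q then M $$ (i, j) else 0)"
  have M': "M' \<in> carrier_mat p p" by (simp add: M'_def)
  let ?e = "unit_vec p (p - 1) :: complex vec"
  have "transpose_mat M' *\<^sub>v ?e = 0\<^sub>v p"
  proof (rule eq_vecI)
    fix i assume "i < dim_vec (0\<^sub>v p :: complex vec)"
    then have i: "i < p" by simp
    have "(transpose_mat M' *\<^sub>v ?e) $ i = col M' i \<bullet> ?e" using M' i by simp
    also have "\<dots> = col M' i $ (p - 1)" using M' i by simp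
    also have "\<dots> = 0" using M' i \<open>q < p\<close> by (auto simp: M'_def)
    finally show "(transpose_mat M' *\<^sub>v ?e) $ i = 0\<^sub>v p $ i" using i by simp
  qed (use M' in auto)
  moreover have "?e \<noteq> 0\<^sub>v p" using \<open>q < p\<close> by (intro unit_vec_nonzero) auto
  ultimately have "\<exists>v. v \<in> carrier_vec p \<and> v \<noteq> 0\<^sub>v p \<and> transpose_mat M' *\<^sub>v v = 0\<^sub>v p"
    using unit_vec_carrier by blast
  then have "det (transpose_mat M') = 0"
    using M' det_0_iff_vec_prod_zero[of "transpose_mat M'" p] by simp
  then have "det M' = 0" using det_transpose[OF M'] by simp
  then obtain c where c: "c \<in> carrier_vec p" "c \<noteq> 0\<^sub>v p" "M' *\<^sub>v c = 0\<^sub>v p"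
    using det_0_iff_vec_prod_zero[OF M'] by auto
  have "M *\<^sub>v c = 0\<^sub>v q"
  proof (rule eq_vecI)
    fix i assume "i < dim_vec (0\<^sub>v q :: complex vec)"
    then have i: "i < q" by simp
    then have "row M' i = row M i" using M \<open>q < p\<close> by (intro eq_vecI) (auto simp: M'_def)
    then show "(M *\<^sub>v c) $ i = 0\<^sub>v q $ i"
      using arg_cong[OF c(3), of "\<lambda>v. v $ i"] M M' i \<open>q < p\<close> by simp
  qed (use M in auto)
  with c that show ?thesis by blast
qed

text \<open>This is x* G x, with the real part taken so that the values are ordered; for a Hermitian
  \<open>G\<close> the value is real already.\<close>

definition hform :: "complex mat \<Rightarrow> complex vec \<Rightarrow> real" where
  "hform G x = Re ((G *\<^sub>v x) \<bullet>c x)"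

lemma adj_cscalar_prod:
  fixes A :: "complex mat"
  assumes "A \<in> carrier_mat r c" "u \<in> carrier_vec r" "x \<in> carrier_vec c"
  shows "(mat_adjoint A *\<^sub>v u) \<bullet>c x = u \<bullet>c (A *\<^sub>v x)"
proof -
  have "(mat_adjoint A *\<^sub>v u) \<bullet>c x = (\<Sum>i<c. \<Sum>j<r. cnj (A $$ (j, i)) * u $ j * cnj (x $ i))"
    using assms by (simp add: scalar_prod_def conjugate_vec_def row_def sum_distrib_right lessThan_atLeast0)
  also have "\<dots> = (\<Sum>j<r. \<Sum>i<c. cnj (A $$ (j, i)) * u $ j * cnj (x $ i))"
    by (rule sum.swap)
  also have "\<dots> = u \<bullet>c (A *\<^sub>v x)"
    using assms by (simp add: scalar_prod_def conjugate_vec_def row_def sum_distrib_left lessThan_atLeast0 mult_ac)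
  finally show ?thesis .
qed

lemma hform_cong:
  assumes "G \<in> carrier_mat n n" "S \<in> carrier_mat n n" "x \<in> carrier_vec n"
  shows "hform (mat_adjoint S * G * S) x = hform G (S *\<^sub>v x)"
  using assms adj_cscalar_prod[of S n n "G *\<^sub>v (S *\<^sub>v x)" x]
  by (simp add: hform_def assoc_mult_mat_vec[of _ n n _ n])

lemma hform_dsum:
  assumes "G \<in> carrier_mat n n" "K \<in> carrier_mat k k" "x \<in> carrier_vec n" "y \<in> carrier_vec k"
  shows "hform (G \<oplus>\<^sub>m K) (x @\<^sub>v y) = hform G x + hform K y"
proof -
  have "conjugate (x @\<^sub>v y) = conjugate x @\<^sub>v conjugate y"
    by (rule eq_vecI) (auto simp: conjugate_vec_def)
  moreover have "(G \<oplus>\<^sub>m K) *\<^sub>v (x @\<^sub>v y) = (G *\<^sub>v x) @\<^sub>v (K *\<^sub>v y)"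
    unfolding mat_dsum_def using assms mult_mat_vec_split[of G n K k x y] by simp
  ultimately show ?thesis
    unfolding hform_def using assms by (simp add: scalar_prod_append[of _ n _ k])
qed

lemma dsum_mult_vec:
  fixes A :: "complex mat"
  assumes "A \<in> carrier_mat a b" "B \<in> carrier_mat c d" "x \<in> carrier_vec b" "y \<in> carrier_vec d"
  shows "(A \<oplus>\<^sub>m B) *\<^sub>v (x @\<^sub>v y) = (A *\<^sub>v x) @\<^sub>v (B *\<^sub>v y)"
  unfolding mat_dsum_def using assms
  by (subst four_block_mat_mult_vec[of _ a b _ d _ c]) auto

text \<open>Two certificates pin the index down. The columns of \<open>P\<close> span a positive
  subspace of the kernel, of dimension \<open>p\<close> because a nonzero \<open>c\<close> gives a
  nonzero value. The rows of \<open>F\<close> are \<open>p\<close> linear conditions under which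
  only nonpositive vectors of the kernel survive. With matrices in place of subspaces, one kernel
  argument replaces all dimension counting.\<close>

definition form_index :: "nat \<Rightarrow> complex mat \<Rightarrow> complex mat \<Rightarrow> nat \<Rightarrow> bool" where
  "form_index n M G p \<longleftrightarrow> M \<in> carrier_mat n n \<and> G \<in> carrier_mat n n \<and>
     (\<exists>P \<in> carrier_mat n p. \<forall>c \<in> carrier_vec p. M *\<^sub>v (P *\<^sub>v c) = 0\<^sub>v n \<and>
        (c \<noteq> 0\<^sub>v p \<longrightarrow> 0 < hform G (P *\<^sub>v c))) \<and>
     (\<exists>F \<in> carrier_mat p n. \<forall>x \<in> carrier_vec n. M *\<^sub>v x = 0\<^sub>v n \<longrightarrow> F *\<^sub>v x = 0\<^sub>v p \<longrightarrow>
        hform G x \<le> 0)"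

lemma form_indexI:
  assumes "M \<in> carrier_mat n n" "G \<in> carrier_mat n n" "P \<in> carrier_mat n p" "F \<in> carrier_mat p n"
    and "\<And>c. c \<in> carrier_vec p \<Longrightarrow> M *\<^sub>v (P *\<^sub>v c) = 0\<^sub>v n"
    and "\<And>c. c \<in> carrier_vec p \<Longrightarrow> c \<noteq> 0\<^sub>v p \<Longrightarrow> 0 < hform G (P *\<^sub>v c)"
    and "\<And>x. x \<in> carrier_vec n \<Longrightarrow> M *\<^sub>v x = 0\<^sub>v n \<Longrightarrow> F *\<^sub>v x = 0\<^sub>v p \<Longrightarrow> hform G x \<le> 0"
  shows "form_index n M G p"
  unfolding form_index_def using assms by blast

lemma hform_zero [simp]: "G \<in> carrier_mat n n \<Longrightarrow> hform G (0\<^sub>v n) = 0"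
  by (simp add: hform_def scalar_prod_def)

text \<open>If \<open>p\<close> exceeded \<open>q\<close>, the wide matrix \<open>F * P\<close>
  would annihilate some nonzero \<open>c\<close>, whose image under \<open>P\<close> would be
  positive by hypothesis and nonpositive by the choice of \<open>F\<close>.\<close>

lemma pos_space_le_form_index:
  assumes "form_index n M G q" and P: "P \<in> carrier_mat n p"
    and pos: "\<And>c. c \<in> carrier_vec p \<Longrightarrow> c \<noteq> 0\<^sub>v p \<Longrightarrow> M *\<^sub>v (P *\<^sub>v c) = 0\<^sub>v n \<and> 0 < hform G (P *\<^sub>v c)"
  shows "p \<le> q"
proof (rule ccontr)
  assume "\<not> p \<le> q"
  obtain F where F: "F \<in> carrier_mat q n"
    "\<And>x. x \<in> carrier_vec n \<Longrightarrow> M *\<^sub>v x = 0\<^sub>v n \<Longrightarrow> F *\<^sub>v x = 0\<^sub>v q \<Longrightarrow> hform G x \<le> 0"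
    using assms(1) unfolding form_index_def by blast
  have "F * P \<in> carrier_mat q p" using F P by simp
  then obtain c where c: "c \<in> carrier_vec p" "c \<noteq> 0\<^sub>v p" "(F * P) *\<^sub>v c = 0\<^sub>v q"
    using wide_mat_kernel \<open>\<not> p \<le> q\<close> by (metis not_le)
  then have "F *\<^sub>v (P *\<^sub>v c) = 0\<^sub>v q" using F P by simp
  then have "hform G (P *\<^sub>v c) \<le> 0" using F P c pos[OF c(1,2)] by simp
  with pos[OF c(1,2)] show False by simp
qed

lemma form_index_unique:
  assumes "form_index n M G p" "form_index n M G q"
  shows "p = q"
proof -
  have "p \<le> q" if "form_index n M G p" "form_index n M G q" for p q
  proof -
    from that(1) obtain P where "P \<in> carrier_mat n p"
      "\<forall>c \<in> carrier_vec p. M *\<^sub>v (P *\<^sub>v c) = 0\<^sub>v n \<and> (c \<noteq> 0\<^sub>v p \<longrightarrow> 0 < hform G (P *\<^sub>v c))"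
      unfolding form_index_def by blast
    then show ?thesis by (intro pos_space_le_form_index[OF that(2)]) auto
  qed
  with assms show ?thesis by (meson antisym)
qed

lemma form_index_cong:
  assumes ix: "form_index n M G p" and S: "S \<in> carrier_mat n n" and T: "T \<in> carrier_mat n n"
    and ST: "S * T = 1\<^sub>m n"
  shows "form_index n (T * M * S) (mat_adjoint S * G * S) p"
proof -
  have M: "M \<in> carrier_mat n n" and G: "G \<in> carrier_mat n n"
    using ix by (auto simp: form_index_def)
  obtain P where P: "P \<in> carrier_mat n p"
      "\<And>c. c \<in> carrier_vec p \<Longrightarrow> M *\<^sub>v (P *\<^sub>v c) = 0\<^sub>v n \<and> (c \<noteq> 0\<^sub>v p \<longrightarrow> 0 < hform G (P *\<^sub>v c))"
    using ix unfolding form_index_def by blast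
  obtain F where F: "F \<in> carrier_mat p n"
    "\<And>x. x \<in> carrier_vec n \<Longrightarrow> M *\<^sub>v x = 0\<^sub>v n \<Longrightarrow> F *\<^sub>v x = 0\<^sub>v p \<Longrightarrow> hform G x \<le> 0"
    using ix unfolding form_index_def by blast
  have STv: "S *\<^sub>v (T *\<^sub>v x) = x" if "x \<in> carrier_vec n" for x
    using S T ST that by (simp flip: assoc_mult_mat_vec[of _ n n _ n])
  have eq: "(T * M * S) *\<^sub>v x = T *\<^sub>v (M *\<^sub>v (S *\<^sub>v x))" if "x \<in> carrier_vec n" for x
    using M S T that by (simp add: assoc_mult_mat_vec[of _ n n _ n])
  show ?thesis
  proof (rule form_indexI[of _ _ _ "T * P" _ "F * S"])
    fix c :: "complex vec" assume c: "c \<in> carrier_vec p"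
    have TP: "(T * P) *\<^sub>v c = T *\<^sub>v (P *\<^sub>v c)" using T P c by simp
    have Pc: "P *\<^sub>v c \<in> carrier_vec n" "T *\<^sub>v (P *\<^sub>v c) \<in> carrier_vec n" using P c T by auto
    show "(T * M * S) *\<^sub>v ((T * P) *\<^sub>v c) = 0\<^sub>v n"
      unfolding TP eq[OF Pc(2)] STv[OF Pc(1)] using P(2)[OF c] T by auto
    assume "c \<noteq> 0\<^sub>v p"
    then show "0 < hform (mat_adjoint S * G * S) (T * P *\<^sub>v c)"
      unfolding TP hform_cong[OF G S Pc(2)] STv[OF Pc(1)] using P(2)[OF c] by auto
  next
    fix x assume x: "x \<in> carrier_vec n" "(T * M * S) *\<^sub>v x = 0\<^sub>v n" "F * S *\<^sub>v x = 0\<^sub>v p"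
    have Sx: "S *\<^sub>v x \<in> carrier_vec n" using S x by simp
    have "M *\<^sub>v (S *\<^sub>v x) = S *\<^sub>v (T *\<^sub>v (M *\<^sub>v (S *\<^sub>v x)))" using STv M Sx by simp
    also have "\<dots> = 0\<^sub>v n" using x(2) S unfolding eq[OF x(1)] by auto
    finally show "hform (mat_adjoint S * G * S) x \<le> 0"
      unfolding hform_cong[OF G S x(1)] using F(2)[OF Sx] x(1,3) F(1) S by simp
  qed (use M S T P F G in auto)
qed

lemma form_index_dsum:
  assumes "form_index n M G p" "form_index k N K q"
  shows "form_index (n + k) (M \<oplus>\<^sub>m N) (G \<oplus>\<^sub>m K) (p + q)"
proof -
  have M: "M \<in> carrier_mat n n" and G: "G \<in> carrier_mat n n"
    and N: "N \<in> carrier_mat k k" and K: "K \<in> carrier_mat k k"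
    using assms by (auto simp: form_index_def)
  obtain P where P: "P \<in> carrier_mat n p"
      "\<And>c. c \<in> carrier_vec p \<Longrightarrow> M *\<^sub>v (P *\<^sub>v c) = 0\<^sub>v n \<and> (c \<noteq> 0\<^sub>v p \<longrightarrow> 0 < hform G (P *\<^sub>v c))"
    using assms(1) unfolding form_index_def by blast
  obtain F where F: "F \<in> carrier_mat p n"
    "\<And>x. x \<in> carrier_vec n \<Longrightarrow> M *\<^sub>v x = 0\<^sub>v n \<Longrightarrow> F *\<^sub>v x = 0\<^sub>v p \<Longrightarrow> hform G x \<le> 0"
    using assms(1) unfolding form_index_def by blast
  obtain Q where Q: "Q \<in> carrier_mat k q"
      "\<And>c. c \<in> carrier_vec q \<Longrightarrow> N *\<^sub>v (Q *\<^sub>v c) = 0\<^sub>v k \<and> (c \<noteq> 0\<^sub>v q \<longrightarrow> 0 < hform K (Q *\<^sub>v c))"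
    using assms(2) unfolding form_index_def by blast
  obtain E where E: "E \<in> carrier_mat q k"
    "\<And>x. x \<in> carrier_vec k \<Longrightarrow> N *\<^sub>v x = 0\<^sub>v k \<Longrightarrow> E *\<^sub>v x = 0\<^sub>v q \<Longrightarrow> hform K x \<le> 0"
    using assms(2) unfolding form_index_def by blast
  have zero: "0\<^sub>v (a + b) = (0\<^sub>v a :: complex vec) @\<^sub>v 0\<^sub>v b" for a b
    by (rule eq_vecI) auto
  have P0: "P *\<^sub>v 0\<^sub>v p = 0\<^sub>v n" and Q0: "Q *\<^sub>v 0\<^sub>v q = 0\<^sub>v k"
    using P Q by (auto intro!: eq_vecI)
  show ?thesis
  proof -
    have pos: "\<forall>c \<in> carrier_vec (p + q). (M \<oplus>\<^sub>m N) *\<^sub>v ((P \<oplus>\<^sub>m Q) *\<^sub>v c) = 0\<^sub>v (n + k) \<and>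
      (c \<noteq> 0\<^sub>v (p + q) \<longrightarrow> 0 < hform (G \<oplus>\<^sub>m K) ((P \<oplus>\<^sub>m Q) *\<^sub>v c))"
      unfolding all_vec_append
    proof (intro ballI)
      fix c d :: "complex vec" assume c: "c \<in> carrier_vec p" and d: "d \<in> carrier_vec q"
      have 1: "(P \<oplus>\<^sub>m Q) *\<^sub>v (c @\<^sub>v d) = (P *\<^sub>v c) @\<^sub>v (Q *\<^sub>v d)"
        using P Q c d by (intro dsum_mult_vec) auto
      have 2: "(M \<oplus>\<^sub>m N) *\<^sub>v ((P *\<^sub>v c) @\<^sub>v (Q *\<^sub>v d)) = (M *\<^sub>v (P *\<^sub>v c)) @\<^sub>v (N *\<^sub>v (Q *\<^sub>v d))"
        using P Q c d M N by (intro dsum_mult_vec) auto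
      have 3: "hform (G \<oplus>\<^sub>m K) ((P *\<^sub>v c) @\<^sub>v (Q *\<^sub>v d)) = hform G (P *\<^sub>v c) + hform K (Q *\<^sub>v d)"
        using P Q c d G K by (intro hform_dsum) auto
      \<comment> \<open>One of \<open>c\<close> and \<open>d\<close> may vanish although
        \<open>c @\<^sub>v d\<close> does not. Its summand is then 0, so only the weak bounds hold
        for both.\<close>
      have ge: "0 \<le> hform G (P *\<^sub>v c)" "0 \<le> hform K (Q *\<^sub>v d)"
        using P(2)[OF c] Q(2)[OF d] P0 Q0 hform_zero G K by (metis less_imp_le order_refl)+
      show "(M \<oplus>\<^sub>m N) *\<^sub>v ((P \<oplus>\<^sub>m Q) *\<^sub>v (c @\<^sub>v d)) = 0\<^sub>v (n + k) \<and>
         (c @\<^sub>v d \<noteq> 0\<^sub>v (p + q) \<longrightarrow> 0 < hform (G \<oplus>\<^sub>m K) ((P \<oplus>\<^sub>m Q) *\<^sub>v (c @\<^sub>v d)))"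
        unfolding 1 2 3 using P(2)[OF c] Q(2)[OF d] c d ge by (fastforce simp: zero)
    qed
    have neg: "\<forall>x \<in> carrier_vec (n + k). (M \<oplus>\<^sub>m N) *\<^sub>v x = 0\<^sub>v (n + k) \<longrightarrow>
      (F \<oplus>\<^sub>m E) *\<^sub>v x = 0\<^sub>v (p + q) \<longrightarrow> hform (G \<oplus>\<^sub>m K) x \<le> 0"
      unfolding all_vec_append
    proof (intro ballI impI)
      fix x y assume x: "x \<in> carrier_vec n" and y: "y \<in> carrier_vec k"
        and ker: "(M \<oplus>\<^sub>m N) *\<^sub>v (x @\<^sub>v y) = 0\<^sub>v (n + k)" "(F \<oplus>\<^sub>m E) *\<^sub>v (x @\<^sub>v y) = 0\<^sub>v (p + q)"
      have "(M *\<^sub>v x) @\<^sub>v (N *\<^sub>v y) = 0\<^sub>v n @\<^sub>v 0\<^sub>v k"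
        using ker(1) dsum_mult_vec[OF M N x y] by (simp add: zero)
      then have "M *\<^sub>v x = 0\<^sub>v n" "N *\<^sub>v y = 0\<^sub>v k"
        using append_vec_eq[of "M *\<^sub>v x" n "0\<^sub>v n"] M x by auto
      moreover have "(F *\<^sub>v x) @\<^sub>v (E *\<^sub>v y) = 0\<^sub>v p @\<^sub>v 0\<^sub>v q"
        using ker(2) dsum_mult_vec[OF F(1) E(1) x y] by (simp add: zero)
      then have "F *\<^sub>v x = 0\<^sub>v p" "E *\<^sub>v y = 0\<^sub>v q"
        using append_vec_eq[of "F *\<^sub>v x" p "0\<^sub>v p"] F x by auto
      ultimately show "hform (G \<oplus>\<^sub>m K) (x @\<^sub>v y) \<le> 0"
        using F(2)[OF x] E(2)[OF y] hform_dsum[OF G K x y] by simp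
    qed
    show ?thesis
      by (rule form_indexI[of _ _ _ "P \<oplus>\<^sub>m Q" _ "F \<oplus>\<^sub>m E"]) (use pos neg M N G K P Q F E in auto)
  qed
qed

lemma form_index_injective:
  assumes M: "M \<in> carrier_mat n n" and G: "G \<in> carrier_mat n n" and "det M \<noteq> 0"
  shows "form_index n M G 0"
proof -
  have "x = 0\<^sub>v n" if "x \<in> carrier_vec n" "M *\<^sub>v x = 0\<^sub>v n" for x
    using det_0_iff_vec_prod_zero[OF M] assms(3) that by blast
  then have hx: "hform G x = 0" if "x \<in> carrier_vec n" "M *\<^sub>v x = 0\<^sub>v n" for x
    using that G hform_zero by metis
  have "M *\<^sub>v (0\<^sub>m n 0 *\<^sub>v c) = 0\<^sub>v n" if "c \<in> carrier_vec 0" for c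
  proof -
    have "0\<^sub>m n 0 *\<^sub>v c = 0\<^sub>v n" using that by (intro eq_vecI) (auto simp: scalar_prod_def)
    then show ?thesis using M by (auto intro!: eq_vecI)
  qed
  then show ?thesis
    by (intro form_indexI[of _ _ _ "0\<^sub>m n 0" _ "0\<^sub>m 0 n"]) (use M G hx in auto)
qed

text \<open>On the kernel of \<open>M\<close> the form only involves the coordinates in \<open>{lo..<hi}\<close>, where it is
  \<open>\<epsilon>\<close> times the reversal \<open>a \<mapsto> lo + hi - 1 - a\<close>; the subspaces on which \<open>x\<close> is symmetric,
  respectively antisymmetric under the reversal are definite with opposite signs.\<close>

lemma form_index_antidiag:
  fixes n s i :: nat and \<epsilon> :: int
  defines "hi \<equiv> min n s" defines "lo \<equiv> n + i - hi" defines "w \<equiv> hi - lo"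
  assumes "\<epsilon> = 1 \<or> \<epsilon> = -1"
  shows "form_index n (mat n n (\<lambda>(a, b). if b = a + s then 1 else 0))
    (mat n n (\<lambda>(a, b). if a + b + 1 = n + i then of_int \<epsilon> else 0))
    (if \<epsilon> = 1 then (w + 1) div 2 else w div 2)"
proof -
  define M :: "complex mat" where "M = mat n n (\<lambda>(a, b). if b = a + s then 1 else 0)"
  define G :: "complex mat" where "G = mat n n (\<lambda>(a, b). if a + b + 1 = n + i then of_int \<epsilon> else 0)"
  define p where "p = (if \<epsilon> = 1 then (w + 1) div 2 else w div 2)"
  have \<epsilon>2: "real_of_int \<epsilon> * real_of_int \<epsilon> = 1" using assms(4) by auto
  \<comment> \<open>Since \<open>hi \<le> n\<close>, the subtraction in \<open>lo\<close> is exact,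
    and the reversal about \<open>lo + hi = n + i\<close> preserves \<open>{lo..<hi}\<close>. In
    contrast \<open>w\<close> truncates to 0 when that interval is empty.\<close>
  have lohi: "lo + hi = n + i" "hi \<le> n" "i \<le> lo" "hi \<le> s" by (auto simp: lo_def hi_def)
  have kerM: "M *\<^sub>v x = 0\<^sub>v n \<longleftrightarrow> (\<forall>b. hi \<le> b \<longrightarrow> b < n \<longrightarrow> x $ b = 0)" if x: "x \<in> carrier_vec n" for x
  proof -
    have "(M *\<^sub>v x) $ a = (if a + s < n then x $ (a + s) else 0)" if "a < n" for a
    proof -
      have "(M *\<^sub>v x) $ a = (\<Sum>b<n. if b = a + s then x $ b else 0)"
        using x that by (simp add: M_def scalar_prod_def if_distrib[of "\<lambda>c. c * _"] lessThan_atLeast0 cong: if_cong)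
      also have "\<dots> = (if a + s < n then x $ (a + s) else 0)"
        by (subst sum.delta) auto
      finally show ?thesis .
    qed
    then have 1: "M *\<^sub>v x = 0\<^sub>v n \<longleftrightarrow> (\<forall>a. a + s < n \<longrightarrow> x $ (a + s) = 0)"
      by (subst vec_eq_iff) (auto simp: M_def)
    show ?thesis unfolding 1
    proof
      assume h: "\<forall>a. a + s < n \<longrightarrow> x $ (a + s) = 0"
      show "\<forall>b. hi \<le> b \<longrightarrow> b < n \<longrightarrow> x $ b = 0"
      proof (intro allI impI)
        fix b assume "hi \<le> b" "b < n"
        then have "s \<le> b" by (simp add: hi_def)
        then show "x $ b = 0" using h[rule_format, of "b - s"] \<open>b < n\<close> by simp
      qed
    qed (auto simp: hi_def)
  qed
  have form: "hform G x = of_int \<epsilon> * (\<Sum>a\<in>{lo..<hi}. Re (x $ (lo + hi - 1 - a) * cnj (x $ a)))"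
    if x: "x \<in> carrier_vec n" and ker: "M *\<^sub>v x = 0\<^sub>v n" for x
  proof -
    have 0: "x $ b = 0" if "hi \<le> b" "b < n" for b using kerM[OF x] ker that by auto
    have row: "(G *\<^sub>v x) $ a = (if i \<le> a then of_int \<epsilon> * x $ (n + i - 1 - a) else 0)" if "a < n" for a
    proof -
      have "(G *\<^sub>v x) $ a = (\<Sum>b<n. if a + b + 1 = n + i then of_int \<epsilon> * x $ b else 0)"
        using x that by (simp add: G_def scalar_prod_def if_distrib[of "\<lambda>c. c * _"] lessThan_atLeast0 cong: if_cong)
      also have "\<dots> = (\<Sum>b<n. if b = n + i - 1 - a then of_int \<epsilon> * x $ b else 0)"
        using that by (intro sum.cong) auto
      also have "\<dots> = (if i \<le> a then of_int \<epsilon> * x $ (n + i - 1 - a) else 0)"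
        using that by (subst sum.delta) auto
      finally show ?thesis .
    qed
    have "hform G x = Re (\<Sum>a<n. (G *\<^sub>v x) $ a * cnj (x $ a))"
      unfolding hform_def scalar_prod_def using x by (simp add: conjugate_vec_def lessThan_atLeast0)
    also have "(\<Sum>a<n. (G *\<^sub>v x) $ a * cnj (x $ a)) =
      (\<Sum>a\<in>{lo..<hi}. of_int \<epsilon> * (x $ (lo + hi - 1 - a) * cnj (x $ a)))"
    proof (rule sum.mono_neutral_cong_right)
      show "\<forall>a\<in>{..<n} - {lo..<hi}. (G *\<^sub>v x) $ a * cnj (x $ a) = 0"
      proof
        fix a assume a: "a \<in> {..<n} - {lo..<hi}"
        show "(G *\<^sub>v x) $ a * cnj (x $ a) = 0"
        proof (cases "hi \<le> a")
          case False
          then have "i \<le> a \<longrightarrow> x $ (n + i - 1 - a) = 0" using a lohi by (intro impI 0) auto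
          then show ?thesis using row[of a] a by auto
        qed (use 0[of a] a in auto)
      qed
      show "(G *\<^sub>v x) $ a * cnj (x $ a) = of_int \<epsilon> * (x $ (lo + hi - 1 - a) * cnj (x $ a))"
        if "a \<in> {lo..<hi}" for a
        using row[of a] that lohi by auto
    qed (use lohi in auto)
    finally have "hform G x = (\<Sum>a\<in>{lo..<hi}. Re (of_int \<epsilon> * (x $ (lo + hi - 1 - a) * cnj (x $ a))))"
      by (simp only: Re_sum)
    moreover have "Re (of_int \<epsilon> * z) = of_int \<epsilon> * Re z" for z by simp
    ultimately show ?thesis by (simp only: sum_distrib_left)
  qed
  have sym: "hform G x = of_int \<delta> * of_int \<epsilon> * (\<Sum>a\<in>{lo..<hi}. (cmod (x $ a))\<^sup>2)"
    if x: "x \<in> carrier_vec n" "M *\<^sub>v x = 0\<^sub>v n"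
      and \<delta>: "\<And>a. lo \<le> a \<Longrightarrow> a < hi \<Longrightarrow> x $ (lo + hi - 1 - a) = of_int \<delta> * x $ a" for x \<delta>
  proof -
    have "Re (x $ (lo + hi - 1 - a) * cnj (x $ a)) = of_int \<delta> * (cmod (x $ a))\<^sup>2"
      if "a \<in> {lo..<hi}" for a
      using \<delta>[of a] that by (simp add: cmod_def power2_eq_square algebra_simps)
    then have "(\<Sum>a\<in>{lo..<hi}. Re (x $ (lo + hi - 1 - a) * cnj (x $ a))) =
        of_int \<delta> * (\<Sum>a\<in>{lo..<hi}. (cmod (x $ a))\<^sup>2)"
      by (simp only: sum_distrib_left cong: sum.cong)
    then show ?thesis by (simp only: form[OF x] mult_ac)
  qed
  \<comment> \<open>With a = lo + j and b = hi - 1 - j, column \<open>j\<close> of \<open>P\<close>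
    is e_a + \<epsilon> e_b and row \<open>j\<close> of \<open>F\<close> is the functional x_a +
    \<epsilon> x_b. The middle a = b is reached only for \<epsilon> = 1; there the column is e_a, by
    the order of the tests, and the functional is 2 x_a, which still forces x_a = 0.\<close>
  define P :: "complex mat" where "P = mat n p (\<lambda>(a, j). if a = lo + j then 1 else if a = hi - 1 - j then of_int \<epsilon> else 0)"
  define F :: "complex mat" where "F = mat p n (\<lambda>(j, a). (if a = lo + j then 1 else 0) + (if a = hi - 1 - j then of_int \<epsilon> else 0))"
  have p: "2 * p \<le> w + (if \<epsilon> = 1 then 1 else 0)" "w \<le> 2 * p + (if \<epsilon> = 1 then 0 else 1)"
    unfolding p_def by auto
  have jlt: "lo + j < hi" "lo + j \<le> hi - 1 - j" "\<epsilon> \<noteq> 1 \<Longrightarrow> lo + j < hi - 1 - j" if "j < p" for j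
    using p that by (auto simp: w_def split: if_splits)
  have "form_index n M G p"
  proof (rule form_indexI[of _ _ _ P _ F])
    fix c :: "complex vec" assume c: "c \<in> carrier_vec p"
    let ?x = "P *\<^sub>v c"
    have x: "?x \<in> carrier_vec n" using c by (auto simp: P_def intro!: mult_mat_vec_carrier)
    have xa: "?x $ a = (\<Sum>j<p. P $$ (a, j) * c $ j)" if "a < n" for a
      using that c by (simp add: P_def scalar_prod_def lessThan_atLeast0)
    have xlo: "?x $ (lo + j) = c $ j" if j: "j < p" for j
    proof -
      have n: "lo + j < n" using jlt[OF j] lohi by linarith
      have "P $$ (lo + j, l) = (if l = j then 1 else 0)" if l: "l < p" for l
        using jlt[OF j] jlt[OF l] l n by (auto simp: P_def)
      then have "?x $ (lo + j) = (\<Sum>l<p. if l = j then c $ l else 0)"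
        unfolding xa[OF n] by (intro sum.cong) auto
      with j show ?thesis by simp
    qed
    have refl: "?x $ (lo + hi - 1 - a) = of_int \<epsilon> * ?x $ a" if a: "lo \<le> a" "a < hi" for a
    proof -
      have n: "a < n" "lo + hi - 1 - a < n" using a lohi by auto
      have "P $$ (lo + hi - 1 - a, l) = of_int \<epsilon> * P $$ (a, l)" if l: "l < p" for l
        using jlt[OF l] l n a assms(4) by (auto simp: P_def)
      then show ?thesis unfolding xa[OF n(1)] xa[OF n(2)] sum_distrib_left
        by (intro sum.cong) auto
    qed
    have "?x $ b = 0" if b: "hi \<le> b" "b < n" for b
    proof -
      have "P $$ (b, l) = 0" if l: "l < p" for l
        using jlt[OF l] l b by (auto simp: P_def)
      then show ?thesis unfolding xa[OF b(2)] by simp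
    qed
    then show ker: "M *\<^sub>v ?x = 0\<^sub>v n" unfolding kerM[OF x] by auto
    assume "c \<noteq> 0\<^sub>v p"
    then obtain j where j: "j < p" "c $ j \<noteq> 0"
      using c by (auto simp: vec_eq_iff)
    have "0 < (\<Sum>a\<in>{lo..<hi}. (cmod (?x $ a))\<^sup>2)"
      using j xlo[OF j(1)] jlt[OF j(1)] by (intro sum_pos2[of _ "lo + j"]) auto
    then show "0 < hform G ?x"
      by (simp add: sym[OF x ker refl] \<epsilon>2)
  next
    fix x assume x: "x \<in> carrier_vec n" and ker: "M *\<^sub>v x = 0\<^sub>v n" and F: "F *\<^sub>v x = 0\<^sub>v p"
    have Fj: "x $ (lo + j) + of_int \<epsilon> * x $ (hi - 1 - j) = 0" if j: "j < p" for j
    proof -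
      have n: "lo + j < n" "hi - 1 - j < n" using jlt[OF j] lohi by auto
      have "0 = (F *\<^sub>v x) $ j" using F j by simp
      also have "\<dots> = (\<Sum>a<n. F $$ (j, a) * x $ a)"
        using x j by (simp add: F_def scalar_prod_def lessThan_atLeast0)
      also have "\<dots> = (\<Sum>a<n. (if a = lo + j then x $ a else 0) + (if a = hi - 1 - j then of_int \<epsilon> * x $ a else 0))"
        using j by (intro sum.cong) (auto simp: F_def algebra_simps)
      also have "\<dots> = x $ (lo + j) + of_int \<epsilon> * x $ (hi - 1 - j)"
        using n by (simp add: sum.distrib)
      finally show ?thesis by simp
    qed
    have "x $ (lo + hi - 1 - a) = of_int (- \<epsilon>) * x $ a" if a: "lo \<le> a" "a < hi" for a
    proof -
      \<comment> \<open>Every index is the lower or the upper member of one of the \<open>p\<close>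
        pairs, except for the middle index when \<epsilon> = -1 and \<open>w\<close> is odd; the
        reversal fixes that one, and it counts as negative.\<close>
      consider "a - lo < p" | "hi - 1 - a < p" | "\<epsilon> = -1" "lo + hi - 1 - a = a"
        using a p assms(4) by (fastforce simp: w_def split: if_splits)
      then show ?thesis
      proof cases
        case 1
        have "hi - 1 - (a - lo) = lo + hi - 1 - a" using a by auto
        then show ?thesis using Fj[OF 1] a assms(4) by (auto simp: add_eq_0_iff)
      next
        case 2
        have "lo + (hi - 1 - a) = lo + hi - 1 - a" "hi - 1 - (hi - 1 - a) = a" using a by auto
        then show ?thesis using Fj[OF 2] a assms(4) by (auto simp: add_eq_0_iff)
      qed auto
    qed
    from sym[OF x ker this] have "hform G x = - (\<Sum>a\<in>{lo..<hi}. (cmod (x $ a))\<^sup>2)"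
      using \<epsilon>2 by simp
    then show "hform G x \<le> 0" by (simp add: sum_nonneg)
  qed (auto simp: M_def G_def P_def F_def)
  then show ?thesis unfolding M_def G_def p_def .
qed

subsection \<open>Toeplitz matrices of formal power series\<close>

text \<open>This is the series \<open>f\<close> evaluated at the nilpotent block J_k(0). The map is
  multiplicative, so powers, roots, inverses and commutation of such matrices become questions about
  power series.\<close>

definition toeplitz :: "nat \<Rightarrow> complex fps \<Rightarrow> complex mat" where
  "toeplitz k f = mat k k (\<lambda>(i, j). if i \<le> j then fps_nth f (j - i) else 0)"

lemma toeplitz_carrier [simp]: "toeplitz k f \<in> carrier_mat k k"
  and toeplitz_dim [simp]: "dim_row (toeplitz k f) = k" "dim_col (toeplitz k f) = k"
  by (simp_all add: toeplitz_def)

lemma toeplitz_one [simp]: "toeplitz k 1 = 1\<^sub>m k"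
  by (rule eq_matI) (auto simp: toeplitz_def)

lemma toeplitz_mult: "toeplitz k (f * g) = toeplitz k f * toeplitz k g"
proof (rule eq_matI)
  fix i j assume "i < dim_row (toeplitz k f * toeplitz k g)" "j < dim_col (toeplitz k f * toeplitz k g)"
  then have ij: "i < k" "j < k" by auto
  have "(toeplitz k f * toeplitz k g) $$ (i, j) = (\<Sum>l\<in>{0..<k}. toeplitz k f $$ (i, l) * toeplitz k g $$ (l, j))"
    using ij by (simp add: scalar_prod_def)
  also have "\<dots> = (\<Sum>l\<in>{i..j}. fps_nth f (l - i) * fps_nth g (j - l))"
    using ij by (intro sum.mono_neutral_cong_right) (auto simp: toeplitz_def)
  also have "\<dots> = toeplitz k (f * g) $$ (i, j)"
  proof (cases "i \<le> j")
    case True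
    have "(\<Sum>l\<in>{i..j}. fps_nth f (l - i) * fps_nth g (j - l)) = (\<Sum>l=0..j - i. fps_nth f l * fps_nth g (j - i - l))"
      using True by (intro sum.reindex_bij_witness[of _ "\<lambda>l. l + i" "\<lambda>l. l - i"]) auto
    then show ?thesis using ij True by (simp add: toeplitz_def fps_mult_nth)
  qed (use ij in \<open>simp add: toeplitz_def\<close>)
  finally show "toeplitz k (f * g) $$ (i, j) = (toeplitz k f * toeplitz k g) $$ (i, j)" ..
qed auto

lemma toeplitz_power: "toeplitz k (f ^ m) = toeplitz k f ^\<^sub>m m"
  by (induction m) (simp_all add: power_Suc2 toeplitz_mult del: power_Suc)

lemma toeplitz_commute: "toeplitz k f * toeplitz k g = toeplitz k g * toeplitz k f"
  by (metis toeplitz_mult mult.commute)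

lemma jordan_block_toeplitz: "jordan_block k a = toeplitz k (fps_const a + fps_X)"
  by (rule eq_matI) (auto simp: toeplitz_def jordan_block_def)

definition fps_cnj :: "complex fps \<Rightarrow> complex fps" where
  "fps_cnj f = Abs_fps (\<lambda>n. cnj (fps_nth f n))"

lemma fps_cnj_nth [simp]: "fps_nth (fps_cnj f) n = cnj (fps_nth f n)"
  by (simp add: fps_cnj_def)

lemma fps_cnj_mult: "fps_cnj (f * g) = fps_cnj f * fps_cnj g"
  by (rule fps_ext) (simp add: fps_mult_nth)

lemma fps_cnj_power: "fps_cnj (f ^ m) = fps_cnj f ^ m"
  by (induction m) (auto simp: fps_cnj_mult intro!: fps_ext)

lemma fps_cnj_linear [simp]: "fps_cnj (fps_const a + fps_X) = fps_const (cnj a) + fps_X"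
  by (rule fps_ext) auto

definition fps_of_real :: "real fps \<Rightarrow> complex fps" where
  "fps_of_real f = Abs_fps (\<lambda>n. of_real (fps_nth f n))"

lemma fps_of_real_nth [simp]: "fps_nth (fps_of_real f) n = of_real (fps_nth f n)"
  by (simp add: fps_of_real_def)

lemma fps_of_real_mult: "fps_of_real (f * g) = fps_of_real f * fps_of_real g"
  by (rule fps_ext) (simp add: fps_mult_nth)

lemma fps_of_real_power: "fps_of_real (f ^ m) = fps_of_real f ^ m"
  by (induction m) (auto simp: fps_of_real_mult intro!: fps_ext)

lemma fps_of_real_linear [simp]: "fps_of_real (fps_const a + fps_X) = fps_const (of_real a) + fps_X"
  by (rule fps_ext) auto

lemma fps_cnj_of_real [simp]: "fps_cnj (fps_of_real f) = fps_of_real f"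
  by (rule fps_ext) auto

section \<open>The antidiagonal form\<close>

lemma antidiag_carrier [simp]: "antidiag_mat k \<in> carrier_mat k k"
  and antidiag_dim [simp]: "dim_row (antidiag_mat k) = k" "dim_col (antidiag_mat k) = k"
  by (simp_all add: antidiag_mat_def)

lemma antidiag_mult_index:
  assumes "A \<in> carrier_mat k c" "i < k" "j < c"
  shows "(antidiag_mat k * A) $$ (i, j) = A $$ (k - 1 - i, j)"
proof -
  have "(antidiag_mat k * A) $$ (i, j) = (\<Sum>l\<in>{0..<k}. antidiag_mat k $$ (i, l) * A $$ (l, j))"
    using assms by (simp add: scalar_prod_def)
  also have "\<dots> = (\<Sum>l\<in>{0..<k}. if l = k - 1 - i then A $$ (l, j) else 0)"
    using assms by (intro sum.cong) (auto simp: antidiag_mat_def)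
  also have "\<dots> = A $$ (k - 1 - i, j)" using assms by (subst sum.delta) auto
  finally show ?thesis .
qed

lemma mult_antidiag_index:
  assumes "A \<in> carrier_mat r k" "i < r" "j < k"
  shows "(A * antidiag_mat k) $$ (i, j) = A $$ (i, k - 1 - j)"
proof -
  have "(A * antidiag_mat k) $$ (i, j) = (\<Sum>l\<in>{0..<k}. A $$ (i, l) * antidiag_mat k $$ (l, j))"
    using assms by (simp add: scalar_prod_def)
  also have "\<dots> = (\<Sum>l\<in>{0..<k}. if l = k - 1 - j then A $$ (i, l) else 0)"
    using assms by (intro sum.cong) (auto simp: antidiag_mat_def)
  also have "\<dots> = A $$ (i, k - 1 - j)" using assms by (subst sum.delta) auto
  finally show ?thesis .
qed

lemma antidiag_adj [simp]: "mat_adjoint (antidiag_mat k) = antidiag_mat k"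
  by (rule eq_matI) (auto simp: antidiag_mat_def add_ac)

lemma antidiag_square: "antidiag_mat k * antidiag_mat k = 1\<^sub>m k"
proof (rule eq_matI)
  fix i j assume "i < dim_row (1\<^sub>m k :: complex mat)" "j < dim_col (1\<^sub>m k :: complex mat)"
  then have ij: "i < k" "j < k" by auto
  show "(antidiag_mat k * antidiag_mat k) $$ (i, j) = 1\<^sub>m k $$ (i, j)"
    unfolding antidiag_mult_index[OF antidiag_carrier ij] using ij by (auto simp: antidiag_mat_def)
qed auto

text \<open>Reversing the rows and the columns of a Toeplitz matrix transposes it. The adjoint
  relative to the antidiagonal form therefore only conjugates the coefficients, and real series give
  selfadjoint matrices.\<close>

lemma toeplitz_adj_antidiag: "mat_adjoint (toeplitz k f) * antidiag_mat k = antidiag_mat k * toeplitz k (fps_cnj f)"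
proof (rule eq_matI)
  fix i j assume "i < dim_row (antidiag_mat k * toeplitz k (fps_cnj f))"
    "j < dim_col (antidiag_mat k * toeplitz k (fps_cnj f))"
  then have ij: "i < k" "j < k" by auto
  have "(mat_adjoint (toeplitz k f) * antidiag_mat k) $$ (i, j) = mat_adjoint (toeplitz k f) $$ (i, k - 1 - j)"
    using ij by (intro mult_antidiag_index) auto
  also have "\<dots> = toeplitz k (fps_cnj f) $$ (k - 1 - i, j)"
    using ij by (auto simp: toeplitz_def intro!: arg_cong[of _ _ "\<lambda>n. fps_nth f n"])
  also have "\<dots> = (antidiag_mat k * toeplitz k (fps_cnj f)) $$ (i, j)"
    using ij by (intro antidiag_mult_index[symmetric]) auto
  finally show "(mat_adjoint (toeplitz k f) * antidiag_mat k) $$ (i, j) =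
    (antidiag_mat k * toeplitz k (fps_cnj f)) $$ (i, j)" .
qed auto

lemma fps_root_exists:
  fixes f :: "'a :: field_char_0 fps"
  assumes "0 < m" "r ^ m = fps_nth f 0" "fps_nth f 0 \<noteq> 0"
  obtains g where "g ^ m = f" "fps_nth g 0 = r"
proof -
  obtain l where m: "m = Suc l" using assms(1) by (cases m) auto
  \<comment> \<open>\<open>fps_radical\<close> is given a function that chooses the root of the
    constant coefficient; the constant function prescribes \<open>r\<close>.\<close>
  have "fps_radical (\<lambda>_ _. r) (Suc l) f ^ Suc l = f"
    using power_radical[of f "\<lambda>_ _. r" l] assms unfolding m by simp
  moreover have "fps_nth (fps_radical (\<lambda>_ _. r) (Suc l) f) 0 = r" by simp
  ultimately show thesis using that m by blast
qed

subsection \<open>Roots of blocks with nonzero eigenvalue\<close>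

text \<open>Under these conditions \<open>a\<close> has a real \<open>m\<close>-th root, hence the
  series a + x has a root with real coefficients. Real coefficients are what makes the Toeplitz
  matrix selfadjoint, for either sign \<epsilon>.\<close>

lemma has_root_real_block:
  assumes "0 < m" "a \<noteq> 0" "0 < a \<or> odd m"
  shows "has_root m (jordan_block k (complex_of_real a)) (of_int \<epsilon> \<cdot>\<^sub>m antidiag_mat k)"
proof -
  have "root m a ^ m = a" using assms by (cases "0 < a") (auto simp: odd_real_root_pow)
  then obtain g where g: "g ^ m = fps_const a + fps_X"
    using fps_root_exists[of m "root m a" "fps_const a + fps_X"] assms by auto
  let ?T = "toeplitz k (fps_of_real g)"
  show ?thesis
  proof (rule has_rootI[of ?T k])
    show "of_int \<epsilon> \<cdot>\<^sub>m antidiag_mat k * ?T = mat_adjoint ?T * (of_int \<epsilon> \<cdot>\<^sub>m antidiag_mat k)"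
      by (simp add: mult_smult_assoc_mat[of _ k k _ k] mult_smult_distrib[of _ k k _ k] toeplitz_adj_antidiag)
    show "?T ^\<^sub>m m = jordan_block k (complex_of_real a)"
      unfolding toeplitz_power[symmetric] jordan_block_toeplitz fps_of_real_power[symmetric] g by simp
  qed auto
qed

lemma antidiag_double:
  "antidiag_mat (k + k) = four_block_mat (0\<^sub>m k k) (antidiag_mat k) (antidiag_mat k) (0\<^sub>m k k)"
  by (rule eq_matI) (auto simp: antidiag_mat_def)

lemma complex_root_exists:
  assumes "0 < m" "z \<noteq> 0"
  obtains r :: complex where "r ^ m = z"
proof -
  have "rcis (root m (cmod z)) (Arg z / m) ^ m = z"
    unfolding DeMoivre2 using assms by (simp add: rcis_cmod_Arg)
  then show thesis by (rule that)
qed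

text \<open>The antidiagonal form of size \<open>k + k\<close> pairs the first summand with the
  second, so taking adjoints exchanges the summands and conjugates their series. Any complex root
  series \<open>g\<close> of z + x may thus be used, next to its conjugate. The number
  \<open>z\<close> may be real; negative eigenvalues rely on that case.\<close>

lemma toeplitz_pair_root:
  assumes "0 < m" "z \<noteq> 0"
  obtains A where "A \<in> carrier_mat (k + k) (k + k)"
    "antidiag_mat (k + k) * A = mat_adjoint A * antidiag_mat (k + k)"
    "A ^\<^sub>m m = jordan_block k z \<oplus>\<^sub>m jordan_block k (cnj z)"
proof -
  obtain r where r: "r ^ m = z" using complex_root_exists[OF assms] .
  obtain g where g: "g ^ m = fps_const z + fps_X"
    using fps_root_exists[of m r "fps_const z + fps_X"] assms r by auto
  let ?T = "toeplitz k g" and ?T' = "toeplitz k (fps_cnj g)"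
  let ?Q = "antidiag_mat k"
  show thesis
  proof (rule that[of "?T \<oplus>\<^sub>m ?T'"])
    have 1: "antidiag_mat (k + k) * (?T \<oplus>\<^sub>m ?T') = four_block_mat (0\<^sub>m k k) (?Q * ?T') (?Q * ?T) (0\<^sub>m k k)"
      unfolding antidiag_double mat_dsum_def
      by (simp, subst mult_four_block_mat[of _ k k _ k _ k _ _ k _ k]) auto
    have 2: "mat_adjoint (?T \<oplus>\<^sub>m ?T') * antidiag_mat (k + k) =
        four_block_mat (0\<^sub>m k k) (mat_adjoint ?T * ?Q) (mat_adjoint ?T' * ?Q) (0\<^sub>m k k)"
      unfolding dsum_adj unfolding antidiag_double mat_dsum_def
      by (simp, subst mult_four_block_mat[of _ k k _ k _ k _ _ k _ k]) auto
    have "fps_cnj (fps_cnj g) = g" by (rule fps_ext) auto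
    then show "antidiag_mat (k + k) * (?T \<oplus>\<^sub>m ?T') = mat_adjoint (?T \<oplus>\<^sub>m ?T') * antidiag_mat (k + k)"
      unfolding 1 2 toeplitz_adj_antidiag by simp
    show "(?T \<oplus>\<^sub>m ?T') ^\<^sub>m m = jordan_block k z \<oplus>\<^sub>m jordan_block k (cnj z)"
      by (simp add: dsum_pow[of _ k _ k] toeplitz_power[symmetric] fps_cnj_power[symmetric] g
          jordan_block_toeplitz)
  qed auto
qed

lemma has_root_pair_block:
  assumes "0 < m" "z \<noteq> 0"
  shows "has_root m (jordan_block k z \<oplus>\<^sub>m jordan_block k (cnj z)) (antidiag_mat (k + k))"
  using toeplitz_pair_root[OF assms, of k] by (metis has_rootI antidiag_carrier)

text \<open>The matrix \<open>S\<close> is 1/sqrt 2 times the 2 by 2 array of blocks 1, 1, 1, -1. It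
  is Hermitian and its own inverse, it commutes with every X + X in block diagonal position, and it
  diagonalises the exchange of two copies into the signs 1 and -1. This turns the form of a pair
  block into one positive and one negative block.\<close>

lemma cong_pair_hyperbolic:
  assumes J: "J \<in> carrier_mat k k"
  shows "cong_pair (J \<oplus>\<^sub>m J) (antidiag_mat (k + k)) (J \<oplus>\<^sub>m J) (antidiag_mat k \<oplus>\<^sub>m - antidiag_mat k)"
proof -
  let ?I = "1\<^sub>m k :: complex mat" and ?Q = "antidiag_mat k"
  define c where "c = complex_of_real (1 / sqrt 2)"
  have cc: "c * c = 1 / 2" by (simp add: c_def flip: of_real_mult)
  have cnj: "cnj c = c" by (simp add: c_def)
  define S where "S = four_block_mat (c \<cdot>\<^sub>m ?I) (c \<cdot>\<^sub>m ?I) (c \<cdot>\<^sub>m ?I) (- c \<cdot>\<^sub>m ?I)"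
  have S: "S \<in> carrier_mat (k + k) (k + k)" by (simp add: S_def)
  have adj: "mat_adjoint S = S"
    unfolding S_def by (rule eq_matI) (auto simp: cnj)
  have 1: "S * four_block_mat X Y Z W * S = four_block_mat ((1/2) \<cdot>\<^sub>m (X + Y + Z + W)) ((1/2) \<cdot>\<^sub>m (X - Y + Z - W))
      ((1/2) \<cdot>\<^sub>m (X + Y - Z - W)) ((1/2) \<cdot>\<^sub>m (X - Y - Z + W))"
    if "X \<in> carrier_mat k k" "Y \<in> carrier_mat k k" "Z \<in> carrier_mat k k" "W \<in> carrier_mat k k" for X Y Z W
  proof -
    have L: "(d \<cdot>\<^sub>m ?I) * A = d \<cdot>\<^sub>m A" and R: "A * (d \<cdot>\<^sub>m ?I) = d \<cdot>\<^sub>m A" if "A \<in> carrier_mat k k" for A d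
      using that by (auto simp: mult_smult_assoc_mat[of _ k k _ k] mult_smult_distrib[of _ k k _ k])
    have 2: "S * four_block_mat X Y Z W = four_block_mat (c \<cdot>\<^sub>m X + c \<cdot>\<^sub>m Z) (c \<cdot>\<^sub>m Y + c \<cdot>\<^sub>m W)
        (c \<cdot>\<^sub>m X + (- c) \<cdot>\<^sub>m Z) (c \<cdot>\<^sub>m Y + (- c) \<cdot>\<^sub>m W)"
      unfolding S_def using that
      by (subst mult_four_block_mat[of _ k k _ k _ k _ _ k _ k]) (auto simp: L)
    have "S * four_block_mat X Y Z W * S = four_block_mat (c \<cdot>\<^sub>m (c \<cdot>\<^sub>m X + c \<cdot>\<^sub>m Z) + c \<cdot>\<^sub>m (c \<cdot>\<^sub>m Y + c \<cdot>\<^sub>m W))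
        (c \<cdot>\<^sub>m (c \<cdot>\<^sub>m X + c \<cdot>\<^sub>m Z) + (- c) \<cdot>\<^sub>m (c \<cdot>\<^sub>m Y + c \<cdot>\<^sub>m W))
        (c \<cdot>\<^sub>m (c \<cdot>\<^sub>m X + (- c) \<cdot>\<^sub>m Z) + c \<cdot>\<^sub>m (c \<cdot>\<^sub>m Y + (- c) \<cdot>\<^sub>m W))
        (c \<cdot>\<^sub>m (c \<cdot>\<^sub>m X + (- c) \<cdot>\<^sub>m Z) + (- c) \<cdot>\<^sub>m (c \<cdot>\<^sub>m Y + (- c) \<cdot>\<^sub>m W))"
      unfolding 2 unfolding S_def using that
      by (subst mult_four_block_mat[of _ k k _ k _ k _ _ k _ k]) (auto simp: R)
    also have "\<dots> = four_block_mat ((1/2) \<cdot>\<^sub>m (X + Y + Z + W)) ((1/2) \<cdot>\<^sub>m (X - Y + Z - W))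
      ((1/2) \<cdot>\<^sub>m (X + Y - Z - W)) ((1/2) \<cdot>\<^sub>m (X - Y - Z + W))"
    proof -
      have "c * (c * x + c * z) + c * (c * y + c * w) = (c * c) * (x + y + z + w)"
        "c * (c * x + c * z) - c * (c * y + c * w) = (c * c) * (x - y + z - w)"
        "c * (c * x - c * z) + c * (c * y - c * w) = (c * c) * (x + y - z - w)"
        "c * (c * x - c * z) - c * (c * y - c * w) = (c * c) * (x - y - z + w)" for x y z w
        by (simp_all add: algebra_simps)
      note eqs = this[unfolded cc]
      show ?thesis
        by (rule cong_four_block_mat; rule eq_matI) (use that in \<open>simp_all add: eqs\<close>)
    qed
    finally show ?thesis .
  qed
  have diag: "S * (X \<oplus>\<^sub>m X) * S = X \<oplus>\<^sub>m X" if X: "X \<in> carrier_mat k k" for X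
  proof -
    have "S * (X \<oplus>\<^sub>m X) * S = four_block_mat ((1/2) \<cdot>\<^sub>m (X + 0\<^sub>m k k + 0\<^sub>m k k + X)) ((1/2) \<cdot>\<^sub>m (X - 0\<^sub>m k k + 0\<^sub>m k k - X))
      ((1/2) \<cdot>\<^sub>m (X + 0\<^sub>m k k - 0\<^sub>m k k - X)) ((1/2) \<cdot>\<^sub>m (X - 0\<^sub>m k k - 0\<^sub>m k k + X))"
      using 1[of X "0\<^sub>m k k" "0\<^sub>m k k" X] X by (simp add: mat_dsum_def)
    also have "\<dots> = four_block_mat X (0\<^sub>m k k) (0\<^sub>m k k) X"
      using X by (intro cong_four_block_mat eq_matI) auto
    finally show ?thesis using X by (simp add: mat_dsum_def)
  qed
  have "S * S = S * (?I \<oplus>\<^sub>m ?I) * S" using S by simp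
  also have "\<dots> = 1\<^sub>m (k + k)" unfolding diag[OF one_carrier_mat] by simp
  finally have SS: "S * S = 1\<^sub>m (k + k)" .
  have "S * antidiag_mat (k + k) * S = four_block_mat ((1/2) \<cdot>\<^sub>m (0\<^sub>m k k + ?Q + ?Q + 0\<^sub>m k k)) ((1/2) \<cdot>\<^sub>m (0\<^sub>m k k - ?Q + ?Q - 0\<^sub>m k k))
      ((1/2) \<cdot>\<^sub>m (0\<^sub>m k k + ?Q - ?Q - 0\<^sub>m k k)) ((1/2) \<cdot>\<^sub>m (0\<^sub>m k k - ?Q - ?Q + 0\<^sub>m k k))"
    unfolding antidiag_double by (rule 1) auto
  also have "\<dots> = four_block_mat ?Q (0\<^sub>m k k) (0\<^sub>m k k) (- ?Q)"
    by (intro cong_four_block_mat eq_matI) auto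
  finally have Q: "S * antidiag_mat (k + k) * S = ?Q \<oplus>\<^sub>m - ?Q"
    by (simp add: mat_dsum_def)
  show ?thesis
    by (rule cong_pairI[of _ "k + k" _ S S]) (use J S SS diag[OF J] Q adj in auto)
qed

lemma has_root_hyperbolic_block:
  assumes "0 < m" "a \<noteq> 0"
  shows "has_root m (jordan_block k (complex_of_real a) \<oplus>\<^sub>m jordan_block k (complex_of_real a))
    (antidiag_mat k \<oplus>\<^sub>m - antidiag_mat k)"
  using has_root_cong[OF cong_pair_hyperbolic] has_root_pair_block[of m "of_real a" k] assms by simp

subsection \<open>Linear algebra over the complex numbers\<close>

lemma conjugate_self_eq_0:
  fixes y :: "complex vec"
  assumes "y \<bullet>c y = 0"
  shows "y = 0\<^sub>v (dim_vec y)"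
proof -
  have "y \<bullet>c y = complex_of_real (\<Sum>i<dim_vec y. (cmod (y $ i))\<^sup>2)"
    by (simp add: scalar_prod_def conjugate_vec_def lessThan_atLeast0 complex_norm_square flip: of_real_power)
  with assms have "(\<Sum>i<dim_vec y. (cmod (y $ i))\<^sup>2) = 0"
    by (metis of_real_eq_0_iff)
  then have "\<forall>i<dim_vec y. y $ i = 0" by (subst (asm) sum_nonneg_eq_0_iff) auto
  then show ?thesis by (intro eq_vecI) auto
qed

lemma inj_mat_inverse:
  fixes M :: "complex mat"
  assumes M: "M \<in> carrier_mat n n" and inj: "\<And>v. v \<in> carrier_vec n \<Longrightarrow> M *\<^sub>v v = 0\<^sub>v n \<Longrightarrow> v = 0\<^sub>v n"
  obtains N where "N \<in> carrier_mat n n" "M * N = 1\<^sub>m n" "N * M = 1\<^sub>m n"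
proof -
  have "det M \<noteq> 0" using det_0_iff_vec_prod_zero[OF M] inj by blast
  from det_non_zero_imp_unit[OF M this, unfolded Units_def, of "()"]
  show thesis using that by (auto simp: ring_mat_def)
qed

lemma inverse_imp_inj:
  fixes M :: "complex mat"
  assumes "M \<in> carrier_mat n n" "N \<in> carrier_mat n n" "N * M = 1\<^sub>m n"
    "v \<in> carrier_vec n" "M *\<^sub>v v = 0\<^sub>v n"
  shows "v = 0\<^sub>v n"
proof -
  have "v = (N * M) *\<^sub>v v" using assms by simp
  also have "\<dots> = N *\<^sub>v 0\<^sub>v n" using assms by (subst assoc_mult_mat_vec[of _ n n _ n]) auto
  also have "\<dots> = 0\<^sub>v n" using assms by (intro eq_vecI) auto
  finally show ?thesis .
qed

lemma cscalar_prod_swap: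
  fixes u v :: "complex vec"
  assumes "u \<in> carrier_vec n" "v \<in> carrier_vec n"
  shows "u \<bullet>c v = cnj (v \<bullet>c u)"
  using assms by (simp add: scalar_prod_def conjugate_vec_def mult.commute)

text \<open>A basis of part of the kernel of \<open>W\<close> is grown column by column. The rows of
  \<open>W\<close> and of the adjoint of \<open>Y\<close> together number less than
  \<open>n\<close>, so some nonzero \<open>y\<close> in the kernel of \<open>W\<close> is orthogonal
  to all earlier columns, and orthogonality keeps the columns independent.\<close>

lemma injective_kernel_columns:
  fixes W :: "complex mat"
  assumes W: "W \<in> carrier_mat k n" and "l + k \<le> n"
  shows "\<exists>Y \<in> carrier_mat n l. W * Y = 0\<^sub>m k l \<and> (\<forall>d \<in> carrier_vec l. Y *\<^sub>v d = 0\<^sub>v n \<longrightarrow> d = 0\<^sub>v l)"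
  using assms(2)
proof (induction l)
  case 0
  then show ?case using W by (intro bexI[of _ "0\<^sub>m n 0"]) auto
next
  case (Suc l)
  then obtain Y where Y: "Y \<in> carrier_mat n l" "W * Y = 0\<^sub>m k l"
    and inj: "\<And>d. d \<in> carrier_vec l \<Longrightarrow> Y *\<^sub>v d = 0\<^sub>v n \<Longrightarrow> d = 0\<^sub>v l" by auto
  define R where "R = W @\<^sub>r mat_adjoint Y"
  have adjY: "mat_adjoint Y \<in> carrier_mat l n" using Y by simp
  have R: "R \<in> carrier_mat (k + l) n" unfolding R_def using W adjY by auto
  obtain y where y: "y \<in> carrier_vec n" "y \<noteq> 0\<^sub>v n" "R *\<^sub>v y = 0\<^sub>v (k + l)"
    using wide_mat_kernel[OF R] Suc.prems by auto
  have "W *\<^sub>v y @\<^sub>v mat_adjoint Y *\<^sub>v y = 0\<^sub>v k @\<^sub>v 0\<^sub>v l"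
    using y mat_mult_append[OF W adjY y(1)] unfolding R_def by (auto intro!: eq_vecI)
  then have Wy: "W *\<^sub>v y = 0\<^sub>v k" and Yy: "mat_adjoint Y *\<^sub>v y = 0\<^sub>v l"
    using append_vec_eq[of "W *\<^sub>v y" k "0\<^sub>v k"] W y by auto
  define Z where "Z = mat n (Suc l) (\<lambda>(i, j). if j < l then Y $$ (i, j) else y $ i)"
  have Z: "Z \<in> carrier_mat n (Suc l)" by (simp add: Z_def)
  have "W * Z = 0\<^sub>m k (Suc l)"
  proof (rule eq_matI)
    fix i j assume "i < dim_row (0\<^sub>m k (Suc l) :: complex mat)" "j < dim_col (0\<^sub>m k (Suc l) :: complex mat)"
    then have ij: "i < k" "j < Suc l" by auto
    show "(W * Z) $$ (i, j) = 0\<^sub>m k (Suc l) $$ (i, j)"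
    proof (cases "j < l")
      case True
      then have "col Z j = col Y j" using Y by (intro eq_vecI) (auto simp: Z_def)
      moreover have "(W * Y) $$ (i, j) = 0" unfolding Y(2) using ij True by simp
      then have "row W i \<bullet> col Y j = 0" using ij True W Y(1) by simp
      ultimately show ?thesis using ij W Z by simp
    next
      case False
      then have "col Z j = y" using y ij by (intro eq_vecI) (auto simp: Z_def)
      then show ?thesis using arg_cong[OF Wy, of "\<lambda>v. v $ i"] ij W Z by simp
    qed
  qed (use W Z in auto)
  moreover have "d = 0\<^sub>v (Suc l)" if d: "d \<in> carrier_vec (Suc l)" and 0: "Z *\<^sub>v d = 0\<^sub>v n" for d
  proof -
    define c where "c = vec l (\<lambda>i. d $ i)"
    have c: "c \<in> carrier_vec l" by (simp add: c_def)
    have eq: "Y *\<^sub>v c + d $ l \<cdot>\<^sub>v y = 0\<^sub>v n"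
    proof (rule eq_vecI)
      fix i assume "i < dim_vec (0\<^sub>v n :: complex vec)"
      then have i: "i < n" by simp
      have "0 = (Z *\<^sub>v d) $ i" using 0 i by simp
      also have "\<dots> = (\<Sum>j\<in>{0..<Suc l}. Z $$ (i, j) * d $ j)"
        using Z d i by (simp add: scalar_prod_def)
      also have "\<dots> = (\<Sum>j\<in>{0..<l}. Y $$ (i, j) * d $ j) + y $ i * d $ l"
        using i by (simp add: Z_def)
      also have "\<dots> = (Y *\<^sub>v c + d $ l \<cdot>\<^sub>v y) $ i"
        using Y c i y by (simp add: scalar_prod_def c_def)
      finally show "(Y *\<^sub>v c + d $ l \<cdot>\<^sub>v y) $ i = 0\<^sub>v n $ i" using i by simp
    qed (use Y y in auto)
    have Yc: "Y *\<^sub>v c \<in> carrier_vec n" using Y c by simp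
    have "(mat_adjoint Y *\<^sub>v y) \<bullet>c c = y \<bullet>c (Y *\<^sub>v c)"
      using adj_cscalar_prod[OF Y(1) y(1) c] .
    then have "y \<bullet>c (Y *\<^sub>v c) = 0" using Yy c by simp
    then have orth: "(Y *\<^sub>v c) \<bullet>c y = 0" using cscalar_prod_swap[OF Yc y(1)] by simp
    have "0 = (Y *\<^sub>v c + d $ l \<cdot>\<^sub>v y) \<bullet>c y" using eq y by simp
    also have "\<dots> = d $ l * (y \<bullet>c y)"
      using Yc y orth by (simp add: add_scalar_prod_distrib[of _ n])
    finally have dl: "d $ l = 0" using conjugate_self_eq_0[of y] y by auto
    then have "Y *\<^sub>v c = 0\<^sub>v n" using eq Yc y
      by (metis (no_types) carrier_vecD eq_vecI index_smult_vec(1,2) index_zero_vec mult_zero_left right_zero_vec)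
    then have "c = 0\<^sub>v l" using inj c by simp
    then have c0: "\<forall>i<l. d $ i = 0" unfolding c_def by (metis index_vec index_zero_vec(1))
    show ?thesis
    proof (rule eq_vecI)
      fix i assume "i < dim_vec (0\<^sub>v (Suc l) :: complex vec)"
      then show "d $ i = 0\<^sub>v (Suc l) $ i" using c0 dl by (cases "i = l") auto
    qed (use d in auto)
  qed
  ultimately show ?case using Z by blast
qed

text \<open>Polarisation: on e_i + t e_j the values t = 1 and t = \<i> isolate the sum and the
  difference of the entries at (i, j) and (j, i), once the diagonal is known to vanish.\<close>

lemma quadratic_form_zero:
  fixes M :: "complex mat"
  assumes M: "M \<in> carrier_mat n n" and 0: "\<And>x. x \<in> carrier_vec n \<Longrightarrow> (M *\<^sub>v x) \<bullet>c x = 0"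
  shows "M = 0\<^sub>m n n"
proof (rule eq_matI)
  fix i j assume "i < dim_row (0\<^sub>m n n :: complex mat)" "j < dim_col (0\<^sub>m n n :: complex mat)"
  then have ij: "i < n" "j < n" by auto
  let ?e = "\<lambda>i. unit_vec n i :: complex vec"
  have cu: "conjugate (?e i) = ?e i" for i
    by (rule eq_vecI) (auto simp: conjugate_vec_def unit_vec_def)
  have B: "(M *\<^sub>v ?e b) \<bullet>c ?e a = M $$ (a, b)" if "a < n" "b < n" for a b
    using that M by (simp add: cu)
  have ex: "M $$ (i, i) + t * M $$ (i, j) + cnj t * M $$ (j, i) + t * cnj t * M $$ (j, j) = 0" for t
  proof -
    have "(M *\<^sub>v (?e i + t \<cdot>\<^sub>v ?e j)) \<bullet>c (?e i + t \<cdot>\<^sub>v ?e j) =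
        (M *\<^sub>v ?e i + t \<cdot>\<^sub>v (M *\<^sub>v ?e j)) \<bullet> (?e i + cnj t \<cdot>\<^sub>v ?e j)"
      using M by (simp add: mult_add_distrib_mat_vec[of _ n n] mult_mat_vec[of _ n n]
          conjugate_add_vec[of _ n] conjugate_smult_vec cu)
    also have "\<dots> = M $$ (i, i) + t * M $$ (i, j) + cnj t * M $$ (j, i) + t * cnj t * M $$ (j, j)"
      using M ij B by (simp add: scalar_prod_add_distrib[of _ n] add_scalar_prod_distrib[of _ n] cu algebra_simps)
    finally show ?thesis using 0[of "?e i + t \<cdot>\<^sub>v ?e j"] by simp
  qed
  have "M $$ (i, i) = 0" "M $$ (j, j) = 0" using 0[of "?e i"] 0[of "?e j"] B ij by auto
  with ex[of 1] ex[of \<i>] have "M $$ (i, j) + M $$ (j, i) = 0" "\<i> * (M $$ (i, j) - M $$ (j, i)) = 0"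
    by (auto simp: algebra_simps)
  then have "M $$ (i, j) = 0" by auto
  then show "M $$ (i, j) = 0\<^sub>m n n $$ (i, j)" using ij by simp
qed (use M in auto)

text \<open>The condition holds when A^k and A^(k+1) have the same range, so the least such
  \<open>k\<close> is the size of the largest Jordan block at 0, and it is 0 for an invertible
  matrix. Stated through a commuting \<open>X\<close>, it is an equation between matrices that
  passes to direct sums and to similar matrices.\<close>

definition has_drazin_index :: "complex mat \<Rightarrow> nat \<Rightarrow> bool" where
  "has_drazin_index A k \<longleftrightarrow> (\<exists>n X. A \<in> carrier_mat n n \<and> X \<in> carrier_mat n n \<and> A * X = X * A \<and> A ^\<^sub>m Suc k * X = A ^\<^sub>m k)"

lemma has_drazin_index_add:
  assumes "has_drazin_index A k"
  shows "has_drazin_index A (l + k)"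
proof -
  obtain n X where A: "A \<in> carrier_mat n n" and X: "X \<in> carrier_mat n n" "A * X = X * A"
    and k: "A ^\<^sub>m Suc k * X = A ^\<^sub>m k" using assms unfolding has_drazin_index_def by blast
  have "A ^\<^sub>m Suc (l + k) * X = A ^\<^sub>m l * (A ^\<^sub>m Suc k * X)"
    using A X pow_mat_add[OF A, of l "Suc k"] by (simp add: assoc_mult_mat[of _ n n _ n _ n])
  also have "\<dots> = A ^\<^sub>m (l + k)" unfolding k using pow_mat_add[OF A] by simp
  finally show ?thesis using A X unfolding has_drazin_index_def by blast
qed

lemma has_drazin_index_dsum:
  assumes "has_drazin_index A k" "has_drazin_index B k"
  shows "has_drazin_index (A \<oplus>\<^sub>m B) k"
proof -
  obtain n X where A: "A \<in> carrier_mat n n" and X: "X \<in> carrier_mat n n" "A * X = X * A"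
    "A ^\<^sub>m Suc k * X = A ^\<^sub>m k" using assms(1) unfolding has_drazin_index_def by blast
  obtain b Y where B: "B \<in> carrier_mat b b" and Y: "Y \<in> carrier_mat b b" "B * Y = Y * B"
    "B ^\<^sub>m Suc k * Y = B ^\<^sub>m k" using assms(2) unfolding has_drazin_index_def by blast
  have pc: "A ^\<^sub>m i \<in> carrier_mat n n" "B ^\<^sub>m i \<in> carrier_mat b b" for i using A B by auto
  show ?thesis
    unfolding has_drazin_index_def
  proof (intro exI[of _ "n + b"] exI[of _ "X \<oplus>\<^sub>m Y"] conjI)
    show "(A \<oplus>\<^sub>m B) ^\<^sub>m Suc k * (X \<oplus>\<^sub>m Y) = (A \<oplus>\<^sub>m B) ^\<^sub>m k"
      unfolding dsum_pow[OF A B] dsum_mult[OF pc(1) X(1) pc(2) Y(1)] X(3) Y(3) ..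
    show "(A \<oplus>\<^sub>m B) * (X \<oplus>\<^sub>m Y) = (X \<oplus>\<^sub>m Y) * (A \<oplus>\<^sub>m B)"
      unfolding dsum_mult[OF A X(1) B Y(1)] dsum_mult[OF X(1) A Y(1) B] X(2) Y(2) ..
  qed (use A B X Y in auto)
qed

lemma jordan_block_0_pow: "jordan_block n (0 :: complex) ^\<^sub>m r = mat n n (\<lambda>(i, j). if j = i + r then 1 else 0)"
  unfolding jordan_block_pow
  by (rule eq_matI) (auto simp: power_0_left)

text \<open>A nilpotent block dies at the power \<open>n\<close>, where \<open>X = 0\<close> serves.
  An invertible block has index 0, with \<open>X\<close> the Toeplitz matrix of the inverse
  series.\<close>

lemma has_drazin_index_jordan_block: "has_drazin_index (jordan_block n a) n"
proof (cases "a = 0")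
  case True
  have "jordan_block n (0 :: complex) ^\<^sub>m n = 0\<^sub>m n n"
    unfolding jordan_block_0_pow by (rule eq_matI) auto
  then show ?thesis
    unfolding has_drazin_index_def True
    by (intro exI[of _ n] exI[of _ "0\<^sub>m n n"]) auto
next
  case False
  have "(fps_const a + fps_X) * inverse (fps_const a + fps_X) = (1 :: complex fps)"
    using False by (intro inverse_mult_eq_1') simp
  then have "jordan_block n a * toeplitz n (inverse (fps_const a + fps_X)) = 1\<^sub>m n"
    unfolding jordan_block_toeplitz toeplitz_mult[symmetric] by simp
  moreover from this have "toeplitz n (inverse (fps_const a + fps_X)) * jordan_block n a = 1\<^sub>m n"
    unfolding jordan_block_toeplitz by (metis toeplitz_commute)
  ultimately have "has_drazin_index (jordan_block n a) 0"
    unfolding has_drazin_index_def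
    by (intro exI[of _ n] exI[of _ "toeplitz n (inverse (fps_const a + fps_X))"]) auto
  from has_drazin_index_add[OF this, of n] show ?thesis by simp
qed

lemma has_drazin_index_exists:
  assumes A: "A \<in> carrier_mat n n"
  shows "\<exists>k. has_drazin_index A k"
proof -
  obtain n_as where "jordan_nf A n_as"
    using char_poly_factorized[OF A] jordan_nf_exists[OF A] by blast
  then have "similar_mat A (jordan_matrix n_as)" by (simp add: jordan_nf_def)
  then obtain P Q where PQ: "similar_mat_wit A (jordan_matrix n_as) P Q" by (auto simp: similar_mat_def)
  define J where "J = jordan_matrix n_as"
  have c: "J \<in> carrier_mat n n" "P \<in> carrier_mat n n" "Q \<in> carrier_mat n n"
    and inv: "P * Q = 1\<^sub>m n" "Q * P = 1\<^sub>m n" and AJ: "A = P * J * Q"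
    using similar_mat_witD2[OF A PQ] by (auto simp: J_def)
  have "\<exists>k. has_drazin_index (jordan_matrix xs) k" for xs
  proof (induction xs)
    case Nil
    show ?case
      by (rule exI[of _ 0]) (auto simp: has_drazin_index_def jordan_matrix_def intro!: exI[of _ 0] exI[of _ "0\<^sub>m 0 0"])
  next
    case (Cons x xs)
    obtain m a where x: "x = (m, a)" by (cases x)
    from Cons obtain k where k: "has_drazin_index (jordan_matrix xs) k" by blast
    \<comment> \<open>Direct sums require one exponent for both parts, so both indices are raised to
      their sum.\<close>
    have "has_drazin_index (jordan_block m a) (k + m)" "has_drazin_index (jordan_matrix xs) (m + k)"
      using has_drazin_index_add has_drazin_index_jordan_block k by blast+
    then have "has_drazin_index (jordan_block m a \<oplus>\<^sub>m jordan_matrix xs) (m + k)"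
      using has_drazin_index_dsum by (simp add: add.commute)
    then show ?case by (auto simp: x jordan_matrix_def)
  qed
  then obtain k X where X: "X \<in> carrier_mat n n" "J * X = X * J" "J ^\<^sub>m Suc k * X = J ^\<^sub>m k"
    unfolding has_drazin_index_def J_def using c(1)[unfolded J_def] by (metis carrier_matD(1))
  have pow: "A ^\<^sub>m i = P * J ^\<^sub>m i * Q" for i
    unfolding AJ using c inv by (intro conj_mat_pow) auto
  have conj: "(P * M * Q) * (P * N * Q) = P * (M * N) * Q" if "M \<in> carrier_mat n n" "N \<in> carrier_mat n n" for M N
    using c that by (simp add: assoc_mult_mat[of _ n n _ n _ n] cancel_left_mat[OF inv(2)])
  have "A * (P * X * Q) = (P * X * Q) * A"
    unfolding AJ using conj[OF c(1) X(1)] conj[OF X(1) c(1)] X(2) by simp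
  moreover have "A ^\<^sub>m Suc k * (P * X * Q) = A ^\<^sub>m k"
    unfolding pow using conj[of "J ^\<^sub>m Suc k" X] X c(1) by simp
  ultimately show ?thesis
    unfolding has_drazin_index_def using A c X(1)
    by (intro exI[of _ k] exI[of _ n] exI[of _ "P * X * Q"]) auto
qed

subsection \<open>Splitting off the nilpotent part\<close>

lemma sq_mult_vec_carrier [simp]:
  "A \<in> carrier_mat n n \<Longrightarrow> x \<in> carrier_vec n \<Longrightarrow> A *\<^sub>v x \<in> carrier_vec n"
  by (rule mult_mat_vec_carrier)

lemma selfadjoint_pow:
  fixes A H :: "complex mat"
  assumes A: "A \<in> carrier_mat n n" and H: "H \<in> carrier_mat n n" and HA: "H * A = mat_adjoint A * H"
  shows "H * A ^\<^sub>m j = mat_adjoint (A ^\<^sub>m j) * H"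
proof (induction j)
  case (Suc j)
  have "H * A ^\<^sub>m Suc j = (H * A ^\<^sub>m j) * A" using A H by (simp add: assoc_mult_mat[of _ n n _ n _ n])
  also have "\<dots> = mat_adjoint (A ^\<^sub>m j) * (H * A)" unfolding Suc using A H by (simp add: assoc_mult_mat[of _ n n _ n _ n])
  also have "\<dots> = mat_adjoint (A * A ^\<^sub>m j) * H"
    unfolding HA using A H by (simp add: adj_mult[of _ n n _ n] assoc_mult_mat[of _ n n _ n _ n])
  also have "A * A ^\<^sub>m j = A ^\<^sub>m Suc j" using pow_mat_Suc_left[OF A] by simp
  finally show ?case .
qed (use A H in auto)

text \<open>With \<open>X\<close> a Drazin inverse of \<open>A\<close> and \<open>Q = 1 - A X\<close>, the range of \<open>Q\<close> lies in the kernel of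
  \<open>A\<^sup>k\<close>. If the form \<open>x\<^sup>* H A\<^sup>k\<^sup>-\<^sup>1 x\<close> vanished on that range, then \<open>A\<^sup>k\<^sup>-\<^sup>1 Q\<^sup># Q = 0\<close> with
  \<open>Q\<^sup>#\<close> the \<open>H\<close>-adjoint of \<open>Q\<close>, so that \<open>k - 1\<close> would be a Drazin index as well.\<close>

lemma nonisotropic_vector_exists:
  fixes A H :: "complex mat"
  assumes A: "A \<in> carrier_mat n n" and H: "H \<in> carrier_mat n n"
    and K: "K \<in> carrier_mat n n" "H * K = 1\<^sub>m n" "K * H = 1\<^sub>m n"
    and HA: "H * A = mat_adjoint A * H"
    and idx: "has_drazin_index A (Suc k)" and min: "\<not> has_drazin_index A k"
  obtains x where "x \<in> carrier_vec n" "A ^\<^sub>m Suc k *\<^sub>v x = 0\<^sub>v n" "(H *\<^sub>v (A ^\<^sub>m k *\<^sub>v x)) \<bullet>c x \<noteq> 0"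
proof -
  note assoc = assoc_mult_mat[of _ n n _ n _ n]
  obtain X where X: "X \<in> carrier_mat n n" and AX: "A * X = X * A" and dr: "A ^\<^sub>m Suc (Suc k) * X = A ^\<^sub>m Suc k"
    using idx A unfolding has_drazin_index_def by (metis carrier_matD(1))
  \<comment> \<open>\<open>Y\<close> is the \<open>H\<close>-adjoint of \<open>X\<close>, so it
    commutes with the selfadjoint \<open>A\<close> as well; likewise \<open>P\<close> below is the
    \<open>H\<close>-adjoint of \<open>Q\<close>.\<close>
  define Y where "Y = K * mat_adjoint X * H"
  have Y: "Y \<in> carrier_mat n n" using K H X by (simp add: Y_def)
  have adjA: "mat_adjoint A = H * A * K"
    using A H K by (simp add: HA assoc)
  have HK: "K * (H * M) = M" "H * (K * M) = M" if "M \<in> carrier_mat n n" for M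
    using cancel_left_mat[OF K(3) K(1) H that] cancel_left_mat[OF K(2) H K(1) that] by auto
  have adjAX: "mat_adjoint A * mat_adjoint X = mat_adjoint X * mat_adjoint A"
    using arg_cong[OF AX, of mat_adjoint] A X by (simp add: adj_mult[of _ n n _ n])
  have AY: "A * Y = Y * A"
  proof -
    have "A * Y = K * (H * A * K) * mat_adjoint X * H"
      unfolding Y_def using A X H K by (simp add: assoc HK)
    also have "\<dots> = K * (mat_adjoint A * mat_adjoint X) * H"
      unfolding adjA[symmetric] using A X H K by (simp add: assoc)
    also have "\<dots> = K * mat_adjoint X * (mat_adjoint A * H)"
      unfolding adjAX using A X H K by (simp add: assoc)
    also have "\<dots> = Y * A" unfolding HA[symmetric] Y_def using A X H K by (simp add: assoc)
    finally show ?thesis .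
  qed
  have HY: "H * Y = mat_adjoint X * H"
    unfolding Y_def using H K X by (simp add: assoc HK)
  define Q where "Q = 1\<^sub>m n - A * X"
  define P where "P = 1\<^sub>m n - A * Y"
  have Q: "Q \<in> carrier_mat n n" and P: "P \<in> carrier_mat n n"
    unfolding Q_def P_def using A X Y by (auto intro!: minus_carrier_mat)
  have comm: "A ^\<^sub>m j * Y = Y * A ^\<^sub>m j" "A ^\<^sub>m j * X = X * A ^\<^sub>m j" for j
    using pow_mat_commute[OF A Y AY] pow_mat_commute[OF A X AX] by auto
  have AQ: "A ^\<^sub>m Suc k * Q = 0\<^sub>m n n"
  proof -
    have "A ^\<^sub>m Suc k * Q = A ^\<^sub>m Suc k * 1\<^sub>m n - A ^\<^sub>m Suc k * (A * X)"
      unfolding Q_def using A X by (intro mult_minus_distrib_mat[of _ n n _ n]) auto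
    also have "A ^\<^sub>m Suc k * (A * X) = A ^\<^sub>m Suc (Suc k) * X"
      using A X by (simp add: assoc)
    finally show ?thesis unfolding dr using A by simp
  qed
  have HP: "mat_adjoint Q * H = H * P"
  proof -
    have "mat_adjoint Q = 1\<^sub>m n - mat_adjoint X * mat_adjoint A"
      unfolding Q_def using A X by (subst adj_minus[of _ n n]) (auto simp: adj_mult[of _ n n _ n])
    then have "mat_adjoint Q * H = H - mat_adjoint X * (mat_adjoint A * H)"
      using A X H by (simp add: minus_mult_distrib_mat[of _ n n _ _ n] assoc)
    also have "mat_adjoint X * (mat_adjoint A * H) = H * Y * A"
      unfolding HA[symmetric] HY using A X H by (simp add: assoc)
    also have "H * Y * A = H * (A * Y)" unfolding AY using A H Y by (simp add: assoc)
    finally show ?thesis unfolding P_def using A H Y by (simp add: mult_minus_distrib_mat[of _ n n _ n])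
  qed
  show thesis
  proof (rule ccontr)
    assume no: "\<not> thesis"
    note found = that
    have zero: "(mat_adjoint Q * (H * (A ^\<^sub>m k * Q)) *\<^sub>v z) \<bullet>c z = 0" if z: "z \<in> carrier_vec n" for z
    proof -
      have "A ^\<^sub>m Suc k *\<^sub>v (Q *\<^sub>v z) = (A ^\<^sub>m Suc k * Q) *\<^sub>v z"
        using A Q z by (simp add: assoc_mult_mat_vec[of _ n n _ n])
      also have "\<dots> = 0\<^sub>v n" unfolding AQ using z by (auto intro!: eq_vecI)
      finally have "(H *\<^sub>v (A ^\<^sub>m k *\<^sub>v (Q *\<^sub>v z))) \<bullet>c (Q *\<^sub>v z) = 0"
        using no found[of "Q *\<^sub>v z"] Q z by fastforce
      then have "(mat_adjoint Q *\<^sub>v (H *\<^sub>v (A ^\<^sub>m k *\<^sub>v (Q *\<^sub>v z)))) \<bullet>c z = 0"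
        using adj_cscalar_prod[of Q n n "H *\<^sub>v (A ^\<^sub>m k *\<^sub>v (Q *\<^sub>v z))" z] A Q H z by simp
      then show ?thesis using A Q H z by (simp add: assoc_mult_mat_vec[of _ n n _ n])
    qed
    have "mat_adjoint Q * (H * (A ^\<^sub>m k * Q)) = 0\<^sub>m n n"
      using quadratic_form_zero[OF _ zero] A Q H by simp
    moreover have "mat_adjoint Q * (H * (A ^\<^sub>m k * Q)) = H * (P * (A ^\<^sub>m k * Q))"
      using HP A Q H P by (simp flip: assoc)
    ultimately have "K * (H * (P * (A ^\<^sub>m k * Q))) = 0\<^sub>m n n"
      using K by simp
    then have PAQ: "P * (A ^\<^sub>m k * Q) = 0\<^sub>m n n" using HK(1)[of "P * (A ^\<^sub>m k * Q)"] A P Q by simp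
    define B where "B = A ^\<^sub>m k"
    have B: "B \<in> carrier_mat n n" using A by (simp add: B_def)
    \<comment> \<open>Expanding (1 - A Y) A^k (1 - A X) = 0 and collecting the multiples of A^(k+1)
      gives A^k = A^(k+1) Z for this \<open>Z\<close>.\<close>
    define Z where "Z = X + Y - A * Y * X"
    have Z: "Z \<in> carrier_mat n n" unfolding Z_def using A X Y by (intro minus_carrier_mat) simp
    have AB: "A * B = B * A" unfolding B_def using pow_mat_Suc_left[OF A] by simp
    have s1: "P * (B * Q) = (B * Q) - A * Y * (B * Q)"
      unfolding P_def using A Y B Q by (simp add: minus_mult_distrib_mat[of _ n n _ _ n])
    have s2: "B * Q = B - B * (A * X)"
      unfolding Q_def using A X B by (simp add: mult_minus_distrib_mat[of _ n n _ n])
    have s3: "A * Y * (B - B * (A * X)) = A * Y * B - A * Y * (B * (A * X))"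
      using A X Y B by (intro mult_minus_distrib_mat[of _ n n _ n]) auto
    have e: "0\<^sub>m n n = B - B * (A * X) - (A * Y * B - A * Y * (B * (A * X)))"
      using s1 unfolding PAQ[folded B_def] unfolding s2 s3 .
    have YB: "Y * B = B * Y" using comm(1)[of k] by (simp add: B_def)
    have 1: "A * Y * B = B * A * Y"
    proof -
      have "A * Y * B = A * (Y * B)" using A Y B by (simp add: assoc)
      also have "\<dots> = (A * B) * Y" unfolding YB using A Y B by (simp add: assoc)
      finally show ?thesis unfolding AB .
    qed
    have 2: "A * Y * (B * (A * X)) = B * A * (A * Y * X)"
    proof -
      have "A * Y * (B * (A * X)) = (A * Y * B) * (A * X)" using A X Y B by (simp add: assoc)
      also have "\<dots> = B * A * (Y * A) * X" unfolding 1 using A X Y B by (simp add: assoc)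
      also have "\<dots> = B * A * (A * Y * X)" unfolding AY[symmetric] using A X Y B by (simp add: assoc)
      finally show ?thesis .
    qed
    have "B * A * Z = B * A * X + B * A * Y - B * A * (A * Y * X)"
      unfolding Z_def using A X Y B
      by (simp add: mult_minus_distrib_mat[of _ n n _ n] mult_add_distrib_mat[of _ n n _ n])
    also have "\<dots> = B"
    proof (rule eq_matI)
      fix i j assume "i < dim_row B" "j < dim_col B"
      then have ij: "i < n" "j < n" using B by auto
      define b1 where "b1 = B * (A * X)"
      define b2 where "b2 = B * A * Y"
      define b3 where "b3 = B * A * (A * Y * X)"
      have c: "b1 \<in> carrier_mat n n" "b2 \<in> carrier_mat n n" "b3 \<in> carrier_mat n n"
        using A X Y B by (auto simp: b1_def b2_def b3_def)
      have "B * A * X = b1" using A X B by (simp add: b1_def assoc)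
      moreover have "0\<^sub>m n n = B - b1 - (b2 - b3)"
        using e unfolding 1 2 b1_def b2_def b3_def .
      then have "(B - b1 - (b2 - b3)) $$ (i, j) = 0" using ij by (metis index_zero_mat(1))
      ultimately show "(B * A * X + B * A * Y - B * A * (A * Y * X)) $$ (i, j) = B $$ (i, j)"
        using ij c B unfolding b2_def[symmetric] b3_def[symmetric] by (simp add: algebra_simps)
    qed (use A X Y B in auto)
    finally have "A ^\<^sub>m Suc k * Z = A ^\<^sub>m k" by (simp add: B_def)
    moreover have "A * Z = Z * A"
    proof -
      have "A * (A * Y * X) = (A * Y * X) * A"
      proof -
        have "(A * Y * X) * A = A * Y * (A * X)" unfolding AX using A X Y by (simp add: assoc)
        also have "\<dots> = A * (Y * A) * X" using A X Y by (simp add: assoc)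
        also have "\<dots> = A * (A * Y * X)" unfolding AY[symmetric] using A X Y by (simp add: assoc)
        finally show ?thesis ..
      qed
      moreover have "A * Z = A * X + A * Y - A * (A * Y * X)"
        unfolding Z_def using A X Y by (simp add: mult_minus_distrib_mat[of _ n n _ n] mult_add_distrib_mat[of _ n n _ n])
      moreover have "Z * A = X * A + Y * A - A * Y * X * A"
        unfolding Z_def using A X Y by (simp add: minus_mult_distrib_mat[of _ n n _ _ n] add_mult_distrib_mat[of _ n n _ _ n])
      ultimately show ?thesis unfolding AX AY by simp
    qed
    ultimately have "has_drazin_index A k"
      unfolding has_drazin_index_def using A Z by blast
    with min show False ..
  qed
qed

section \<open>A Jordan chain normalised for the form\<close>

lemma quadratic_value_real:
  fixes M :: "complex mat"
  assumes M: "M \<in> carrier_mat n n" "mat_adjoint M = M" and x: "x \<in> carrier_vec n"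
  shows "(M *\<^sub>v x) \<bullet>c x = of_real (Re ((M *\<^sub>v x) \<bullet>c x))"
proof -
  have "(M *\<^sub>v x) \<bullet>c x = x \<bullet>c (M *\<^sub>v x)"
    using adj_cscalar_prod[OF M(1) x x] M(2) by simp
  also have "\<dots> = cnj ((M *\<^sub>v x) \<bullet>c x)" using M x by (intro cscalar_prod_swap) auto
  finally show ?thesis by (simp add: complex_eq_iff)
qed

text \<open>Because \<open>A\<close> is selfadjoint, the form on A^a x and A^b x depends on a + b
  only, so the Gram matrix of the chain is the antidiagonal matrix times the Toeplitz matrix of a
  real series \<Gamma>. The hypothesis \<open>nz\<close> says that \<Gamma> has nonzero constant
  coefficient. Multiplying the chain by the Toeplitz matrix of a series \<open>p\<close> keeps it a
  chain, and p^2 = \<epsilon> / \<Gamma> reduces the Gram matrix to \<epsilon> times the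
  antidiagonal one.\<close>

lemma jordan_chain_exists:
  fixes A H :: "complex mat"
  assumes A: "A \<in> carrier_mat n n" and H: "H \<in> carrier_mat n n" and herm: "mat_adjoint H = H"
    and HA: "H * A = mat_adjoint A * H"
    and x: "x \<in> carrier_vec n" and ker: "A ^\<^sub>m Suc k *\<^sub>v x = 0\<^sub>v n" and nz: "(H *\<^sub>v (A ^\<^sub>m k *\<^sub>v x)) \<bullet>c x \<noteq> 0"
  obtains X \<epsilon> where "X \<in> carrier_mat n (Suc k)" "\<epsilon> \<in> {1, -1}" "A * X = X * jordan_block (Suc k) 0"
    "mat_adjoint X * H * X = of_int \<epsilon> \<cdot>\<^sub>m antidiag_mat (Suc k)"
proof -
  define g where "g j = (H *\<^sub>v (A ^\<^sub>m j *\<^sub>v x)) \<bullet>c x" for j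
  have g_real: "g j = of_real (Re (g j))" for j
  proof -
    have "mat_adjoint (H * A ^\<^sub>m j) = H * A ^\<^sub>m j"
      using A H selfadjoint_pow[OF A H HA] by (simp add: adj_mult[of _ n n _ n] herm)
    then show ?thesis using quadratic_value_real[of "H * A ^\<^sub>m j" n x] A H x
      by (simp add: g_def assoc_mult_mat_vec[of _ n n _ n])
  qed
  have powv: "A ^\<^sub>m i *\<^sub>v (A ^\<^sub>m j *\<^sub>v x) = A ^\<^sub>m (i + j) *\<^sub>v x" for i j
    using A x by (simp add: pow_mat_add[OF A] assoc_mult_mat_vec[of _ n n _ n])
  have ker': "A ^\<^sub>m j *\<^sub>v x = 0\<^sub>v n" if "k < j" for j
  proof -
    have "j = (j - Suc k) + Suc k" using that by simp
    then have "A ^\<^sub>m j *\<^sub>v x = A ^\<^sub>m (j - Suc k) *\<^sub>v (A ^\<^sub>m Suc k *\<^sub>v x)" using powv by metis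
    also have "\<dots> = 0\<^sub>v n" unfolding ker using A by (intro eq_vecI) auto
    finally show ?thesis .
  qed
  have g0: "g j = 0" if "k < j" for j
  proof -
    have "H *\<^sub>v 0\<^sub>v n = 0\<^sub>v n" using H by (intro eq_vecI) auto
    then show ?thesis using ker'[OF that] x by (simp add: g_def)
  qed
  \<comment> \<open>The powers decrease from left to right: \<open>A\<close> sends each column to
    its left neighbour and kills column 0, as an upper triangular Jordan block requires.\<close>
  define X0 where "X0 = mat n (Suc k) (\<lambda>(r, j). (A ^\<^sub>m (k - j) *\<^sub>v x) $ r)"
  have X0: "X0 \<in> carrier_mat n (Suc k)" by (simp add: X0_def)
  have col: "col X0 j = A ^\<^sub>m (k - j) *\<^sub>v x" if "j < Suc k" for j
    using that A by (intro eq_vecI) (auto simp: X0_def)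
  have AX0: "A * X0 = X0 * jordan_block (Suc k) 0"
  proof (rule eq_matI)
    fix i j assume "i < dim_row (X0 * jordan_block (Suc k) 0)" "j < dim_col (X0 * jordan_block (Suc k) 0)"
    then have ij: "i < n" "j < Suc k" using X0 by auto
    have "(A * X0) $$ (i, j) = (A *\<^sub>v col X0 j) $ i" using ij A X0 by simp
    also have "A *\<^sub>v col X0 j = A ^\<^sub>m (Suc (k - j)) *\<^sub>v x"
      unfolding col[OF ij(2)] using powv[of 1 "k - j"] A by simp
    also have "\<dots> $ i = (if j = 0 then 0 else X0 $$ (i, j - 1))"
      using ij ker by (auto simp: X0_def Suc_diff_le simp del: pow_mat.simps intro!: arg_cong[of _ _ "\<lambda>m. (A ^\<^sub>m m *\<^sub>v x) $ i"])
    also have "\<dots> = (\<Sum>l\<in>{0..<Suc k}. if l = j - 1 then (if j = 0 then 0 else X0 $$ (i, l)) else 0)"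
      using ij by (subst sum.delta) auto
    also have "\<dots> = (\<Sum>l\<in>{0..<Suc k}. X0 $$ (i, l) * jordan_block (Suc k) 0 $$ (l, j))"
      using ij by (intro sum.cong) auto
    also have "\<dots> = (X0 * jordan_block (Suc k) 0) $$ (i, j)"
      using ij X0 by (simp add: scalar_prod_def)
    finally show "(A * X0) $$ (i, j) = (X0 * jordan_block (Suc k) 0) $$ (i, j)" .
  qed (use A X0 in auto)
  \<comment> \<open>A Toeplitz matrix of size k + 1 sees only the coefficients up to
    \<open>k\<close>; the others are set to 0.\<close>
  define \<Gamma> where "\<Gamma> = Abs_fps (\<lambda>l. if l \<le> k then Re (g (k - l)) else 0)"
  have gram: "mat_adjoint X0 * H * X0 = antidiag_mat (Suc k) * toeplitz (Suc k) (fps_of_real \<Gamma>)"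
  proof (rule eq_matI)
    fix i j assume "i < dim_row (antidiag_mat (Suc k) * toeplitz (Suc k) (fps_of_real \<Gamma>))"
      "j < dim_col (antidiag_mat (Suc k) * toeplitz (Suc k) (fps_of_real \<Gamma>))"
    then have ij: "i < Suc k" "j < Suc k" by auto
    have adjpow: "(H *\<^sub>v (A ^\<^sub>m a *\<^sub>v x)) \<bullet>c (A ^\<^sub>m b *\<^sub>v x) = g (a + b)" for a b
    proof -
      have "(H *\<^sub>v (A ^\<^sub>m a *\<^sub>v x)) \<bullet>c (A ^\<^sub>m b *\<^sub>v x) = (mat_adjoint (A ^\<^sub>m b) *\<^sub>v (H *\<^sub>v (A ^\<^sub>m a *\<^sub>v x))) \<bullet>c x"
        using A H x by (intro adj_cscalar_prod[symmetric]) auto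
      also have "mat_adjoint (A ^\<^sub>m b) *\<^sub>v (H *\<^sub>v (A ^\<^sub>m a *\<^sub>v x)) = (mat_adjoint (A ^\<^sub>m b) * H) *\<^sub>v (A ^\<^sub>m a *\<^sub>v x)"
        using A H x by (simp add: assoc_mult_mat_vec[of _ n n _ n])
      also have "\<dots> = H *\<^sub>v (A ^\<^sub>m (b + a) *\<^sub>v x)"
        unfolding selfadjoint_pow[OF A H HA, symmetric] powv[symmetric]
        using A H x by (simp add: assoc_mult_mat_vec[of _ n n _ n])
      finally show ?thesis by (simp add: g_def add.commute)
    qed
    have "(mat_adjoint X0 * (H * X0)) $$ (i, j) = row (mat_adjoint X0) i \<bullet> col (H * X0) j"
      using ij X0 H by simp
    also have "row (mat_adjoint X0) i = conjugate (col X0 i)"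
      using X0 ij by (intro eq_vecI) (auto simp: conjugate_vec_def)
    also have "col (H * X0) j = H *\<^sub>v col X0 j" using X0 H ij by (intro eq_vecI) auto
    also have "conjugate (col X0 i) \<bullet> (H *\<^sub>v col X0 j) = (H *\<^sub>v col X0 j) \<bullet>c col X0 i"
      using X0 H ij by (intro comm_scalar_prod[of _ n]) auto
    also have "\<dots> = g ((k - j) + (k - i))"
      unfolding col[OF ij(1)] col[OF ij(2)] adjpow ..
    also have "\<dots> = toeplitz (Suc k) (fps_of_real \<Gamma>) $$ (k - i, j)"
    proof (cases "k - i \<le> j")
      case True
      then have "(k - j) + (k - i) = k - (j - (k - i))" using ij by auto
      then show ?thesis using True ij g_real by (simp add: toeplitz_def \<Gamma>_def)
    next
      case False
      then have "k < (k - j) + (k - i)" using ij by auto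
      then show ?thesis using False ij g0 by (simp add: toeplitz_def)
    qed
    also have "\<dots> = (antidiag_mat (Suc k) * toeplitz (Suc k) (fps_of_real \<Gamma>)) $$ (i, j)"
      using antidiag_mult_index[of "toeplitz (Suc k) (fps_of_real \<Gamma>)" "Suc k" "Suc k" i j] ij by simp
    finally show "(mat_adjoint X0 * H * X0) $$ (i, j) =
        (antidiag_mat (Suc k) * toeplitz (Suc k) (fps_of_real \<Gamma>)) $$ (i, j)"
      using X0 H by (simp add: assoc_mult_mat[of _ "Suc k" n _ n _ "Suc k"])
  qed (use X0 in auto)
  have \<Gamma>0: "fps_nth \<Gamma> 0 \<noteq> 0" using nz g_real[of k] by (auto simp: \<Gamma>_def g_def)
  \<comment> \<open>With this sign the series \<epsilon> / \<Gamma> has a positive constant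
    coefficient, hence a real square root.\<close>
  define \<epsilon> :: int where "\<epsilon> = (if 0 < fps_nth \<Gamma> 0 then 1 else -1)"
  define f where "f = fps_const (of_int \<epsilon>) * inverse \<Gamma>"
  have f0: "fps_nth f 0 = 1 / \<bar>fps_nth \<Gamma> 0\<bar>" using \<Gamma>0 by (auto simp: f_def \<epsilon>_def field_simps)
  obtain p where p: "p ^ 2 = f"
    using fps_root_exists[of 2 "sqrt (fps_nth f 0)" f] \<Gamma>0 f0 by auto
  have "\<Gamma> * (p * p) = fps_const (of_int \<epsilon>) * (inverse \<Gamma> * \<Gamma>)"
    using p by (simp add: f_def power2_eq_square mult_ac)
  also have "\<dots> = fps_const (of_int \<epsilon>)" using inverse_mult_eq_1[OF \<Gamma>0] by simp
  finally have pp: "\<Gamma> * (p * p) = fps_const (of_int \<epsilon>)" .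
  define T where "T = toeplitz (Suc k) (fps_of_real p)"
  have T: "T \<in> carrier_mat (Suc k) (Suc k)" by (simp add: T_def)
  define X where "X = X0 * T"
  have X: "X \<in> carrier_mat n (Suc k)" using X0 T by (simp add: X_def)
  have JT: "jordan_block (Suc k) 0 * T = T * jordan_block (Suc k) 0"
    unfolding T_def jordan_block_toeplitz by (rule toeplitz_commute)
  have "A * X = (A * X0) * T" unfolding X_def using A X0 T by (simp add: assoc_mult_mat[of _ n n _ "Suc k" _ "Suc k"])
  also have "\<dots> = X0 * (jordan_block (Suc k) 0 * T)" unfolding AX0 using X0 T
    by (intro assoc_mult_mat[of _ n "Suc k" _ "Suc k" _ "Suc k"]) auto
  also have "\<dots> = X * jordan_block (Suc k) 0" unfolding JT X_def using X0 T
    by (intro assoc_mult_mat[of _ n "Suc k" _ "Suc k" _ "Suc k", symmetric]) auto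
  finally have AX: "A * X = X * jordan_block (Suc k) 0" .
  let ?Q = "antidiag_mat (Suc k)" and ?G = "toeplitz (Suc k) (fps_of_real \<Gamma>)"
  have "mat_adjoint X * H * X = mat_adjoint T * (mat_adjoint X0 * H * X0) * T"
  proof -
    have "mat_adjoint X = mat_adjoint T * mat_adjoint X0" unfolding X_def using X0 T by (simp add: adj_mult[of _ n "Suc k" _ "Suc k"])
    then show ?thesis unfolding X_def using X0 T H
      by (simp add: assoc_mult_mat[of _ "Suc k" n _ n _ "Suc k"] assoc_mult_mat[of _ "Suc k" "Suc k" _ n _ "Suc k"]
          assoc_mult_mat[of _ "Suc k" "Suc k" _ n _ n]
          assoc_mult_mat[of _ "Suc k" "Suc k" _ "Suc k" _ "Suc k"] assoc_mult_mat[of _ n "Suc k" _ "Suc k" _ "Suc k"]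
          assoc_mult_mat[of _ "Suc k" n _ "Suc k" _ "Suc k"] assoc_mult_mat[of _ n n _ "Suc k" _ "Suc k"])
  qed
  also have "\<dots> = (mat_adjoint T * ?Q) * ?G * T"
    unfolding gram using T by (simp add: assoc_mult_mat[of _ "Suc k" "Suc k" _ "Suc k" _ "Suc k"])
  also have "mat_adjoint T * ?Q = ?Q * T" unfolding T_def toeplitz_adj_antidiag by simp
  also have "?Q * T * ?G * T = ?Q * (T * ?G * T)"
    using T by (simp add: assoc_mult_mat[of _ "Suc k" "Suc k" _ "Suc k" _ "Suc k"])
  also have "T * ?G * T = toeplitz (Suc k) (fps_of_real (\<Gamma> * (p * p)))"
    unfolding T_def toeplitz_mult[symmetric] fps_of_real_mult[symmetric] by (simp add: mult_ac)
  also have "\<dots> = of_int \<epsilon> \<cdot>\<^sub>m 1\<^sub>m (Suc k)"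
    unfolding pp by (rule eq_matI) (auto simp: toeplitz_def)
  also have "?Q * (of_int \<epsilon> \<cdot>\<^sub>m 1\<^sub>m (Suc k)) = of_int \<epsilon> \<cdot>\<^sub>m ?Q"
    by (simp add: mult_smult_distrib[of _ "Suc k" "Suc k" _ "Suc k"])
  finally have "mat_adjoint X * H * X = of_int \<epsilon> \<cdot>\<^sub>m ?Q" .
  with X AX show thesis by (intro that[of X \<epsilon>]) (auto simp: \<epsilon>_def)
qed

section \<open>Matrices assembled from two groups of columns\<close>

definition hcat :: "complex mat \<Rightarrow> complex mat \<Rightarrow> complex mat" where
  "hcat X Y = mat (dim_row X) (dim_col X + dim_col Y)
     (\<lambda>(i, j). if j < dim_col X then X $$ (i, j) else Y $$ (i, j - dim_col X))"

lemma hcat_carrier [simp]: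
  "X \<in> carrier_mat n k \<Longrightarrow> Y \<in> carrier_mat n l \<Longrightarrow> hcat X Y \<in> carrier_mat n (k + l)"
  by (auto simp: hcat_def)

lemma col_hcat:
  assumes "X \<in> carrier_mat n k" "Y \<in> carrier_mat n l" "j < k + l"
  shows "col (hcat X Y) j = (if j < k then col X j else col Y (j - k))"
  using assms by (intro eq_vecI) (auto simp: hcat_def)

lemma mult_hcat:
  assumes M: "M \<in> carrier_mat m n" and X: "X \<in> carrier_mat n k" and Y: "Y \<in> carrier_mat n l"
  shows "M * hcat X Y = hcat (M * X) (M * Y)"
proof (rule eq_matI)
  fix i j assume "i < dim_row (hcat (M * X) (M * Y))" "j < dim_col (hcat (M * X) (M * Y))"
  then have ij: "i < m" "j < k + l" using M X Y by (auto simp: hcat_def)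
  have "(M * hcat X Y) $$ (i, j) = row M i \<bullet> col (hcat X Y) j"
    using ij M hcat_carrier[OF X Y] by simp
  also have "\<dots> = hcat (M * X) (M * Y) $$ (i, j)"
    unfolding col_hcat[OF X Y ij(2)] using ij M X Y by (auto simp: hcat_def)
  finally show "(M * hcat X Y) $$ (i, j) = hcat (M * X) (M * Y) $$ (i, j)" .
qed (use M X Y in \<open>auto simp: hcat_def\<close>)

lemma adj_hcat_mult_hcat:
  assumes X: "X \<in> carrier_mat n k" and Y: "Y \<in> carrier_mat n l"
    and U: "U \<in> carrier_mat n k" and V: "V \<in> carrier_mat n l"
  shows "mat_adjoint (hcat X Y) * hcat U V =
    four_block_mat (mat_adjoint X * U) (mat_adjoint X * V) (mat_adjoint Y * U) (mat_adjoint Y * V)"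
proof (rule eq_matI)
  fix i j
  assume "i < dim_row (four_block_mat (mat_adjoint X * U) (mat_adjoint X * V) (mat_adjoint Y * U) (mat_adjoint Y * V))"
    "j < dim_col (four_block_mat (mat_adjoint X * U) (mat_adjoint X * V) (mat_adjoint Y * U) (mat_adjoint Y * V))"
  then have ij: "i < k + l" "j < k + l" using X Y U V by auto
  have row: "row (mat_adjoint M) i = conjugate (col M i)" if "i < dim_col M" for M :: "complex mat" and i
    using that by (intro eq_vecI) (auto simp: conjugate_vec_def)
  have "(mat_adjoint (hcat X Y) * hcat U V) $$ (i, j) = conjugate (col (hcat X Y) i) \<bullet> col (hcat U V) j"
    using ij X Y U V by (simp add: hcat_def row)
  also have "\<dots> = four_block_mat (mat_adjoint X * U) (mat_adjoint X * V) (mat_adjoint Y * U) (mat_adjoint Y * V) $$ (i, j)"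
    unfolding col_hcat[OF X Y ij(1)] col_hcat[OF U V ij(2)] using ij X Y U V by (auto simp: row)
  finally show "(mat_adjoint (hcat X Y) * hcat U V) $$ (i, j) =
    four_block_mat (mat_adjoint X * U) (mat_adjoint X * V) (mat_adjoint Y * U) (mat_adjoint Y * V) $$ (i, j)" .
qed (use X Y U V in \<open>auto simp: hcat_def\<close>)

lemma hcat_mult_vec:
  assumes X: "X \<in> carrier_mat n k" and Y: "Y \<in> carrier_mat n l" and c: "c \<in> carrier_vec k" and d: "d \<in> carrier_vec l"
  shows "hcat X Y *\<^sub>v (c @\<^sub>v d) = X *\<^sub>v c + Y *\<^sub>v d"
proof (rule eq_vecI)
  fix i assume "i < dim_vec (X *\<^sub>v c + Y *\<^sub>v d)"
  then have i: "i < n" using Y by simp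
  have "row (hcat X Y) i = row X i @\<^sub>v row Y i"
    using i X Y by (intro eq_vecI) (auto simp: hcat_def)
  then have "(hcat X Y *\<^sub>v (c @\<^sub>v d)) $ i = (row X i @\<^sub>v row Y i) \<bullet> (c @\<^sub>v d)"
    using i X by (simp add: hcat_def)
  also have "\<dots> = row X i \<bullet> c + row Y i \<bullet> d"
    using i X Y c d by (intro scalar_prod_append[of _ k _ l]) auto
  finally show "(hcat X Y *\<^sub>v (c @\<^sub>v d)) $ i = (X *\<^sub>v c + Y *\<^sub>v d) $ i"
    using i X Y by simp
qed (use X Y in \<open>auto simp: hcat_def\<close>)

text \<open>The form on the span of the chain is \<epsilon> times the antidiagonal one, hence
  nondegenerate, so the \<open>H\<close>-orthogonal space of the chain, the kernel of
  \<open>W\<close>, is a complement. It is invariant because \<open>A\<close> is selfadjoint. In the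
  basis \<open>S\<close>, which lists the chain first, both \<open>A\<close> and \<open>H\<close>
  are therefore block diagonal.\<close>

lemma split_off_jordan_block:
  fixes A H :: "complex mat"
  assumes A: "A \<in> carrier_mat n n" and H: "H \<in> carrier_mat n n" and herm: "mat_adjoint H = H"
    and K: "K \<in> carrier_mat n n" "H * K = 1\<^sub>m n" "K * H = 1\<^sub>m n"
    and HA: "H * A = mat_adjoint A * H"
    and v: "v \<in> carrier_vec n" "v \<noteq> 0\<^sub>v n" "A *\<^sub>v v = 0\<^sub>v n"
  obtains k l \<epsilon> A' H' K' where "0 < k" "n = k + l" "\<epsilon> \<in> {1, -1}" "A' \<in> carrier_mat l l" "H' \<in> carrier_mat l l"
    "mat_adjoint H' = H'" "K' \<in> carrier_mat l l" "H' * K' = 1\<^sub>m l" "K' * H' = 1\<^sub>m l" "H' * A' = mat_adjoint A' * H'"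
    "cong_pair A H (jordan_block k 0 \<oplus>\<^sub>m A') ((of_int \<epsilon> \<cdot>\<^sub>m antidiag_mat k) \<oplus>\<^sub>m H')"
proof -
  \<comment> \<open>A vector that starts a nondegenerate chain is guaranteed just below the least
    index, so the chain is taken of this maximal length. The singularity of \<open>A\<close> makes
    it positive.\<close>
  define k0 where "k0 = (LEAST k. has_drazin_index A k)"
  have k0: "has_drazin_index A k0"
    unfolding k0_def using has_drazin_index_exists[OF A] by (rule LeastI_ex)
  have min: "\<not> has_drazin_index A k" if "k < k0" for k
    using not_less_Least that unfolding k0_def by blast
  have "k0 \<noteq> 0"
  proof
    assume "k0 = 0"
    then obtain X where X: "X \<in> carrier_mat n n" "A * X = X * A" "A ^\<^sub>m Suc 0 * X = A ^\<^sub>m 0"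
      using k0 A unfolding has_drazin_index_def by (metis carrier_matD(1))
    then have "X * A = 1\<^sub>m n" using A by simp
    with inverse_imp_inj[OF A X(1) this v(1,3)] v(2) show False by simp
  qed
  then obtain k1 where k1: "k0 = Suc k1" by (cases k0) auto
  obtain x where x: "x \<in> carrier_vec n" "A ^\<^sub>m Suc k1 *\<^sub>v x = 0\<^sub>v n" "(H *\<^sub>v (A ^\<^sub>m k1 *\<^sub>v x)) \<bullet>c x \<noteq> 0"
    using nonisotropic_vector_exists[OF A H K HA k0[unfolded k1] min[of k1]] k1 by auto
  define k where "k = Suc k1"
  define J where "J = (jordan_block k 0 :: complex mat)"
  have J: "J \<in> carrier_mat k k" by (simp add: J_def)
  obtain X \<epsilon> where X: "X \<in> carrier_mat n k" and \<epsilon>: "\<epsilon> \<in> {1, -1 :: int}" and AX: "A * X = X * J"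
    and gram: "mat_adjoint X * H * X = of_int \<epsilon> \<cdot>\<^sub>m antidiag_mat k"
    using jordan_chain_exists[OF A H herm HA x] unfolding k_def J_def by blast
  define Q where "Q = of_int \<epsilon> \<cdot>\<^sub>m antidiag_mat k"
  have Q: "Q \<in> carrier_mat k k" by (simp add: Q_def)
  have "Q * Q = of_int \<epsilon> \<cdot>\<^sub>m (of_int \<epsilon> \<cdot>\<^sub>m 1\<^sub>m k)"
    unfolding Q_def by (simp add: mult_smult_assoc_mat[of _ k k _ k] mult_smult_distrib[of _ k k _ k] antidiag_square)
  also have "\<dots> = 1\<^sub>m k" by (rule eq_matI) (use \<epsilon> in auto)
  finally have QQ: "Q * Q = 1\<^sub>m k" .
  define W where "W = mat_adjoint X * H"
  have W: "W \<in> carrier_mat k n" using X H by (simp add: W_def)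
  have WX: "W * X = Q" unfolding W_def Q_def gram ..
  have injX: "c = 0\<^sub>v k" if c: "c \<in> carrier_vec k" "X *\<^sub>v c = 0\<^sub>v n" for c
  proof (rule inverse_imp_inj[OF Q Q QQ c(1)])
    have "Q *\<^sub>v c = W *\<^sub>v (X *\<^sub>v c)" unfolding WX[symmetric] using W X c by simp
    then show "Q *\<^sub>v c = 0\<^sub>v k" unfolding c(2) using W by (auto intro!: eq_vecI)
  qed
  have "k \<le> n"
  proof (rule ccontr)
    assume "\<not> k \<le> n"
    then obtain c where "c \<in> carrier_vec k" "c \<noteq> 0\<^sub>v k" "X *\<^sub>v c = 0\<^sub>v n"
      using wide_mat_kernel[OF X] by auto
    with injX show False by blast
  qed
  define l where "l = n - k"
  have n: "n = k + l" using \<open>k \<le> n\<close> by (simp add: l_def)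
  obtain Y where Y: "Y \<in> carrier_mat n l" and WY: "W * Y = 0\<^sub>m k l"
    and injY: "\<And>d. d \<in> carrier_vec l \<Longrightarrow> Y *\<^sub>v d = 0\<^sub>v n \<Longrightarrow> d = 0\<^sub>v l"
    using injective_kernel_columns[OF W, of l] n by auto
  define S where "S = hcat X Y"
  have S: "S \<in> carrier_mat n n" unfolding S_def n using X Y by (metis hcat_carrier n)
  have "\<forall>s \<in> carrier_vec (k + l). S *\<^sub>v s = 0\<^sub>v n \<longrightarrow> s = 0\<^sub>v (k + l)"
    unfolding all_vec_append
  proof (intro ballI impI)
    fix c d :: "complex vec" assume c: "c \<in> carrier_vec k" and d: "d \<in> carrier_vec l" and "S *\<^sub>v (c @\<^sub>v d) = 0\<^sub>v n"
    then have sum: "X *\<^sub>v c + Y *\<^sub>v d = 0\<^sub>v n" unfolding S_def using hcat_mult_vec[OF X Y c d] by simp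
    have "W *\<^sub>v (X *\<^sub>v c + Y *\<^sub>v d) = W *\<^sub>v (X *\<^sub>v c) + W *\<^sub>v (Y *\<^sub>v d)"
      using W X Y c d by (intro mult_add_distrib_mat_vec[of _ k n]) auto
    also have "\<dots> = (W * X) *\<^sub>v c + (W * Y) *\<^sub>v d" using W X Y c d by simp
    also have "\<dots> = Q *\<^sub>v c" unfolding WX WY using Q c d by (auto intro!: eq_vecI)
    finally have "Q *\<^sub>v c = W *\<^sub>v 0\<^sub>v n" unfolding sum by simp
    also have "\<dots> = 0\<^sub>v k" using W by (auto intro!: eq_vecI)
    finally have c0: "c = 0\<^sub>v k" using inverse_imp_inj[OF Q Q QQ c] by simp
    have "X *\<^sub>v 0\<^sub>v k = 0\<^sub>v n" using X by (auto intro!: eq_vecI)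
    then have "Y *\<^sub>v d = 0\<^sub>v n" using sum Y d unfolding c0 by (metis left_zero_vec mult_mat_vec_carrier)
    then have "d = 0\<^sub>v l" using injY d by simp
    then show "c @\<^sub>v d = 0\<^sub>v (k + l)" unfolding c0 by (auto intro!: eq_vecI)
  qed
  then obtain T where T: "T \<in> carrier_mat n n" and ST: "S * T = 1\<^sub>m n" and TS: "T * S = 1\<^sub>m n"
    using inj_mat_inverse[OF S] unfolding n by blast
  define H1 where "H1 = mat_adjoint S * H * S"
  have H1: "H1 \<in> carrier_mat n n" using S H by (simp add: H1_def)
  define N where "N = mat_adjoint Y * (H * Y)"
  \<comment> \<open>\<open>N\<close> is the form on the complement, and \<open>R\<close> is the form
    composed with \<open>A\<close> there. The restricted operator is \<open>M * R\<close>, where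
    \<open>M\<close> is the inverse of \<open>N\<close> obtained below.\<close>
  define R where "R = mat_adjoint Y * (H * (A * Y))"
  have aX: "mat_adjoint X \<in> carrier_mat k n" and aY: "mat_adjoint Y \<in> carrier_mat l n" using X Y by auto
  have HX: "H * X \<in> carrier_mat n k" and HY: "H * Y \<in> carrier_mat n l" and AY: "A * Y \<in> carrier_mat n l"
    using H X Y A by auto
  have N: "N \<in> carrier_mat l l" using aY HY by (simp add: N_def)
  have R: "R \<in> carrier_mat l l" using aY H AY by (simp add: R_def)
  have YHX: "mat_adjoint Y * (H * X) = 0\<^sub>m l k"
  proof -
    have "mat_adjoint (W * Y) = mat_adjoint Y * (H * X)"
      unfolding adj_mult[OF W Y] unfolding W_def adj_mult[OF aX H] by (simp add: herm)
    then show ?thesis unfolding WY by (metis adj_index(1) adj_index(2,3) eq_matI index_zero_mat complex_cnj_zero)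
  qed
  have XHX: "mat_adjoint X * (H * X) = Q"
    using WX unfolding W_def using aX H X by (simp add: assoc_mult_mat[OF aX H X])
  have XHY: "mat_adjoint X * (H * Y) = 0\<^sub>m k l"
    using WY unfolding W_def using aX H Y by (simp add: assoc_mult_mat[OF aX H Y])
  have H1': "H1 = Q \<oplus>\<^sub>m N"
  proof -
    have "H1 = mat_adjoint S * (H * S)" unfolding H1_def using S H by (simp add: assoc_mult_mat[of _ n n _ n _ n])
    also have "H * S = hcat (H * X) (H * Y)" unfolding S_def by (rule mult_hcat[OF H X Y])
    finally show ?thesis
      unfolding S_def adj_hcat_mult_hcat[OF X Y HX HY] XHX XHY YHX mat_dsum_def N_def[symmetric] using N Q by simp
  qed
  have SHAS: "mat_adjoint S * (H * (A * S)) = (Q * J) \<oplus>\<^sub>m R"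
  proof -
    have "A * S = hcat (A * X) (A * Y)" unfolding S_def by (rule mult_hcat[OF A X Y])
    then have "H * (A * S) = hcat (H * (A * X)) (H * (A * Y))"
      using mult_hcat[OF H _ AY, of "A * X" k] A X by simp
    then have "mat_adjoint S * (H * (A * S)) = four_block_mat (mat_adjoint X * (H * (A * X)))
       (mat_adjoint X * (H * (A * Y))) (mat_adjoint Y * (H * (A * X))) (mat_adjoint Y * (H * (A * Y)))"
      unfolding S_def using adj_hcat_mult_hcat[OF X Y, of "H * (A * X)" "H * (A * Y)"] H A X AY by simp
    also have "mat_adjoint X * (H * (A * X)) = Q * J"
      unfolding AX XHX[symmetric] using aX H X J
      by (simp add: assoc_mult_mat[OF aX HX J] assoc_mult_mat[OF H X J])
    also have "mat_adjoint Y * (H * (A * X)) = 0\<^sub>m l k"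
    proof -
      have "mat_adjoint Y * (H * (A * X)) = mat_adjoint Y * (H * X) * J"
        unfolding AX using assoc_mult_mat[OF aY HX J] assoc_mult_mat[OF H X J] by simp
      then show ?thesis unfolding YHX using J by simp
    qed
    also have "mat_adjoint X * (H * (A * Y)) = 0\<^sub>m k l"
    proof -
      have aA: "mat_adjoint A \<in> carrier_mat n n" using A by simp
      have aJ: "mat_adjoint J \<in> carrier_mat k k" using J by simp
      have "H * (A * Y) = mat_adjoint A * (H * Y)"
        using assoc_mult_mat[OF H A Y] assoc_mult_mat[OF aA H Y] HA by simp
      then have "mat_adjoint X * (H * (A * Y)) = mat_adjoint X * mat_adjoint A * (H * Y)"
        using assoc_mult_mat[OF aX aA HY] by simp
      also have "mat_adjoint X * mat_adjoint A = mat_adjoint J * mat_adjoint X"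
        using AX adj_mult[OF A X] adj_mult[OF X J] by simp
      also have "\<dots> * (H * Y) = 0\<^sub>m k l"
        using assoc_mult_mat[OF aJ aX HY] XHY aJ by simp
      finally show ?thesis .
    qed
    finally show ?thesis unfolding R_def[symmetric] mat_dsum_def using R Q J by simp
  qed
  have inj1: "s = 0\<^sub>v n" if s: "s \<in> carrier_vec n" "H1 *\<^sub>v s = 0\<^sub>v n" for s
  proof (rule inverse_imp_inj[OF H1 _ _ s])
    show "T * K * mat_adjoint T \<in> carrier_mat n n" using T K by simp
    show "T * K * mat_adjoint T * H1 = 1\<^sub>m n"
      unfolding H1_def using S T K H TS
      by (simp add: assoc_mult_mat[of _ n n _ n _ n] cancel_left_mat[OF adj_inverse[OF ST]] cancel_left_mat[OF K(3)])
  qed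
  obtain M where M: "M \<in> carrier_mat l l" "N * M = 1\<^sub>m l" "M * N = 1\<^sub>m l"
  proof (rule inj_mat_inverse[OF N])
    fix d :: "complex vec" assume d: "d \<in> carrier_vec l" "N *\<^sub>v d = 0\<^sub>v l"
    have zk: "(0\<^sub>v k :: complex vec) \<in> carrier_vec k" by simp
    have "H1 *\<^sub>v (0\<^sub>v k @\<^sub>v d) = (Q *\<^sub>v 0\<^sub>v k) @\<^sub>v (N *\<^sub>v d)"
      unfolding H1' by (rule dsum_mult_vec[OF Q N zk d(1)])
    also have "\<dots> = 0\<^sub>v n" unfolding d(2) n using Q by (auto intro!: eq_vecI)
    finally have "0\<^sub>v k @\<^sub>v d = 0\<^sub>v n" using inj1 d n by (metis append_carrier_vec zk)
    also have "\<dots> = 0\<^sub>v k @\<^sub>v 0\<^sub>v l" unfolding n by (auto intro!: eq_vecI)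
    finally show "d = 0\<^sub>v l" using append_vec_eq[OF zk zk] by blast
  qed
  \<comment> \<open>Invariance of the complement is not proved column by column: after
    multiplication by the invertible \<open>H1\<close> the claim becomes the block diagonal identity
    \<open>SHAS\<close>, and \<open>H1\<close> is cancelled.\<close>
  have A1: "T * A * S = J \<oplus>\<^sub>m (M * R)"
  proof -
    obtain G where G: "G \<in> carrier_mat n n" "H1 * G = 1\<^sub>m n" "G * H1 = 1\<^sub>m n"
      using inj_mat_inverse[OF H1 inj1] by blast
    have c: "J \<oplus>\<^sub>m (M * R) \<in> carrier_mat n n" unfolding n using J M R by simp
    have TAS: "T * A * S \<in> carrier_mat n n" using T A S by simp
    have NMR: "N * (M * R) = R" by (rule cancel_left_mat[OF M(2) N M(1) R])
    have "H1 * (J \<oplus>\<^sub>m (M * R)) = (Q * J) \<oplus>\<^sub>m R"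
      unfolding H1' using dsum_mult[OF Q J N, of "M * R" l] M R NMR by simp
    also have "\<dots> = H1 * (T * A * S)"
      unfolding SHAS[symmetric] H1_def using S H A T
      by (simp add: assoc_mult_mat[of _ n n _ n _ n] cancel_left_mat[OF ST])
    finally have "G * (H1 * (J \<oplus>\<^sub>m (M * R))) = G * (H1 * (T * A * S))" by simp
    then show ?thesis
      unfolding cancel_left_mat[OF G(3) G(1) H1 c] cancel_left_mat[OF G(3) G(1) H1 TAS] by simp
  qed
  have "cong_pair A H (J \<oplus>\<^sub>m (M * R)) (Q \<oplus>\<^sub>m N)"
    using A H S T ST TS A1 H1' unfolding H1_def by (intro cong_pairI[of _ n _ S T]) auto
  moreover have hermN: "mat_adjoint N = N"
    unfolding N_def adj_mult[OF aY HY] adj_mult[OF H Y] herm adj_adj by (rule assoc_mult_mat[OF aY H Y])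
  moreover have "N * (M * R) = mat_adjoint (M * R) * N"
  proof -
    have aA: "mat_adjoint A \<in> carrier_mat n n" and HA': "H * A \<in> carrier_mat n n" using A H by auto
    have HAY: "H * (A * Y) \<in> carrier_mat n l" using H AY by simp
    have MR: "M * R \<in> carrier_mat l l" using M R by simp
    have NMR: "N * (M * R) = R" by (rule cancel_left_mat[OF M(2) N M(1) R])
    have "mat_adjoint R = (mat_adjoint Y * mat_adjoint A) * H * Y"
      unfolding R_def adj_mult[OF aY HAY] adj_mult[OF H AY] adj_mult[OF A Y] herm adj_adj ..
    also have "\<dots> = mat_adjoint Y * (H * A) * Y" unfolding HA assoc_mult_mat[OF aY aA H] ..
    also have "\<dots> = R" unfolding R_def assoc_mult_mat[OF aY HA' Y] assoc_mult_mat[OF H A Y] ..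
    finally show ?thesis using adj_mult[OF N MR] unfolding NMR hermN by simp
  qed
  ultimately show thesis
    using that[of k l \<epsilon> "M * R" N M] \<epsilon> M R N n unfolding J_def Q_def by (simp add: k_def)
qed

section \<open>Canonical pairs as direct sums of blocks\<close>

lemma block_carrier:
  obtains d where "block_J b \<in> carrier_mat d d" "block_H b \<in> carrier_mat d d"
proof (cases b)
  case (Real_Block k a \<epsilon>)
  then show thesis using that[of k] by simp
next
  case (Pair_Block k z)
  then show thesis using that[of "k + k"] by (simp add: mult_2 dsum_carrier)
qed

lemma canon_Nil [simp]: "canon_J [] = 0\<^sub>m 0 0" "canon_H [] = 0\<^sub>m 0 0"
  and canon_Cons [simp]: "canon_J (b # bs) = block_J b \<oplus>\<^sub>m canon_J bs" "canon_H (b # bs) = block_H b \<oplus>\<^sub>m canon_H bs"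
  by (simp_all add: canon_J_def canon_H_def)

lemma canon_carrier:
  obtains d where "canon_J bs \<in> carrier_mat d d" "canon_H bs \<in> carrier_mat d d"
proof -
  have "\<exists>d. canon_J bs \<in> carrier_mat d d \<and> canon_H bs \<in> carrier_mat d d"
  proof (induction bs)
    case Nil
    show ?case by (auto intro!: exI[of _ 0])
  next
    case (Cons b bs)
    obtain d where "block_J b \<in> carrier_mat d d" "block_H b \<in> carrier_mat d d" by (rule block_carrier)
    then show ?case using Cons by (auto intro: dsum_carrier)
  qed
  then show thesis using that by blast
qed

text \<open>As long as the matrix is singular, a block of positive size splits off and the remainder
  is again selfadjoint for an invertible Hermitian form, so induction on the size ends at an
  injective remainder.\<close>

lemma split_nilpotent_part:
  fixes A H :: "complex mat"
  assumes "A \<in> carrier_mat n n" "H \<in> carrier_mat n n" "mat_adjoint H = H"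
    and "K \<in> carrier_mat n n" "H * K = 1\<^sub>m n" "K * H = 1\<^sub>m n"
    and "H * A = mat_adjoint A * H"
  shows "\<exists>cs l A' H'. (\<forall>b \<in> set cs. valid_block b \<and> is_zero_block b) \<and>
    A' \<in> carrier_mat l l \<and> H' \<in> carrier_mat l l \<and> (\<forall>v \<in> carrier_vec l. A' *\<^sub>v v = 0\<^sub>v l \<longrightarrow> v = 0\<^sub>v l) \<and>
    cong_pair A H (canon_J cs \<oplus>\<^sub>m A') (canon_H cs \<oplus>\<^sub>m H')"
  using assms
proof (induction n arbitrary: A H K rule: less_induct)
  case (less n)
  note A = less.prems(1) and H = less.prems(2) and herm = less.prems(3) and K = less.prems(4-6) and HA = less.prems(7)
  show ?case
  proof (cases "\<forall>v \<in> carrier_vec n. A *\<^sub>v v = 0\<^sub>v n \<longrightarrow> v = 0\<^sub>v n")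
    case True
    have "cong_pair A H (canon_J [] \<oplus>\<^sub>m A) (canon_H [] \<oplus>\<^sub>m H)" using cong_pair_refl[OF A H] by simp
    moreover have "\<forall>b \<in> set []. valid_block b \<and> is_zero_block b" by simp
    ultimately show ?thesis using A H True by blast
  next
    case False
    then obtain v where v: "v \<in> carrier_vec n" "v \<noteq> 0\<^sub>v n" "A *\<^sub>v v = 0\<^sub>v n" by auto
    obtain k l \<epsilon> A' H' K' where k: "0 < k" "n = k + l" "\<epsilon> \<in> {1, -1 :: int}"
      and A': "A' \<in> carrier_mat l l" and H': "H' \<in> carrier_mat l l" "mat_adjoint H' = H'"
      and K': "K' \<in> carrier_mat l l" "H' * K' = 1\<^sub>m l" "K' * H' = 1\<^sub>m l" and self: "H' * A' = mat_adjoint A' * H'"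
      and cong: "cong_pair A H (jordan_block k 0 \<oplus>\<^sub>m A') ((of_int \<epsilon> \<cdot>\<^sub>m antidiag_mat k) \<oplus>\<^sub>m H')"
      using split_off_jordan_block[OF A H herm K HA v] .
    define Q where "Q = of_int \<epsilon> \<cdot>\<^sub>m antidiag_mat k"
    define J where "J = (jordan_block k 0 :: complex mat)"
    have Q: "Q \<in> carrier_mat k k" and J: "J \<in> carrier_mat k k" by (simp_all add: Q_def J_def)
    have "l < n" using k by simp
    from less.IH[OF this A' H' K' self] obtain cs l' A'' H''
      where IH: "\<forall>b \<in> set cs. valid_block b \<and> is_zero_block b" "A'' \<in> carrier_mat l' l'" "H'' \<in> carrier_mat l' l'"
        "\<forall>v \<in> carrier_vec l'. A'' *\<^sub>v v = 0\<^sub>v l' \<longrightarrow> v = 0\<^sub>v l'"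
        "cong_pair A' H' (canon_J cs \<oplus>\<^sub>m A'') (canon_H cs \<oplus>\<^sub>m H'')" by blast
    have "cong_pair (J \<oplus>\<^sub>m A') (Q \<oplus>\<^sub>m H') (J \<oplus>\<^sub>m (canon_J cs \<oplus>\<^sub>m A'')) (Q \<oplus>\<^sub>m (canon_H cs \<oplus>\<^sub>m H''))"
      using J Q IH(5) by (intro cong_pair_dsum cong_pair_refl)
    then have "cong_pair A H (canon_J (Real_Block k 0 \<epsilon> # cs) \<oplus>\<^sub>m A'') (canon_H (Real_Block k 0 \<epsilon> # cs) \<oplus>\<^sub>m H'')"
      using cong_pair_trans[OF cong] by (simp add: dsum_assoc J_def Q_def)
    moreover have "\<forall>b \<in> set (Real_Block k 0 \<epsilon> # cs). valid_block b \<and> is_zero_block b"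
      using IH(1) k by auto
    ultimately show ?thesis using IH(2-4) by blast
  qed
qed

subsection \<open>Sign characteristic\<close>

text \<open>This isolates one block size. On a nilpotent Jordan block of size k < \<nu> the factor
  N^(\<nu>-1) vanishes; for k > \<nu> the kernel of N^\<nu> is the range of N^(k-\<nu>), on which
  the form is 0. Only k = \<nu> leaves a form of rank one, and its sign is that of the
  block.\<close>

definition sign_index :: "complex mat \<Rightarrow> complex mat \<Rightarrow> nat \<Rightarrow> nat \<Rightarrow> bool" where
  "sign_index N H \<nu> p \<longleftrightarrow> (\<exists>n. N \<in> carrier_mat n n \<and> H \<in> carrier_mat n n \<and> form_index n (N ^\<^sub>m \<nu>) (H * N ^\<^sub>m (\<nu> - 1)) p)"

lemma sign_index_unique:
  assumes "sign_index N H \<nu> p" "sign_index N H \<nu> q"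
  shows "p = q"
  using assms unfolding sign_index_def by (metis carrier_matD(1) form_index_unique)

lemma sign_index_cong:
  assumes "cong_pair N H N' H'" "sign_index N H \<nu> p"
  shows "sign_index N' H' \<nu> p"
proof -
  obtain n S T where c: "N \<in> carrier_mat n n" "H \<in> carrier_mat n n" "S \<in> carrier_mat n n" "T \<in> carrier_mat n n"
    and ST: "S * T = 1\<^sub>m n" and TS: "T * S = 1\<^sub>m n"
    and N': "N' = T * N * S" and H': "H' = mat_adjoint S * H * S"
    using assms(1) by (rule cong_pairE)
  have ix: "form_index n (N ^\<^sub>m \<nu>) (H * N ^\<^sub>m (\<nu> - 1)) p"
    using assms(2) c(1) unfolding sign_index_def by (metis carrier_matD(1))
  have pow: "N' ^\<^sub>m j = T * N ^\<^sub>m j * S" for j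
    unfolding N' using c ST TS by (intro conj_mat_pow) auto
  have "H' * N' ^\<^sub>m (\<nu> - 1) = mat_adjoint S * (H * N ^\<^sub>m (\<nu> - 1)) * S"
    unfolding pow H' using c by (simp add: assoc_mult_mat[of _ n n _ n _ n] cancel_left_mat[OF ST])
  then show ?thesis
    using form_index_cong[OF ix c(3,4) ST] c unfolding sign_index_def pow
    by (intro exI[of _ n]) (auto simp: N' H')
qed

lemma sign_index_dsum:
  assumes "sign_index N H \<nu> p" "sign_index M K \<nu> q"
  shows "sign_index (N \<oplus>\<^sub>m M) (H \<oplus>\<^sub>m K) \<nu> (p + q)"
proof -
  obtain n where n: "N \<in> carrier_mat n n" "H \<in> carrier_mat n n" "form_index n (N ^\<^sub>m \<nu>) (H * N ^\<^sub>m (\<nu> - 1)) p"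
    using assms(1) unfolding sign_index_def by blast
  obtain k where k: "M \<in> carrier_mat k k" "K \<in> carrier_mat k k" "form_index k (M ^\<^sub>m \<nu>) (K * M ^\<^sub>m (\<nu> - 1)) q"
    using assms(2) unfolding sign_index_def by blast
  have "(H \<oplus>\<^sub>m K) * (N \<oplus>\<^sub>m M) ^\<^sub>m (\<nu> - 1) = (H * N ^\<^sub>m (\<nu> - 1)) \<oplus>\<^sub>m (K * M ^\<^sub>m (\<nu> - 1))"
    unfolding dsum_pow[OF n(1) k(1)] using n k by (intro dsum_mult[of _ n n _ n _ k k _ k]) auto
  then show ?thesis
    unfolding sign_index_def dsum_pow[OF n(1) k(1)]
    using form_index_dsum[OF n(3) k(3)] n k by (intro exI[of _ "n + k"]) auto
qed

lemma sign_index_empty: "sign_index (0\<^sub>m 0 0) (0\<^sub>m 0 0) \<nu> 0"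
proof -
  have "(0\<^sub>m 0 0 :: complex mat) ^\<^sub>m \<nu> \<in> carrier_mat 0 0" by simp
  moreover have "(0\<^sub>m 0 0 :: complex mat) * 0\<^sub>m 0 0 ^\<^sub>m (\<nu> - 1) \<in> carrier_mat 0 0" by simp
  ultimately have "form_index 0 ((0\<^sub>m 0 0 :: complex mat) ^\<^sub>m \<nu>) (0\<^sub>m 0 0 * 0\<^sub>m 0 0 ^\<^sub>m (\<nu> - 1)) 0"
    by (intro form_index_injective) (auto simp: det_dim_zero)
  then show ?thesis unfolding sign_index_def by (intro exI[of _ 0]) auto
qed

lemma sign_index_invertible:
  assumes N: "N \<in> carrier_mat n n" and H: "H \<in> carrier_mat n n" and inj: "\<And>v. v \<in> carrier_vec n \<Longrightarrow> N *\<^sub>v v = 0\<^sub>v n \<Longrightarrow> v = 0\<^sub>v n"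
  shows "sign_index N H \<nu> 0"
proof -
  have "det N \<noteq> 0" using det_0_iff_vec_prod_zero[OF N] inj by blast
  have "det (N ^\<^sub>m j) \<noteq> 0" for j
  proof (induction j)
    case (Suc j)
    then show ?case using N \<open>det N \<noteq> 0\<close> det_mult[of "N ^\<^sub>m j" n N] by simp
  qed (use N in simp)
  then show ?thesis
    unfolding sign_index_def using N H by (intro exI[of _ n] conjI form_index_injective) auto
qed

text \<open>With \<open>min n (m * \<nu>)\<close> as \<open>hi\<close>, this is the width
  \<open>w\<close> of \<open>form_index_antidiag\<close> for the m-th power of a nilpotent block of
  size \<open>n\<close>. It equals max 0 (m - |n - m \<nu>|), the number of entries \<nu> in the
  balanced tuple with sum \<open>n\<close>.\<close>

definition split_count :: "nat \<Rightarrow> nat \<Rightarrow> nat \<Rightarrow> nat" where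
  "split_count m n \<nu> = min n (m * \<nu>) - (n + m * (\<nu> - 1) - min n (m * \<nu>))"

text \<open>For \<epsilon> = 1 or -1 this is the positive index of \<epsilon> times the antidiagonal
  form of size \<open>c\<close>.\<close>

definition signed_half :: "int \<Rightarrow> nat \<Rightarrow> nat" where
  "signed_half \<epsilon> c = (if \<epsilon> = 1 then (c + 1) div 2 else c div 2)"

lemma signed_half_add: "\<epsilon> \<in> {1, -1} \<Longrightarrow> signed_half \<epsilon> c + signed_half (- \<epsilon>) c = c"
  by (auto simp: signed_half_def)

text \<open>Kernel and form have the shape treated by \<open>form_index_antidiag\<close>, with shift
  \<open>m * \<nu>\<close> in the kernel and \<open>m * (\<nu> - 1)\<close> in the form.\<close>

lemma sign_index_jordan_pow:
  assumes "\<epsilon> \<in> {1, -1}" "0 < \<nu>"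
  shows "sign_index (jordan_block n 0 ^\<^sub>m m) (of_int \<epsilon> \<cdot>\<^sub>m antidiag_mat n) \<nu> (signed_half \<epsilon> (split_count m n \<nu>))"
proof -
  let ?J = "jordan_block n (0 :: complex)"
  have J: "?J \<in> carrier_mat n n" by simp
  have "(of_int \<epsilon> \<cdot>\<^sub>m antidiag_mat n) * (?J ^\<^sub>m m) ^\<^sub>m (\<nu> - 1) =
      mat n n (\<lambda>(a, b). if a + b + 1 = n + m * (\<nu> - 1) then of_int \<epsilon> else 0)"
  proof (rule eq_matI)
    fix a b assume "a < dim_row (mat n n (\<lambda>(a, b). if a + b + 1 = n + m * (\<nu> - 1) then complex_of_int \<epsilon> else 0))"
      "b < dim_col (mat n n (\<lambda>(a, b). if a + b + 1 = n + m * (\<nu> - 1) then complex_of_int \<epsilon> else 0))"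
    then have ab: "a < n" "b < n" by auto
    define M where "M = ?J ^\<^sub>m (m * (\<nu> - 1))"
    have M: "M \<in> carrier_mat n n" by (simp add: M_def)
    have "((of_int \<epsilon> \<cdot>\<^sub>m antidiag_mat n) * M) $$ (a, b) = (of_int \<epsilon> \<cdot>\<^sub>m (antidiag_mat n * M)) $$ (a, b)"
      using M by (simp add: mult_smult_assoc_mat[of _ n n _ n])
    also have "\<dots> = of_int \<epsilon> * (antidiag_mat n * M) $$ (a, b)" using ab M by (intro index_smult_mat) auto
    also have "\<dots> = of_int \<epsilon> * M $$ (n - 1 - a, b)" using antidiag_mult_index[OF M ab] by simp
    also have "\<dots> = (if a + b + 1 = n + m * (\<nu> - 1) then of_int \<epsilon> else 0)"
      using ab unfolding M_def jordan_block_0_pow by auto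
    finally show "((of_int \<epsilon> \<cdot>\<^sub>m antidiag_mat n) * (?J ^\<^sub>m m) ^\<^sub>m (\<nu> - 1)) $$ (a, b) =
        mat n n (\<lambda>(a, b). if a + b + 1 = n + m * (\<nu> - 1) then of_int \<epsilon> else 0) $$ (a, b)"
      using ab unfolding M_def pow_mat_mult[OF J, symmetric] by simp
  qed auto
  moreover have "(?J ^\<^sub>m m) ^\<^sub>m \<nu> = mat n n (\<lambda>(a, b). if b = a + m * \<nu> then 1 else 0)"
    unfolding pow_mat_mult[OF J, symmetric] by (rule jordan_block_0_pow)
  ultimately show ?thesis
    using form_index_antidiag[of \<epsilon> n "m * \<nu>" "m * (\<nu> - 1)"] assms
    unfolding sign_index_def signed_half_def split_count_def by (intro exI[of _ n]) auto
qed

lemma split_count_one: "0 < \<nu> \<Longrightarrow> 0 < k \<Longrightarrow> split_count 1 k \<nu> = (if k = \<nu> then 1 else 0)"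
  by (auto simp: split_count_def min_def)

lemma jordan_block_inj:
  assumes "z \<noteq> (0 :: complex)" "v \<in> carrier_vec k" "jordan_block k z *\<^sub>v v = 0\<^sub>v k"
  shows "v = 0\<^sub>v k"
proof (rule inverse_imp_inj[OF _ _ _ assms(2,3)])
  have "inverse (fps_const z + fps_X) * (fps_const z + fps_X) = (1 :: complex fps)"
    using assms by (intro inverse_mult_eq_1) simp
  then show "toeplitz k (inverse (fps_const z + fps_X)) * jordan_block k z = 1\<^sub>m k"
    unfolding jordan_block_toeplitz toeplitz_mult[symmetric] by simp
qed auto

lemma jordan_block_shift: "jordan_block k z - c \<cdot>\<^sub>m 1\<^sub>m k = jordan_block k (z - c :: complex)"
  by (rule eq_matI) auto

text \<open>The factor \<delta> = -1 makes the positive index count negative blocks. At the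
  eigenvalue \<alpha> this is the power computation with exponent 1; at any other eigenvalue the
  shifted block is injective and contributes 0.\<close>

lemma block_sign_index:
  assumes "valid_block b" "0 < \<nu>" "\<delta> \<in> {1, -1}"
  shows "sign_index (block_J b - complex_of_real \<alpha> \<cdot>\<^sub>m 1\<^sub>m (dim_row (block_J b))) (of_int \<delta> \<cdot>\<^sub>m block_H b) \<nu>
    (if b = Real_Block \<nu> \<alpha> \<delta> then 1 else 0)"
proof (cases b)
  case b: (Real_Block k a \<epsilon>)
  have eps: "of_int \<delta> \<cdot>\<^sub>m block_H b = of_int (\<delta> * \<epsilon>) \<cdot>\<^sub>m antidiag_mat k"
    unfolding b by (rule eq_matI) auto
  have J: "block_J b - complex_of_real \<alpha> \<cdot>\<^sub>m 1\<^sub>m (dim_row (block_J b)) = jordan_block k (complex_of_real (a - \<alpha>))"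
    by (simp add: b jordan_block_shift)
  show ?thesis
  proof (cases "a = \<alpha>")
    case True
    have "sign_index (jordan_block k 0 ^\<^sub>m 1) (of_int (\<delta> * \<epsilon>) \<cdot>\<^sub>m antidiag_mat k) \<nu> (signed_half (\<delta> * \<epsilon>) (split_count 1 k \<nu>))"
      using assms by (intro sign_index_jordan_pow) (auto simp: b)
    moreover have "jordan_block k (0 :: complex) ^\<^sub>m 1 = jordan_block k 0" by simp
    moreover have "signed_half (\<delta> * \<epsilon>) (split_count 1 k \<nu>) = (if b = Real_Block \<nu> \<alpha> \<delta> then 1 else 0)"
      using assms True by (auto simp: b split_count_one[simplified] signed_half_def)
    ultimately show ?thesis unfolding eps J using True by simp
  next
    case False
    then show ?thesis unfolding eps J using jordan_block_inj[of "complex_of_real (a - \<alpha>)" _ k]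
      by (simp add: b sign_index_invertible[of _ k])
  qed
next
  case b: (Pair_Block k z)
  have z: "z - of_real \<alpha> \<noteq> 0" "cnj z - of_real \<alpha> \<noteq> 0" using assms(1) by (auto simp: b complex_eq_iff)
  have J: "block_J b - complex_of_real \<alpha> \<cdot>\<^sub>m 1\<^sub>m (dim_row (block_J b)) =
      jordan_block k (z - of_real \<alpha>) \<oplus>\<^sub>m jordan_block k (cnj z - of_real \<alpha>)"
    by (simp add: b dsum_smult dsum_one[symmetric] dsum_diff[of _ k k _ _ k k] jordan_block_shift del: dsum_one)
  have "sign_index (jordan_block k (z - of_real \<alpha>) \<oplus>\<^sub>m jordan_block k (cnj z - of_real \<alpha>)) (of_int \<delta> \<cdot>\<^sub>m block_H b) \<nu> 0"
  proof (rule sign_index_invertible[of _ "k + k"])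
    have "\<forall>v \<in> carrier_vec (k + k). (jordan_block k (z - of_real \<alpha>) \<oplus>\<^sub>m jordan_block k (cnj z - of_real \<alpha>)) *\<^sub>v v = 0\<^sub>v (k + k) \<longrightarrow> v = 0\<^sub>v (k + k)"
      unfolding all_vec_append
    proof (intro ballI impI)
      fix c d :: "complex vec" assume c: "c \<in> carrier_vec k" and d: "d \<in> carrier_vec k"
        and "(jordan_block k (z - of_real \<alpha>) \<oplus>\<^sub>m jordan_block k (cnj z - of_real \<alpha>)) *\<^sub>v (c @\<^sub>v d) = 0\<^sub>v (k + k)"
      then have "(jordan_block k (z - of_real \<alpha>) *\<^sub>v c) @\<^sub>v (jordan_block k (cnj z - of_real \<alpha>) *\<^sub>v d) = 0\<^sub>v (k + k)"
        using dsum_mult_vec[OF jordan_block_carrier jordan_block_carrier c d] by simp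
      also have "0\<^sub>v (k + k) = 0\<^sub>v k @\<^sub>v (0\<^sub>v k :: complex vec)" by (auto intro!: eq_vecI)
      finally have "jordan_block k (z - of_real \<alpha>) *\<^sub>v c = 0\<^sub>v k" "jordan_block k (cnj z - of_real \<alpha>) *\<^sub>v d = 0\<^sub>v k"
        using append_vec_eq[of "jordan_block k (z - of_real \<alpha>) *\<^sub>v c" k "0\<^sub>v k"] c by auto
      then have "c = 0\<^sub>v k" "d = 0\<^sub>v k" using jordan_block_inj z c d by blast+
      then show "c @\<^sub>v d = 0\<^sub>v (k + k)" by (auto intro!: eq_vecI)
    qed
    then show "v = 0\<^sub>v (k + k)" if "v \<in> carrier_vec (k + k)"
      "(jordan_block k (z - of_real \<alpha>) \<oplus>\<^sub>m jordan_block k (cnj z - of_real \<alpha>)) *\<^sub>v v = 0\<^sub>v (k + k)" for v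
      using that by blast
  qed (auto simp: b mult_2)
  then show ?thesis unfolding J by (simp add: b)
qed

lemma canon_sign_index:
  assumes "\<forall>b \<in> set bs. valid_block b" "0 < \<nu>" "\<delta> \<in> {1, -1}"
  shows "sign_index (canon_J bs - complex_of_real \<alpha> \<cdot>\<^sub>m 1\<^sub>m (dim_row (canon_J bs))) (of_int \<delta> \<cdot>\<^sub>m canon_H bs) \<nu>
    (count (mset bs) (Real_Block \<nu> \<alpha> \<delta>))"
  using assms(1)
proof (induction bs)
  case Nil
  have "0\<^sub>m 0 0 - complex_of_real \<alpha> \<cdot>\<^sub>m 1\<^sub>m 0 = 0\<^sub>m 0 0" "of_int \<delta> \<cdot>\<^sub>m 0\<^sub>m 0 0 = (0\<^sub>m 0 0 :: complex mat)" by auto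
  then show ?case using sign_index_empty by simp
next
  case (Cons b bs)
  obtain d where d: "block_J b \<in> carrier_mat d d" by (rule block_carrier)
  obtain e where e: "canon_J bs \<in> carrier_mat e e" by (rule canon_carrier)
  have "canon_J (b # bs) - complex_of_real \<alpha> \<cdot>\<^sub>m 1\<^sub>m (dim_row (canon_J (b # bs))) =
    (block_J b - complex_of_real \<alpha> \<cdot>\<^sub>m 1\<^sub>m (dim_row (block_J b))) \<oplus>\<^sub>m (canon_J bs - complex_of_real \<alpha> \<cdot>\<^sub>m 1\<^sub>m (dim_row (canon_J bs)))"
    using d e by (simp add: dsum_smult dsum_one[symmetric] dsum_diff[of _ d d _ _ e e] del: dsum_one)
  moreover have "count (mset (b # bs)) (Real_Block \<nu> \<alpha> \<delta>) =
    (if b = Real_Block \<nu> \<alpha> \<delta> then 1 else 0) + count (mset bs) (Real_Block \<nu> \<alpha> \<delta>)" by simp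
  ultimately show ?case
    using sign_index_dsum[OF block_sign_index[of b \<nu> \<delta> \<alpha>] Cons.IH] Cons.prems assms(2,3)
    by (simp add: dsum_smult)
qed

text \<open>If \<open>C\<^sup>2 = B\<close> and \<open>\<alpha> < 0\<close>, then \<open>C\<close> maps the kernel of \<open>(B - \<alpha>)\<^sup>\<nu>\<close> to itself and multiplies the
  form \<open>x\<^sup>* H (B - \<alpha>)\<^sup>\<nu>\<^sup>-\<^sup>1 x\<close> by \<open>\<alpha>\<close>, hence it exchanges positive and negative subspaces.\<close>

lemma sign_index_le_of_square_root:
  assumes C: "C \<in> carrier_mat n n" and H: "H \<in> carrier_mat n n" and HC: "H * C = mat_adjoint C * H"
    and "\<alpha> < 0" "0 < \<nu>"
    and p: "sign_index (C * C - complex_of_real \<alpha> \<cdot>\<^sub>m 1\<^sub>m n) H \<nu> p"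
    and q: "sign_index (C * C - complex_of_real \<alpha> \<cdot>\<^sub>m 1\<^sub>m n) (- 1 \<cdot>\<^sub>m H) \<nu> q"
  shows "p \<le> q"
proof -
  note assoc = assoc_mult_mat[of _ n n _ n _ n]
  define N where "N = C * C - complex_of_real \<alpha> \<cdot>\<^sub>m 1\<^sub>m n"
  define M where "M = N ^\<^sub>m (\<nu> - 1)"
  have N: "N \<in> carrier_mat n n" unfolding N_def by (intro minus_carrier_mat) auto
  have M: "M \<in> carrier_mat n n" using N by (simp add: M_def)
  have MN: "N ^\<^sub>m \<nu> = M * N" unfolding M_def using \<open>0 < \<nu>\<close> by (cases \<nu>) auto
  have CN: "N * C = C * N"
    unfolding N_def using C by (simp add: minus_mult_distrib_mat[of _ n n _ _ n] mult_minus_distrib_mat[of _ n n _ n]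
      mult_smult_assoc_mat[of _ n n _ n] mult_smult_distrib[of _ n n _ n] assoc)
  have CM: "N ^\<^sub>m j * C = C * N ^\<^sub>m j" for j using pow_mat_commute[OF N C CN] .
  have ix: "form_index n (N ^\<^sub>m \<nu>) (H * M) p" "form_index n (N ^\<^sub>m \<nu>) (- 1 \<cdot>\<^sub>m H * M) q"
    using p q N unfolding N_def[symmetric] M_def sign_index_def by (metis carrier_matD(1))+
  have ker: "N ^\<^sub>m \<nu> *\<^sub>v (C *\<^sub>v x) = 0\<^sub>v n" if x: "x \<in> carrier_vec n" "N ^\<^sub>m \<nu> *\<^sub>v x = 0\<^sub>v n" for x
  proof -
    have Np: "N ^\<^sub>m \<nu> \<in> carrier_mat n n" using N by simp
    have "N ^\<^sub>m \<nu> *\<^sub>v (C *\<^sub>v x) = C *\<^sub>v (N ^\<^sub>m \<nu> *\<^sub>v x)"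
      using assoc_mult_mat_vec[OF Np C x(1)] assoc_mult_mat_vec[OF C Np x(1)] CM by simp
    then show ?thesis unfolding x(2) using C by (auto intro!: eq_vecI)
  qed
  have form: "hform (- 1 \<cdot>\<^sub>m H * M) (C *\<^sub>v x) = - \<alpha> * hform (H * M) x"
    if x: "x \<in> carrier_vec n" "N ^\<^sub>m \<nu> *\<^sub>v x = 0\<^sub>v n" for x
  proof -
    \<comment> \<open>Moving \<open>C\<close> across \<open>H\<close> turns the transported form
      into H M C^2 = H (N^\<nu> + \<alpha> M), and N^\<nu> vanishes on \<open>x\<close>.\<close>
    have CC: "C * C = N + complex_of_real \<alpha> \<cdot>\<^sub>m 1\<^sub>m n"
      unfolding N_def using C by (intro eq_matI) auto
    have "mat_adjoint C * (H * M) * C = H * (M * (C * C))"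
    proof -
      have aC: "mat_adjoint C \<in> carrier_mat n n" using C by simp
      have "mat_adjoint C * (H * M) * C = (mat_adjoint C * H) * (M * C)"
        using aC C H M by (simp add: assoc)
      also have "\<dots> = H * (C * (M * C))" unfolding HC[symmetric] using C H M by (simp add: assoc)
      also have "C * (M * C) = M * (C * C)"
        using CM[of "\<nu> - 1"] assoc_mult_mat[OF M C C] assoc_mult_mat[OF C M C] unfolding M_def[symmetric] by simp
      finally show ?thesis .
    qed
    also have "M * (C * C) = N ^\<^sub>m \<nu> + complex_of_real \<alpha> \<cdot>\<^sub>m M"
      unfolding CC MN using M N by (simp add: mult_add_distrib_mat[of _ n n _ n] mult_smult_distrib[of _ n n _ n])
    finally have eq: "mat_adjoint C * (H * M) * C = H * (N ^\<^sub>m \<nu> + complex_of_real \<alpha> \<cdot>\<^sub>m M)" .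
    have "H *\<^sub>v ((N ^\<^sub>m \<nu> + complex_of_real \<alpha> \<cdot>\<^sub>m M) *\<^sub>v x) = H *\<^sub>v (complex_of_real \<alpha> \<cdot>\<^sub>v (M *\<^sub>v x))"
    proof -
      have "(N ^\<^sub>m \<nu> + complex_of_real \<alpha> \<cdot>\<^sub>m M) *\<^sub>v x = N ^\<^sub>m \<nu> *\<^sub>v x + (complex_of_real \<alpha> \<cdot>\<^sub>m M) *\<^sub>v x"
        using N M x by (intro add_mult_distrib_mat_vec[of _ n n]) auto
      also have "\<dots> = complex_of_real \<alpha> \<cdot>\<^sub>v (M *\<^sub>v x)"
        unfolding x(2) using M x by (intro eq_vecI) auto
      finally show ?thesis by simp
    qed
    also have "\<dots> = complex_of_real \<alpha> \<cdot>\<^sub>v (H *\<^sub>v (M *\<^sub>v x))" using H M x by (intro mult_mat_vec[of _ n n]) auto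
    finally have v: "(mat_adjoint C * (H * M) * C) *\<^sub>v x = complex_of_real \<alpha> \<cdot>\<^sub>v (H * M *\<^sub>v x)"
      unfolding eq using H M N x by (simp add: assoc_mult_mat_vec[of _ n n _ n])
    have "hform (H * M) (C *\<^sub>v x) = hform (mat_adjoint C * (H * M) * C) x"
      using hform_cong[of "H * M" n C x] C H M x by simp
    also have "\<dots> = \<alpha> * hform (H * M) x"
      unfolding hform_def v using H M x by simp
    finally have "hform (H * M) (C *\<^sub>v x) = \<alpha> * hform (H * M) x" .
    moreover have "hform (- 1 \<cdot>\<^sub>m H * M) y = - hform (H * M) y" if y: "y \<in> carrier_vec n" for y
    proof -
      define G where "G = H * M"
      have G: "G \<in> carrier_mat n n" using H M by (simp add: G_def)
      have "- 1 \<cdot>\<^sub>m H * M = - 1 \<cdot>\<^sub>m G" unfolding G_def using H M by (rule mult_smult_assoc_mat)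
      moreover have "(- 1 \<cdot>\<^sub>m G) *\<^sub>v y = - 1 \<cdot>\<^sub>v (G *\<^sub>v y)"
        using G y by (intro eq_vecI) auto
      ultimately show ?thesis unfolding hform_def G_def[symmetric] using G y by simp
    qed
    ultimately show ?thesis using C x by simp
  qed
  obtain P where P: "P \<in> carrier_mat n p"
    "\<And>c. c \<in> carrier_vec p \<Longrightarrow> N ^\<^sub>m \<nu> *\<^sub>v (P *\<^sub>v c) = 0\<^sub>v n \<and> (c \<noteq> 0\<^sub>v p \<longrightarrow> 0 < hform (H * M) (P *\<^sub>v c))"
    using ix(1) unfolding form_index_def by blast
  show ?thesis
  proof (rule pos_space_le_form_index[OF ix(2)])
    show "C * P \<in> carrier_mat n p" using C P by simp
    fix c :: "complex vec" assume c: "c \<in> carrier_vec p" "c \<noteq> 0\<^sub>v p"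
    have Pc: "P *\<^sub>v c \<in> carrier_vec n" using P c by simp
    have "C * P *\<^sub>v c = C *\<^sub>v (P *\<^sub>v c)" using C P c by simp
    then show "N ^\<^sub>m \<nu> *\<^sub>v (C * P *\<^sub>v c) = 0\<^sub>v n \<and> 0 < hform (- 1 \<cdot>\<^sub>m H * M) (C * P *\<^sub>v c)"
      using ker[OF Pc] form[OF Pc] P(2)[OF c(1)] c(2) \<open>\<alpha> < 0\<close> by (simp add: mult_neg_pos)
  qed
qed

subsection \<open>Balanced tuples\<close>

lemma split_count_alt:
  assumes "0 < \<nu>"
  shows "split_count m n \<nu> = min m (n + m - m * \<nu>) - (n - m * \<nu>)"
proof -
  obtain l where \<nu>: "\<nu> = Suc l" using assms by (cases \<nu>) auto
  define M where "M = m * l"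
  have "m * \<nu> = m + M" "m * (\<nu> - 1) = M" by (simp_all add: \<nu> M_def)
  then show ?thesis unfolding split_count_def by (auto simp: min_def)
qed

text \<open>The entry (n + m - 1 - j) div m is the ceiling of (n - j) / m, the number of indices
  below \<open>n\<close> congruent to \<open>j\<close> modulo \<open>m\<close>. It is the length of
  the chain through index \<open>j\<close> of the m-th power of a nilpotent block of size
  \<open>n\<close>, and 0 if n \<le> j.\<close>

lemma card_balanced:
  assumes "0 < m" "0 < \<nu>"
  shows "card {j. j < m \<and> (n + m - 1 - j) div m = \<nu>} = split_count m n \<nu>"
proof -
  have "(n + m - 1 - j) div m = \<nu> \<longleftrightarrow> n - m * \<nu> \<le> j \<and> j < n + m - m * \<nu>" if "j < m" for j
  proof -
    have "(n + m - 1 - j) div m = \<nu> \<longleftrightarrow> m * \<nu> \<le> n + m - 1 - j \<and> n + m - 1 - j < m * \<nu> + m"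
    proof
      assume "(n + m - 1 - j) div m = \<nu>"
      then show "m * \<nu> \<le> n + m - 1 - j \<and> n + m - 1 - j < m * \<nu> + m"
        using dividend_less_times_div[OF assms(1), of "n + m - 1 - j"] by auto
    qed (auto intro: div_nat_eqI)
    also have "\<dots> \<longleftrightarrow> n - m * \<nu> \<le> j \<and> j < n + m - m * \<nu>" using that by auto
    finally show ?thesis .
  qed
  then have "{j. j < m \<and> (n + m - 1 - j) div m = \<nu>} = {j. j < m \<and> n - m * \<nu> \<le> j \<and> j < n + m - m * \<nu>}"
    by (intro Collect_cong) blast
  also have "\<dots> = {n - m * \<nu>..<min m (n + m - m * \<nu>)}" by auto
  finally have "{j. j < m \<and> (n + m - 1 - j) div m = \<nu>} = {n - m * \<nu>..<min m (n + m - m * \<nu>)}" .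
  then show ?thesis unfolding split_count_alt[OF assms(2)] by simp
qed

text \<open>A balanced tuple is determined by its sum: its entries are \<open>q\<close> and q + 1,
  with \<open>q\<close> the last entry, and if r entries equal q + 1 the sum is m q + r. The last
  entry is not among these, so r < m and the sum determines both \<open>q\<close> and r.\<close>

lemma card_tuple_value:
  fixes t :: "nat \<Rightarrow> nat"
  assumes "0 < m" "0 < \<nu>" and desc: "\<And>i j. i \<le> j \<Longrightarrow> j < m \<Longrightarrow> t j \<le> t i" and le: "t 0 \<le> t (m - 1) + 1"
  shows "card {j. j < m \<and> t j = \<nu>} = split_count m (\<Sum>j<m. t j) \<nu>"
proof -
  define q where "q = t (m - 1)"
  define R where "R = {j. j < m \<and> t j = q + 1}"
  define r where "r = card R"
  have vals: "t j = q \<or> t j = q + 1" if "j < m" for j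
  proof -
    have "t j \<le> t 0" "t (m - 1) \<le> t j" using that by (auto intro!: desc)
    then show ?thesis using le unfolding q_def by linarith
  qed
  have fin: "finite R" by (simp add: R_def)
  have "R \<subseteq> {..<m - 1}"
  proof
    fix j assume "j \<in> R"
    then have "j < m" "j \<noteq> m - 1" by (auto simp: R_def q_def)
    then show "j \<in> {..<m - 1}" by simp
  qed
  then have "r \<le> card {..<m - 1}" unfolding r_def by (intro card_mono) auto
  then have rm: "r < m" using assms(1) by simp
  have "(\<Sum>j<m. t j) = (\<Sum>j<m. q + (if j \<in> R then 1 else 0))"
    using vals by (intro sum.cong) (auto simp: R_def)
  also have "\<dots> = m * q + card ({..<m} \<inter> R)"
    by (simp add: sum.distrib sum.If_cases)
  also have "{..<m} \<inter> R = R" by (auto simp: R_def)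
  finally have sum: "(\<Sum>j<m. t j) = m * q + r" by (simp add: r_def)
  have cq: "card {j. j < m \<and> t j = q} = m - r"
  proof -
    have "{j. j < m \<and> t j = q} = {..<m} - R" using vals by (auto simp: R_def)
    moreover have "R \<subseteq> {..<m}" by (auto simp: R_def)
    ultimately show ?thesis using fin by (simp add: card_Diff_subset r_def)
  qed
  \<comment> \<open>Naming the gap between \<nu> and \<open>q\<close> lets the product of
    \<open>m\<close> and \<nu> expand, so that the truncated subtractions can be compared
    linearly.\<close>
  consider "\<nu> = q" | "\<nu> = q + 1" | d where "\<nu> = q + 2 + d" | d where "q = \<nu> + 1 + d"
  proof -
    consider "\<nu> = q" | "\<nu> = q + 1" | "q + 2 \<le> \<nu>" | "\<nu> + 1 \<le> q" by linarith
    then show thesis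
    proof cases
      case 3
      then show thesis using that(3)[of "\<nu> - (q + 2)"] by simp
    next
      case 4
      then show thesis using that(4)[of "q - (\<nu> + 1)"] by simp
    qed (use that in auto)
  qed
  then show ?thesis
  proof cases
    case 1
    then show ?thesis unfolding sum split_count_alt[OF assms(2)] using cq rm by simp
  next
    case 2
    then show ?thesis unfolding sum split_count_alt[OF assms(2)] using rm by (simp add: r_def R_def algebra_simps)
  next
    case 3
    have "{j. j < m \<and> t j = \<nu>} = {}" using vals 3 by fastforce
    moreover have "m * q + r + m \<le> m * \<nu>" using rm unfolding 3 by (simp add: algebra_simps)
    ultimately show ?thesis unfolding sum split_count_alt[OF assms(2)] by simp
  next
    case 4
    have "{j. j < m \<and> t j = \<nu>} = {}" using vals 4 by fastforce
    moreover have "m * \<nu> + m \<le> m * q + r" unfolding 4 by (simp add: algebra_simps)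
    ultimately show ?thesis unfolding sum split_count_alt[OF assms(2)] by (simp add: min_def)
  qed
qed

lemma card_size_indices:
  "card (size_indices m n' \<nu> k) = card {j. j < m \<and> n' (m * k + j) = \<nu>}"
proof -
  have "bij_betw (\<lambda>j. m * k + j) {j. j < m \<and> n' (m * k + j) = \<nu>} (size_indices m n' \<nu> k)"
    by (rule bij_betw_byWitness[of _ "\<lambda>i. i - m * k"]) (auto simp: size_indices_def tuple_indices_def)
  from bij_betw_same_card[OF this] show ?thesis by simp
qed

lemma card_value_eq_sum:
  assumes "0 < m" "0 < \<nu>" and zero: "\<forall>i \<ge> m * p. n' i = (0 :: nat)"
  shows "card {i. n' i = \<nu>} = (\<Sum>k<p. card (size_indices m n' \<nu> k))"
proof -
  have "{i. n' i = \<nu>} = (\<Union>k\<in>{..<p}. size_indices m n' \<nu> k)"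
  proof (intro equalityI subsetI)
    fix i assume "i \<in> {i. n' i = \<nu>}"
    then have i: "n' i = \<nu>" by simp
    then have "i < m * p" using zero assms(2) by (metis not_le less_irrefl)
    then have "i div m < p" by (simp add: less_mult_imp_div_less mult.commute)
    moreover have "i \<in> tuple_indices m (i div m)"
      using assms(1) by (simp add: tuple_indices_def dividend_less_times_div)
    ultimately show "i \<in> (\<Union>k\<in>{..<p}. size_indices m n' \<nu> k)" using i by (auto simp: size_indices_def)
  qed (auto simp: size_indices_def)
  also have "card \<dots> = (\<Sum>k<p. card (size_indices m n' \<nu> k))"
  proof (rule card_UN_disjoint)
    show "\<forall>k\<in>{..<p}. finite (size_indices m n' \<nu> k)" by (auto simp: size_indices_def tuple_indices_def)
    have div: "i div m = k" if "i \<in> size_indices m n' \<nu> k" for i k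
      using that by (auto simp: size_indices_def tuple_indices_def intro!: div_nat_eqI simp: algebra_simps)
    then show "\<forall>i\<in>{..<p}. \<forall>j\<in>{..<p}. i \<noteq> j \<longrightarrow> size_indices m n' \<nu> i \<inter> size_indices m n' \<nu> j = {}"
      by blast
  qed auto
  finally show ?thesis .
qed

text \<open>The bijection is glued from bijections between the fibres. Over a positive value both
  fibres are finite and of equal size; over 0 both are infinite subsets of the natural numbers. The
  infinite tail of zeros is what permits zeros to be inserted freely into the tuples.\<close>

lemma rearrangement_exists:
  fixes s s' :: "nat \<Rightarrow> nat"
  assumes fin: "finite {i. s i \<noteq> 0}" "finite {i. s' i \<noteq> 0}"
    and card: "\<And>\<nu>. 0 < \<nu> \<Longrightarrow> card {i. s i = \<nu>} = card {i. s' i = \<nu>}"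
  shows "\<exists>\<sigma>. bij \<sigma> \<and> s' = s \<circ> \<sigma>"
proof -
  have "\<exists>f. bij_betw f {i. s' i = \<nu>} {i. s i = \<nu>}" for \<nu>
  proof (cases "\<nu> = 0")
    case True
    have inf: "infinite {i. t i = 0}" if "finite {i. t i \<noteq> 0}" for t :: "nat \<Rightarrow> nat"
    proof
      assume "finite {i. t i = 0}"
      then have "finite ({i. t i = 0} \<union> {i. t i \<noteq> 0})" using that by blast
      moreover have "{i. t i = 0} \<union> {i. t i \<noteq> 0} = UNIV" by auto
      ultimately show False using infinite_UNIV_nat by metis
    qed
    have "infinite {i. s i = 0}" "infinite {i. s' i = 0}" by (rule inf[OF fin(1)], rule inf[OF fin(2)])
    then have "bij_betw (enumerate {i. s i = 0}) UNIV {i. s i = 0}"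
      "bij_betw (enumerate {i. s' i = 0}) UNIV {i. s' i = 0}" by (auto intro: bij_enumerate)
    then show ?thesis unfolding True by (meson bij_betw_inv bij_betw_trans)
  next
    case False
    have "finite {i. s' i = \<nu>}" "finite {i. s i = \<nu>}"
      using False by (auto intro: finite_subset[OF _ fin(1)] finite_subset[OF _ fin(2)])
    then show ?thesis using card[of \<nu>] False by (intro finite_same_card_bij) auto
  qed
  then obtain f where f: "\<And>\<nu>. bij_betw (f \<nu>) {i. s' i = \<nu>} {i. s i = \<nu>}" by metis
  define \<sigma> where "\<sigma> i = f (s' i) i" for i
  have s\<sigma>: "s (\<sigma> i) = s' i" for i
    using bij_betwE[OF f[of "s' i"]] by (auto simp: \<sigma>_def)
  have "bij \<sigma>"
  proof (rule bijI)
    show "inj \<sigma>"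
    proof (rule injI)
      fix i j assume eq: "\<sigma> i = \<sigma> j"
      then have "s' i = s' j" using s\<sigma> by metis
      then show "i = j"
        using eq bij_betw_imp_inj_on[OF f[of "s' i"]] by (auto simp: \<sigma>_def dest: inj_onD)
    qed
    show "surj \<sigma>"
      unfolding surj_def
    proof
      fix y
      have "y \<in> f (s y) ` {i. s' i = s y}" using bij_betw_imp_surj_on[OF f[of "s y"]] by blast
      then obtain x where x: "s' x = s y" "y = f (s y) x" by blast
      have "y = \<sigma> x" unfolding \<sigma>_def x(1) by (rule x(2))
      then show "\<exists>x. y = \<sigma> x" ..
    qed
  qed
  moreover have "s' = s \<circ> \<sigma>" using s\<sigma> by auto
  ultimately show ?thesis by blast
qed

lemma card_rearrangement:
  assumes "bij \<sigma>" "s' = s \<circ> \<sigma>"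
  shows "card {i. s' i = \<nu>} = card {i. s i = \<nu>}"
proof -
  have "\<sigma> ` {i. s' i = \<nu>} = {i. s i = \<nu>}"
    using assms by (auto simp: image_iff) (metis bij_pointE)
  moreover have "inj_on \<sigma> {i. s' i = \<nu>}" using assms(1) by (meson bij_is_inj inj_on_subset subset_UNIV)
  ultimately show ?thesis by (metis card_image)
qed

lemma pos_count_signed_half:
  assumes "\<eta> k \<in> {1, -1}"
  shows "pos_count m n' \<eta> \<nu> k = int (signed_half (\<eta> k) (card (size_indices m n' \<nu> k)))"
proof (cases "even (card (size_indices m n' \<nu> k))")
  case False
  then obtain b where "card (size_indices m n' \<nu> k) = 2 * b + 1" by (auto elim: oddE)
  then show ?thesis using assms by (auto simp: pos_count_def signed_half_def)
qed (use assms in \<open>auto simp: pos_count_def signed_half_def zdiv_int elim!: evenE\<close>)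

subsection \<open>The Segre characteristic of a canonical form\<close>

fun block_sizes :: "canon_block \<Rightarrow> (nat \<times> complex) list" where
  "block_sizes (Real_Block k a \<epsilon>) = [(k, complex_of_real a)]"
| "block_sizes (Pair_Block k z) = [(k, z), (k, cnj z)]"

lemma card_padded_desc:
  assumes "0 < \<nu>"
  shows "card {i. padded_desc ks i = \<nu>} = count (mset ks) \<nu>"
proof -
  have "{i. padded_desc ks i = \<nu>} = {i. i < length (rev (sort ks)) \<and> rev (sort ks) ! i = \<nu>}"
    using assms by (auto simp: padded_desc_def)
  also have "card \<dots> = length (filter (\<lambda>x. x = \<nu>) (rev (sort ks)))"
    by (simp only: length_filter_conv_card)
  also have "length (filter (\<lambda>x. x = \<nu>) xs) = count (mset xs) \<nu>" for xs
    by (induction xs) auto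
  also have "count (mset (rev (sort ks))) \<nu> = count (mset ks) \<nu>" by simp
  finally show ?thesis .
qed

lemma canon_jordan_matrix: "jordan_matrix (concat (map block_sizes bs)) = canon_J bs"
proof -
  have "jordan_matrix (block_sizes b) = block_J b" for b
    by (cases b) (auto simp: jordan_matrix_def)
  then show ?thesis
    unfolding jordan_matrix_concat_diag_block_mat canon_J_def by (simp add: o_def)
qed

lemma segre_char_canonical:
  assumes "similar_mat B (canon_J bs)" "\<forall>b \<in> set bs. valid_block b"
  shows "segre_char B 0 = padded_desc (jordan_sizes (concat (map block_sizes bs)) 0)"
proof (rule segre_char_eq)
  have "0 \<notin> fst ` set (block_sizes b)" if "valid_block b" for b
    using that by (cases b) auto
  then show "jordan_nf B (concat (map block_sizes bs))"
    using assms by (auto simp: jordan_nf_def canon_jordan_matrix image_UN)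
qed

lemma count_jordan_sizes_canonical:
  assumes "\<forall>b \<in> set bs. valid_block b"
  shows "count (mset (jordan_sizes (concat (map block_sizes bs)) 0)) \<nu> =
    count (mset bs) (Real_Block \<nu> 0 1) + count (mset bs) (Real_Block \<nu> 0 (-1))"
  using assms
proof (induction bs)
  case (Cons b bs)
  have "count (mset (jordan_sizes (block_sizes b) 0)) \<nu> =
    (if b = Real_Block \<nu> 0 1 then 1 else 0) + (if b = Real_Block \<nu> 0 (-1) then 1 else 0)"
  proof (cases b)
    case (Pair_Block k z)
    then have "z \<noteq> 0" using Cons.prems by auto
    then show ?thesis using Pair_Block by (simp add: jordan_sizes_def)
  qed (use Cons.prems in \<open>auto simp: jordan_sizes_def\<close>)
  moreover have "jordan_sizes (concat (map block_sizes (b # bs))) 0 =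
    jordan_sizes (block_sizes b) 0 @ jordan_sizes (concat (map block_sizes bs)) 0"
    by (simp add: jordan_sizes_def)
  ultimately show ?case using Cons by simp
qed (simp add: jordan_sizes_def)

lemma num_positive_zero_part:
  "num_positive_blocks \<nu> (zero_part bs) = count (mset bs) (Real_Block \<nu> 0 1)"
proof (induction bs)
  case (Cons b bs)
  then show ?case by (cases b) (auto simp: num_positive_blocks_def zero_part_def)
qed (simp add: num_positive_blocks_def zero_part_def)

subsection \<open>Block data of a root at the eigenvalue zero\<close>

text \<open>The list \<open>zs\<close> holds the sizes and signs of the blocks at 0 of a prospective
  root. The equation demands that their m-th powers together produce as many blocks of each size and
  sign as \<open>bs\<close> has at 0. This condition mediates between the combinatorial properties
  and the existence of a root.\<close>

definition zero_root_data :: "nat \<Rightarrow> canon_block list \<Rightarrow> (nat \<times> int) list \<Rightarrow> bool" where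
  "zero_root_data m bs zs \<longleftrightarrow> (\<forall>(k, \<epsilon>) \<in> set zs. 0 < k \<and> \<epsilon> \<in> {1, -1}) \<and>
     (\<forall>\<nu> \<delta>. 0 < \<nu> \<longrightarrow> \<delta> \<in> {1, -1} \<longrightarrow> count (mset bs) (Real_Block \<nu> 0 \<delta>) =
        (\<Sum>(k, \<epsilon>) \<leftarrow> zs. signed_half (\<delta> * \<epsilon>) (split_count m k \<nu>)))"

text \<open>Each block of the root supplies one tuple, the balanced one whose sum is the size of the
  block, and the sign of the block serves as \<eta>. Adding the counts for both signs removes the
  dependence on \<eta> and gives the Segre characteristic.\<close>

lemma properties_of_zero_root_data:
  assumes "0 < m" and sim: "similar_mat B (canon_J bs)" and val: "\<forall>b \<in> set bs. valid_block b"
    and data: "zero_root_data m bs zs"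
  shows "property1 m B \<and> property2 m B bs"
proof -
  define p where "p = length zs"
  define K where "K k = fst (zs ! k)" for k
  define \<eta> where "\<eta> k = snd (zs ! k)" for k
  define n' where "n' i = (if i < m * p then (K (i div m) + m - 1 - i mod m) div m else 0)" for i
  have K: "0 < K k" and \<eta>: "\<eta> k \<in> {1, -1}" if "k < p" for k
  proof -
    have "zs ! k \<in> set zs" using that by (simp add: p_def)
    moreover have "\<forall>(k, \<epsilon>) \<in> set zs. 0 < k \<and> \<epsilon> \<in> {1, -1}"
      using data unfolding zero_root_data_def by (rule conjunct1)
    ultimately have "case zs ! k of (k, \<epsilon>) \<Rightarrow> 0 < k \<and> \<epsilon> \<in> {1, -1}" by (rule bspec[rotated])
    then show "0 < K k" "\<eta> k \<in> {1, -1}" unfolding K_def \<eta>_def by (simp_all only: case_prod_beta)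
  qed
  have tup: "n' (m * k + j) = (K k + m - 1 - j) div m" if "k < p" "j < m" for k j
  proof -
    have "m * k + j < m * (k + 1)" using that by simp
    also have "\<dots> \<le> m * p" using that by (intro mult_le_mono2) simp
    finally show ?thesis using that by (simp add: n'_def)
  qed
  have card: "card (size_indices m n' \<nu> k) = split_count m (K k) \<nu>" if "k < p" "0 < \<nu>" for k \<nu>
  proof -
    have "{j. j < m \<and> n' (m * k + j) = \<nu>} = {j. j < m \<and> (K k + m - 1 - j) div m = \<nu>}"
      using tup[OF that(1)] by auto
    then show ?thesis unfolding card_size_indices using card_balanced[OF assms(1) that(2)] by simp
  qed
  have counts: "count (mset bs) (Real_Block \<nu> 0 \<delta>) = (\<Sum>k<p. signed_half (\<delta> * \<eta> k) (split_count m (K k) \<nu>))"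
    if "0 < \<nu>" "\<delta> \<in> {1, -1}" for \<nu> \<delta>
  proof -
    have "count (mset bs) (Real_Block \<nu> 0 \<delta>) = (\<Sum>(k, \<epsilon>) \<leftarrow> zs. signed_half (\<delta> * \<epsilon>) (split_count m k \<nu>))"
      using data that unfolding zero_root_data_def by blast
    also have "\<dots> = (\<Sum>k<p. signed_half (\<delta> * \<eta> k) (split_count m (K k) \<nu>))"
      unfolding sum_list_sum_nth by (auto simp: p_def K_def \<eta>_def lessThan_atLeast0 split: prod.splits intro!: sum.cong)
    finally show ?thesis .
  qed
  define s where "s = segre_char B 0"
  have s: "s = padded_desc (jordan_sizes (concat (map block_sizes bs)) 0)"
    unfolding s_def by (rule segre_char_canonical[OF sim val])
  have zero: "\<forall>i \<ge> m * p. n' i = 0" by (simp add: n'_def)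
  have "\<exists>\<sigma>. bij \<sigma> \<and> n' = s \<circ> \<sigma>"
  proof (rule rearrangement_exists)
    show "finite {i. s i \<noteq> 0}" unfolding s
      by (rule finite_subset[of _ "{..<length (jordan_sizes (concat (map block_sizes bs)) 0)}"]) (auto simp: padded_desc_def)
    show "finite {i. n' i \<noteq> 0}" by (rule finite_subset[of _ "{..<m * p}"]) (auto simp: n'_def)
    fix \<nu> :: nat assume \<nu>: "0 < \<nu>"
    have "card {i. s i = \<nu>} = count (mset bs) (Real_Block \<nu> 0 1) + count (mset bs) (Real_Block \<nu> 0 (-1))"
      unfolding s card_padded_desc[OF \<nu>] count_jordan_sizes_canonical[OF val] ..
    also have "\<dots> = (\<Sum>k<p. signed_half (\<eta> k) (split_count m (K k) \<nu>) + signed_half (- \<eta> k) (split_count m (K k) \<nu>))"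
      using counts[OF \<nu>, of 1] counts[OF \<nu>, of "-1"] by (simp add: sum.distrib)
    also have "\<dots> = (\<Sum>k<p. card (size_indices m n' \<nu> k))"
      using signed_half_add \<eta> card[OF _ \<nu>] by (intro sum.cong) auto
    also have "\<dots> = card {i. n' i = \<nu>}" using card_value_eq_sum[OF assms(1) \<nu> zero] by simp
    finally show "card {i. s i = \<nu>} = card {i. n' i = \<nu>}" .
  qed
  moreover have "\<exists>i \<in> tuple_indices m k. n' i \<noteq> 0" if "k < p" for k
  proof
    show "m * k \<in> tuple_indices m k" using assms(1) by (simp add: tuple_indices_def)
    \<comment> \<open>The first entry is the ceiling of K k / m, which is positive because the block
      has positive size.\<close>
    show "n' (m * k) \<noteq> 0" using tup[OF that, of 0] K[OF that] assms(1) by (simp add: div_eq_0_iff)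
  qed
  ultimately have reord: "is_tuple_reordering m (segre_char B 0) p n'"
    using zero unfolding is_tuple_reordering_def s_def by blast
  have prop1: "property1_for m n'"
    unfolding property1_for_def
  proof (intro allI conjI ballI impI)
    fix k i j assume ij: "i \<in> tuple_indices m k" "j \<in> tuple_indices m k" "i \<le> j"
    show "n' j \<le> n' i"
    proof (cases "k < p")
      case True
      obtain a b where "i = m * k + a" "j = m * k + b" "a < m" "b < m" "a \<le> b"
        using ij by (auto simp: tuple_indices_def le_iff_add)
      then show ?thesis using tup[OF True] by (auto intro: div_le_mono diff_le_mono2)
    next
      case False
      then have "m * p \<le> m * k" by (intro mult_le_mono2) simp
      also have "\<dots> \<le> j" using ij by (simp add: tuple_indices_def)
      finally have "m * p \<le> j" .
      then have "n' j = 0" using zero by blast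
      then show ?thesis by simp
    qed
  next
    fix k
    show "int (n' (m * k)) - int (n' (m * k + m - 1)) \<le> 1"
    proof (cases "k < p")
      case True
      have "n' (m * k) = (K k + m - 1) div m" using tup[OF True, of 0] assms(1) by simp
      also have "\<dots> \<le> (K k + m) div m" by (intro div_le_mono) simp
      also have "\<dots> = K k div m + 1" using assms(1) by simp
      also have "K k div m = n' (m * k + m - 1)"
        using tup[OF True, of "m - 1"] assms(1) by simp
      finally show ?thesis by simp
    next
      case False
      then have "m * p \<le> m * k" by simp
      then show ?thesis using zero by simp
    qed
  qed
  have "int (num_positive_blocks \<nu> (zero_part bs)) = (\<Sum>k < p. pos_count m n' \<eta> \<nu> k)" if \<nu>: "0 < \<nu>" for \<nu>
  proof -
    have "int (num_positive_blocks \<nu> (zero_part bs)) = (\<Sum>k<p. int (signed_half (\<eta> k) (split_count m (K k) \<nu>)))"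
      unfolding num_positive_zero_part using counts[OF \<nu>, of 1] by simp
    also have "\<dots> = (\<Sum>k < p. pos_count m n' \<eta> \<nu> k)"
      using pos_count_signed_half \<eta> card[OF _ \<nu>] by (intro sum.cong) auto
    finally show ?thesis .
  qed
  then show ?thesis
    unfolding property1_def property2_def using reord prop1 \<eta> by blast
qed

text \<open>Each tuple is replaced by its sum \<open>K k\<close>, which determines it by
  \<open>card_tuple_value\<close>. Property 2 prescribes only the positive blocks; the negative ones
  are what remains of the total given by the Segre characteristic.\<close>

lemma zero_root_data_of_property2:
  assumes "0 < m" and sim: "similar_mat B (canon_J bs)" and val: "\<forall>b \<in> set bs. valid_block b"
    and "property2 m B bs"
  shows "\<exists>zs. zero_root_data m bs zs"
proof -
  obtain p n' \<eta> where reord: "is_tuple_reordering m (segre_char B 0) p n'" and prop1: "property1_for m n'"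
    and \<eta>: "\<And>k. k < p \<Longrightarrow> \<eta> k \<in> {1, -1 :: int}"
    and pos: "\<And>\<nu>. 0 < \<nu> \<Longrightarrow> \<nu> \<in> range (segre_char B 0) \<Longrightarrow>
      int (num_positive_blocks \<nu> (zero_part bs)) = (\<Sum>k < p. pos_count m n' \<eta> \<nu> k)"
    using assms(4) unfolding property2_def by blast
  define K where "K k = (\<Sum>j<m. n' (m * k + j))" for k
  define zs where "zs = map (\<lambda>k. (K k, \<eta> k)) [0..<p]"
  have card: "card (size_indices m n' \<nu> k) = split_count m (K k) \<nu>" if "0 < \<nu>" for k \<nu>
    unfolding card_size_indices K_def
  proof (rule card_tuple_value[OF assms(1) that])
    fix i j assume "i \<le> j" "j < m"
    then have "m * k + i \<in> tuple_indices m k" "m * k + j \<in> tuple_indices m k" by (auto simp: tuple_indices_def)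
    then show "n' (m * k + j) \<le> n' (m * k + i)"
      using prop1 \<open>i \<le> j\<close> unfolding property1_for_def by auto
  next
    have "int (n' (m * k)) - int (n' (m * k + m - 1)) \<le> 1" using prop1 unfolding property1_for_def by blast
    then show "n' (m * k + 0) \<le> n' (m * k + (m - 1)) + 1" using assms(1) by simp
  qed
  have K: "0 < K k" if k: "k < p" for k
  proof -
    obtain i where i: "i \<in> tuple_indices m k" "n' i \<noteq> 0"
      using reord k unfolding is_tuple_reordering_def by blast
    then obtain j where "i = m * k + j" "j < m" by (auto simp: tuple_indices_def le_iff_add)
    then show ?thesis unfolding K_def using i by (intro sum_pos2[of _ j]) auto
  qed
  have zero: "\<forall>i \<ge> m * p. n' i = 0" and "\<exists>\<sigma>. bij \<sigma> \<and> n' = segre_char B 0 \<circ> \<sigma>"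
    using reord unfolding is_tuple_reordering_def by auto
  then obtain \<sigma> where \<sigma>: "bij \<sigma>" "n' = segre_char B 0 \<circ> \<sigma>" by blast
  have total: "(\<Sum>k<p. split_count m (K k) \<nu>) =
      count (mset bs) (Real_Block \<nu> 0 1) + count (mset bs) (Real_Block \<nu> 0 (-1))" if \<nu>: "0 < \<nu>" for \<nu>
  proof -
    have "(\<Sum>k<p. split_count m (K k) \<nu>) = card {i. n' i = \<nu>}"
      using card_value_eq_sum[OF assms(1) \<nu> zero] card[OF \<nu>] by simp
    also have "\<dots> = card {i. segre_char B 0 i = \<nu>}" by (rule card_rearrangement[OF \<sigma>])
    finally show ?thesis
      unfolding segre_char_canonical[OF sim val] card_padded_desc[OF \<nu>] count_jordan_sizes_canonical[OF val] .
  qed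
  have plus: "count (mset bs) (Real_Block \<nu> 0 1) = (\<Sum>k<p. signed_half (\<eta> k) (split_count m (K k) \<nu>))" if \<nu>: "0 < \<nu>" for \<nu>
  proof (cases "\<nu> \<in> range (segre_char B 0)")
    case True
    have "int (count (mset bs) (Real_Block \<nu> 0 1)) = (\<Sum>k<p. int (signed_half (\<eta> k) (split_count m (K k) \<nu>)))"
      using pos[OF \<nu> True] pos_count_signed_half \<eta> card[OF \<nu>] unfolding num_positive_zero_part by simp
    then show ?thesis by (metis of_nat_eq_iff of_nat_sum)
  next
    case False
    \<comment> \<open>Property 2 is silent about sizes outside the Segre characteristic. No tuple
      contains such a size, so both sides are 0.\<close>
    then have "{i. n' i = \<nu>} = {}" unfolding \<sigma>(2) by auto
    then have 0: "(\<Sum>k<p. split_count m (K k) \<nu>) = 0"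
      using card_value_eq_sum[OF assms(1) \<nu> zero] card[OF \<nu>] by simp
    then have "\<forall>k<p. split_count m (K k) \<nu> = 0" by simp
    then have "(\<Sum>k<p. signed_half (\<eta> k) (split_count m (K k) \<nu>)) = 0" by (simp add: signed_half_def)
    moreover have "count (mset bs) (Real_Block \<nu> 0 1) = 0" using total[OF \<nu>] unfolding 0 by linarith
    ultimately show ?thesis by linarith
  qed
  have "count (mset bs) (Real_Block \<nu> 0 \<delta>) = (\<Sum>k<p. signed_half (\<delta> * \<eta> k) (split_count m (K k) \<nu>))"
    if \<nu>: "0 < \<nu>" and "\<delta> \<in> {1, -1}" for \<nu> \<delta>
  proof (cases "\<delta> = 1")
    case False
    \<comment> \<open>The two halves of each count add up to the whole, so the negative counts
      follow from \<open>total\<close> by subtraction.\<close>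
    have "(\<Sum>k<p. signed_half (\<eta> k) (split_count m (K k) \<nu>)) + (\<Sum>k<p. signed_half (- \<eta> k) (split_count m (K k) \<nu>)) =
        (\<Sum>k<p. split_count m (K k) \<nu>)"
      unfolding sum.distrib[symmetric] using signed_half_add \<eta> by (intro sum.cong) auto
    then show ?thesis using total[OF \<nu>] plus[OF \<nu>] False that by simp
  qed (use plus[OF \<nu>] in simp)
  moreover have "(\<Sum>(k, \<epsilon>) \<leftarrow> zs. f k \<epsilon>) = (\<Sum>k<p. f (K k) (\<eta> k))" for f :: "nat \<Rightarrow> int \<Rightarrow> nat"
    unfolding zs_def by (simp add: o_def interv_sum_list_conv_sum_set_nat lessThan_atLeast0)
  ultimately have "zero_root_data m bs zs"
    unfolding zero_root_data_def using K \<eta> by (auto simp: zs_def)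
  then show ?thesis ..
qed

section \<open>From a root to its block data at zero\<close>

lemma cong_pair_canonical:
  assumes "is_canonical_form B H bs" "B \<in> carrier_mat n n" "H \<in> carrier_mat n n"
  shows "cong_pair B H (canon_J bs) (canon_H bs)"
proof -
  obtain S S' where w: "similar_mat_wit (canon_J bs) B S' S" and H: "canon_H bs = mat_adjoint S * H * S"
    using assms(1) unfolding is_canonical_form_def by blast
  note W = similar_mat_witD[OF refl w]
  have n: "dim_row (canon_J bs) = n" using W(5) assms(2) by (metis carrier_matD(1))
  show ?thesis
    using W H assms(2,3) unfolding n by (intro cong_pairI[of _ n _ S S']) auto
qed

lemma cong_pair_smult:
  assumes "cong_pair A H A' H'"
  shows "cong_pair A (c \<cdot>\<^sub>m H) A' (c \<cdot>\<^sub>m H')"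
  using assms
proof (rule cong_pairE)
  fix n S T
  assume c: "A \<in> carrier_mat n n" "H \<in> carrier_mat n n" "S \<in> carrier_mat n n" "T \<in> carrier_mat n n"
    "S * T = 1\<^sub>m n" "T * S = 1\<^sub>m n" "A' = T * A * S" "H' = mat_adjoint S * H * S"
  have "mat_adjoint S * (c \<cdot>\<^sub>m H) * S = c \<cdot>\<^sub>m (mat_adjoint S * H * S)"
    using c(2,3) by (simp add: mult_smult_distrib[of _ n n _ n] mult_smult_assoc_mat[of _ n n _ n])
  then show ?thesis using c by (intro cong_pairI[of _ n _ S T]) auto
qed

lemma canon_pairs:
  "canon_J bs = diag_block_mat (map fst (map (\<lambda>b. (block_J b, block_H b)) bs))"
  "canon_H bs = diag_block_mat (map snd (map (\<lambda>b. (block_J b, block_H b)) bs))"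
  by (simp_all add: canon_J_def canon_H_def o_def)

lemma cong_pair_canon_perm:
  assumes "mset bs = mset cs"
  shows "cong_pair (canon_J bs) (canon_H bs) (canon_J cs) (canon_H cs)"
  unfolding canon_pairs
proof (rule cong_pair_perm)
  show "mset (map (\<lambda>b. (block_J b, block_H b)) bs) = mset (map (\<lambda>b. (block_J b, block_H b)) cs)"
    using assms by (simp only: mset_map)
  have "\<exists>n. block_J b \<in> carrier_mat n n \<and> block_H b \<in> carrier_mat n n" for b
    by (rule block_carrier[of b]) blast
  then show "square_pairs (map (\<lambda>b. (block_J b, block_H b)) bs)" by (simp add: square_pairs_def)
qed

lemma canon_append:
  "canon_J (bs @ cs) = canon_J bs \<oplus>\<^sub>m canon_J cs" "canon_H (bs @ cs) = canon_H bs \<oplus>\<^sub>m canon_H cs"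
  by (simp_all add: canon_J_def canon_H_def diag_block_mat_app)

lemma canon_sign_index_0:
  assumes "\<forall>b \<in> set bs. valid_block b" "0 < \<nu>" "\<delta> \<in> {1, -1}"
  shows "sign_index (canon_J bs) (of_int \<delta> \<cdot>\<^sub>m canon_H bs) \<nu> (count (mset bs) (Real_Block \<nu> 0 \<delta>))"
proof -
  obtain d where "canon_J bs \<in> carrier_mat d d" by (rule canon_carrier)
  then have "canon_J bs - complex_of_real 0 \<cdot>\<^sub>m 1\<^sub>m (dim_row (canon_J bs)) = canon_J bs" by (intro eq_matI) auto
  then show ?thesis using canon_sign_index[OF assms, of 0] by simp
qed

abbreviation zero_blocks :: "(nat \<times> int) list \<Rightarrow> canon_block list" where
  "zero_blocks zs \<equiv> map (\<lambda>(k, \<epsilon>). Real_Block k 0 \<epsilon>) zs"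

lemma zero_blocks_exist:
  assumes "\<forall>b \<in> set cs. valid_block b \<and> is_zero_block b"
  shows "\<exists>zs. cs = zero_blocks zs \<and> (\<forall>(k, \<epsilon>) \<in> set zs. 0 < k \<and> \<epsilon> \<in> {1, -1})"
  using assms
proof (induction cs)
  case (Cons b cs)
  then obtain zs where zs: "cs = zero_blocks zs" "\<forall>(k, \<epsilon>) \<in> set zs. 0 < k \<and> \<epsilon> \<in> {1, -1}" by auto
  obtain k \<epsilon> where "b = Real_Block k 0 \<epsilon>" "0 < k" "\<epsilon> \<in> {1, -1}" using Cons.prems by (cases b) auto
  with zs show ?case by (intro exI[of _ "(k, \<epsilon>) # zs"]) auto
qed (intro exI[of _ "[]"], simp)

definition root_power :: "nat \<Rightarrow> (nat \<times> int) list \<Rightarrow> complex mat" where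
  "root_power m zs = diag_block_mat (map (\<lambda>(k, \<epsilon>). jordan_block k 0 ^\<^sub>m m) zs)"

lemma canon_J_zero_blocks_pow: "canon_J (zero_blocks zs) ^\<^sub>m m = root_power m zs"
proof (induction zs)
  case Nil
  show ?case unfolding root_power_def by (intro eq_matI) auto
next
  case (Cons x zs)
  obtain k \<epsilon> where x: "x = (k, \<epsilon>)" by (cases x)
  obtain d where d: "canon_J (zero_blocks zs) \<in> carrier_mat d d" by (rule canon_carrier)
  show ?case using dsum_pow[OF _ d, of "jordan_block k 0" k m] Cons by (simp add: x root_power_def)
qed

lemma root_power_sign_index:
  assumes "\<forall>(k, \<epsilon>) \<in> set zs. 0 < k \<and> \<epsilon> \<in> {1, -1}" "0 < \<nu>" "\<delta> \<in> {1, -1}"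
  shows "sign_index (root_power m zs) (of_int \<delta> \<cdot>\<^sub>m canon_H (zero_blocks zs)) \<nu>
    (\<Sum>(k, \<epsilon>) \<leftarrow> zs. signed_half (\<delta> * \<epsilon>) (split_count m k \<nu>))"
  using assms(1)
proof (induction zs)
  case Nil
  have "of_int \<delta> \<cdot>\<^sub>m 0\<^sub>m 0 0 = (0\<^sub>m 0 0 :: complex mat)" by auto
  then show ?case using sign_index_empty by (simp add: root_power_def)
next
  case (Cons x zs)
  obtain k \<epsilon> where x: "x = (k, \<epsilon>)" by (cases x)
  have "sign_index (jordan_block k 0 ^\<^sub>m m) (of_int (\<delta> * \<epsilon>) \<cdot>\<^sub>m antidiag_mat k) \<nu> (signed_half (\<delta> * \<epsilon>) (split_count m k \<nu>))"
    using Cons.prems assms by (intro sign_index_jordan_pow) (auto simp: x)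
  moreover have "of_int (\<delta> * \<epsilon>) \<cdot>\<^sub>m antidiag_mat k = of_int \<delta> \<cdot>\<^sub>m (of_int \<epsilon> \<cdot>\<^sub>m antidiag_mat k)"
    by (rule eq_matI) auto
  ultimately show ?case
    using sign_index_dsum[OF _ Cons.IH] Cons.prems by (simp add: x root_power_def dsum_smult)
qed

lemma inj_mat_pow:
  fixes A :: "complex mat"
  assumes A: "A \<in> carrier_mat n n" and inj: "\<forall>v \<in> carrier_vec n. A *\<^sub>v v = 0\<^sub>v n \<longrightarrow> v = 0\<^sub>v n"
    and "v \<in> carrier_vec n" "A ^\<^sub>m j *\<^sub>v v = 0\<^sub>v n"
  shows "v = 0\<^sub>v n"
  using assms(3,4)
proof (induction j arbitrary: v)
  case 0
  then show ?case using A by simp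
next
  case (Suc j)
  have "A ^\<^sub>m j *\<^sub>v (A *\<^sub>v v) = 0\<^sub>v n"
    using Suc.prems A by (simp add: assoc_mult_mat_vec[of _ n n _ n])
  then have "A *\<^sub>v v = 0\<^sub>v n" using Suc.IH[of "A *\<^sub>v v"] A Suc.prems(1) sq_mult_vec_carrier by blast
  then show ?case using inj Suc.prems(1) by blast
qed

text \<open>For each size and sign the index of the power is computed twice, once from its canonical
  form and once from the splitting of \<open>A\<close>, whose injective part contributes 0.
  Uniqueness of the index equates the two counts.\<close>

lemma zero_root_data_of_root:
  assumes A: "A \<in> carrier_mat n n" and H: "H \<in> carrier_mat n n" "mat_adjoint H = H"
    and K: "K \<in> carrier_mat n n" "H * K = 1\<^sub>m n" "K * H = 1\<^sub>m n"
    and HA: "H * A = mat_adjoint A * H"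
    and cong: "cong_pair (A ^\<^sub>m m) H (canon_J bs) (canon_H bs)" and val: "\<forall>b \<in> set bs. valid_block b"
  shows "\<exists>zs. zero_root_data m bs zs"
proof -
  obtain cs l A' H' where cs: "\<forall>b \<in> set cs. valid_block b \<and> is_zero_block b"
    and A': "A' \<in> carrier_mat l l" and H': "H' \<in> carrier_mat l l"
    and inj: "\<forall>v \<in> carrier_vec l. A' *\<^sub>v v = 0\<^sub>v l \<longrightarrow> v = 0\<^sub>v l"
    and congA: "cong_pair A H (canon_J cs \<oplus>\<^sub>m A') (canon_H cs \<oplus>\<^sub>m H')"
    using split_nilpotent_part[OF A H K HA] by blast
  obtain zs where zs: "cs = zero_blocks zs" and zval: "\<forall>(k, \<epsilon>) \<in> set zs. 0 < k \<and> \<epsilon> \<in> {1, -1}"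
    using zero_blocks_exist[OF cs] by blast
  obtain d where d: "canon_J cs \<in> carrier_mat d d" by (rule canon_carrier)
  have pow: "(canon_J cs \<oplus>\<^sub>m A') ^\<^sub>m m = root_power m zs \<oplus>\<^sub>m A' ^\<^sub>m m"
    unfolding dsum_pow[OF d A'] unfolding zs canon_J_zero_blocks_pow ..
  have "count (mset bs) (Real_Block \<nu> 0 \<delta>) = (\<Sum>(k, \<epsilon>) \<leftarrow> zs. signed_half (\<delta> * \<epsilon>) (split_count m k \<nu>))"
    if \<nu>: "0 < \<nu>" and \<delta>: "\<delta> \<in> {1, -1}" for \<nu> \<delta>
  proof -
    let ?s = "\<Sum>(k, \<epsilon>) \<leftarrow> zs. signed_half (\<delta> * \<epsilon>) (split_count m k \<nu>)"
    have "sign_index (A' ^\<^sub>m m) (of_int \<delta> \<cdot>\<^sub>m H') \<nu> 0"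
    proof (rule sign_index_invertible)
      show "A' ^\<^sub>m m \<in> carrier_mat l l" "of_int \<delta> \<cdot>\<^sub>m H' \<in> carrier_mat l l" using A' H' by auto
    qed (rule inj_mat_pow[OF A' inj])
    then have "sign_index (root_power m zs \<oplus>\<^sub>m A' ^\<^sub>m m) (of_int \<delta> \<cdot>\<^sub>m (canon_H cs \<oplus>\<^sub>m H')) \<nu> (?s + 0)"
      unfolding dsum_smult zs by (intro sign_index_dsum root_power_sign_index zval \<nu> \<delta>)
    moreover have "cong_pair (A ^\<^sub>m m) (of_int \<delta> \<cdot>\<^sub>m H) (root_power m zs \<oplus>\<^sub>m A' ^\<^sub>m m) (of_int \<delta> \<cdot>\<^sub>m (canon_H cs \<oplus>\<^sub>m H'))"
      using cong_pair_smult[OF cong_pair_pow[OF congA, of m]] unfolding pow .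
    ultimately have "sign_index (A ^\<^sub>m m) (of_int \<delta> \<cdot>\<^sub>m H) \<nu> ?s"
      using sign_index_cong[OF cong_pair_sym] by simp
    then have "sign_index (canon_J bs) (of_int \<delta> \<cdot>\<^sub>m canon_H bs) \<nu> ?s"
      by (rule sign_index_cong[OF cong_pair_smult[OF cong]])
    with canon_sign_index_0[OF val \<nu> \<delta>] show ?thesis by (rule sign_index_unique)
  qed
  then have "zero_root_data m bs zs" unfolding zero_root_data_def using zval by blast
  then show ?thesis ..
qed

section \<open>From block data to a root at zero\<close>

lemma jordan_block_0_selfadjoint:
  "(of_int \<epsilon> \<cdot>\<^sub>m antidiag_mat k) * jordan_block k 0 = mat_adjoint (jordan_block k 0) * (of_int \<epsilon> \<cdot>\<^sub>m antidiag_mat k)"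
  unfolding jordan_block_toeplitz using fps_cnj_linear[of 0]
  by (simp add: mult_smult_assoc_mat[of _ k k _ k] mult_smult_distrib[of _ k k _ k] toeplitz_adj_antidiag)

text \<open>These are the hypotheses of \<open>split_nilpotent_part\<close> for the power of the
  candidate root, with the form as its own inverse, together with a nilpotency exponent that will
  exclude an injective remainder.\<close>

lemma root_power_facts:
  assumes "0 < m" "\<forall>(k, \<epsilon>) \<in> set zs. 0 < k \<and> \<epsilon> \<in> {1, -1}"
  shows "\<exists>d j. root_power m zs \<in> carrier_mat d d \<and> canon_H (zero_blocks zs) \<in> carrier_mat d d \<and>
    mat_adjoint (canon_H (zero_blocks zs)) = canon_H (zero_blocks zs) \<and>
    canon_H (zero_blocks zs) * canon_H (zero_blocks zs) = 1\<^sub>m d \<and>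
    canon_H (zero_blocks zs) * root_power m zs = mat_adjoint (root_power m zs) * canon_H (zero_blocks zs) \<and>
    root_power m zs ^\<^sub>m j = 0\<^sub>m d d"
  using assms(2)
proof (induction zs)
  case Nil
  show ?case
    by (rule exI[of _ 0], rule exI[of _ 1]) (auto simp: root_power_def)
next
  case (Cons x zs)
  obtain k \<epsilon> where x: "x = (k, \<epsilon>)" by (cases x)
  have \<epsilon>: "\<epsilon> \<in> {1, -1}" using Cons.prems by (simp add: x)
  obtain d j where IH: "root_power m zs \<in> carrier_mat d d" "canon_H (zero_blocks zs) \<in> carrier_mat d d"
    "mat_adjoint (canon_H (zero_blocks zs)) = canon_H (zero_blocks zs)"
    "canon_H (zero_blocks zs) * canon_H (zero_blocks zs) = 1\<^sub>m d"
    "canon_H (zero_blocks zs) * root_power m zs = mat_adjoint (root_power m zs) * canon_H (zero_blocks zs)"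
    "root_power m zs ^\<^sub>m j = 0\<^sub>m d d" using Cons by auto
  define Q where "Q = of_int \<epsilon> \<cdot>\<^sub>m antidiag_mat k"
  define J where "J = jordan_block k (0 :: complex) ^\<^sub>m m"
  have Q: "Q \<in> carrier_mat k k" and J: "J \<in> carrier_mat k k" by (simp_all add: Q_def J_def)
  have adjQ: "mat_adjoint Q = Q" by (simp add: Q_def)
  have "Q * Q = of_int \<epsilon> \<cdot>\<^sub>m (of_int \<epsilon> \<cdot>\<^sub>m 1\<^sub>m k)"
    unfolding Q_def by (simp add: mult_smult_assoc_mat[of _ k k _ k] mult_smult_distrib[of _ k k _ k] antidiag_square)
  also have "\<dots> = 1\<^sub>m k" by (rule eq_matI) (use \<epsilon> in auto)
  finally have QQ: "Q * Q = 1\<^sub>m k" .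
  have QJ: "Q * J = mat_adjoint J * Q"
    unfolding J_def using jordan_block_0_selfadjoint[of \<epsilon> k] by (intro selfadjoint_pow[of _ k]) (simp_all add: Q_def)
  \<comment> \<open>Positivity of \<open>m\<close> makes \<open>m * k\<close> at least
    \<open>k\<close>, so the k-th power of J^m shifts past the end of the block.\<close>
  have "k * 1 \<le> k * m" using assms(1) by (intro mult_le_mono2) simp
  then obtain M where M: "m * k = M" "k \<le> M" by (metis mult.commute mult_1_right)
  have "J ^\<^sub>m k = mat k k (\<lambda>(i, j). if j = i + m * k then 1 else 0)"
    unfolding J_def pow_mat_mult[OF jordan_block_carrier, symmetric] by (rule jordan_block_0_pow)
  also have "\<dots> = 0\<^sub>m k k" unfolding M(1) using M(2) by (intro eq_matI) auto
  finally have "J ^\<^sub>m k = 0\<^sub>m k k" .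
  then have nil: "J ^\<^sub>m (k + j) = 0\<^sub>m k k" "root_power m zs ^\<^sub>m (k + j) = 0\<^sub>m d d"
    using J IH(1,6) by (simp_all add: pow_mat_add[of _ k] pow_mat_add[of _ d])
  have R: "root_power m (x # zs) = J \<oplus>\<^sub>m root_power m zs" by (simp add: root_power_def J_def x)
  have C: "canon_H (zero_blocks (x # zs)) = Q \<oplus>\<^sub>m canon_H (zero_blocks zs)" by (simp add: Q_def x)
  show ?case
    unfolding R C
  proof (rule exI[of _ "k + d"], rule exI[of _ "k + j"], intro conjI)
    show "(J \<oplus>\<^sub>m root_power m zs) ^\<^sub>m (k + j) = 0\<^sub>m (k + d) (k + d)"
      unfolding dsum_pow[OF J IH(1)] nil by simp
    show "mat_adjoint (Q \<oplus>\<^sub>m canon_H (zero_blocks zs)) = Q \<oplus>\<^sub>m canon_H (zero_blocks zs)"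
      unfolding dsum_adj adjQ IH(3) ..
    show "(Q \<oplus>\<^sub>m canon_H (zero_blocks zs)) * (Q \<oplus>\<^sub>m canon_H (zero_blocks zs)) = 1\<^sub>m (k + d)"
      unfolding dsum_mult[OF Q Q IH(2) IH(2)] QQ IH(4) by simp
    have aJ: "mat_adjoint J \<in> carrier_mat k k" and aR: "mat_adjoint (root_power m zs) \<in> carrier_mat d d"
      using J IH(1) by auto
    show "(Q \<oplus>\<^sub>m canon_H (zero_blocks zs)) * (J \<oplus>\<^sub>m root_power m zs) =
        mat_adjoint (J \<oplus>\<^sub>m root_power m zs) * (Q \<oplus>\<^sub>m canon_H (zero_blocks zs))"
      unfolding dsum_adj dsum_mult[OF Q J IH(2) IH(1)] dsum_mult[OF aJ Q aR IH(2)] QJ IH(5) ..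
  qed (use Q J IH(1,2) in auto)
qed

text \<open>The power of the candidate root is nilpotent, so splitting it gives a complete canonical
  form \<open>cs\<close>. By the data and the uniqueness of the index, \<open>cs\<close> contains
  the same blocks as the zero part of \<open>bs\<close>; it is a rearrangement of it, and the root
  is carried along the congruences.\<close>

lemma has_root_zero_part:
  assumes "0 < m" and val: "\<forall>b \<in> set bs. valid_block b" and data: "zero_root_data m bs zs"
  shows "has_root m (canon_J (zero_part bs)) (canon_H (zero_part bs))"
proof -
  define B0 where "B0 = root_power m zs"
  define H0 where "H0 = canon_H (zero_blocks zs)"
  have zval: "\<forall>(k, \<epsilon>) \<in> set zs. 0 < k \<and> \<epsilon> \<in> {1, -1}"
    and counts: "\<And>\<nu> \<delta>. 0 < \<nu> \<Longrightarrow> \<delta> \<in> {1, -1} \<Longrightarrow> count (mset bs) (Real_Block \<nu> 0 \<delta>) =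
        (\<Sum>(k, \<epsilon>) \<leftarrow> zs. signed_half (\<delta> * \<epsilon>) (split_count m k \<nu>))"
    using data unfolding zero_root_data_def by blast+
  obtain d j where B0: "B0 \<in> carrier_mat d d" and H0: "H0 \<in> carrier_mat d d" "mat_adjoint H0 = H0"
    "H0 * H0 = 1\<^sub>m d" "H0 * B0 = mat_adjoint B0 * H0" and nil: "B0 ^\<^sub>m j = 0\<^sub>m d d"
    using root_power_facts[OF assms(1) zval] unfolding B0_def H0_def by blast
  have "has_root m (diag_block_mat (map (\<lambda>(k, \<epsilon>). jordan_block k 0 ^\<^sub>m m) zs))
    (diag_block_mat (map (\<lambda>(k, \<epsilon>). of_int \<epsilon> \<cdot>\<^sub>m antidiag_mat k) zs))"
  proof (rule has_root_list)
    fix x :: "nat \<times> int"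
    obtain k \<epsilon> where x: "x = (k, \<epsilon>)" by (cases x)
    show "has_root m (case x of (k, \<epsilon>) \<Rightarrow> jordan_block k 0 ^\<^sub>m m) (case x of (k, \<epsilon>) \<Rightarrow> of_int \<epsilon> \<cdot>\<^sub>m antidiag_mat k)"
      unfolding x prod.case by (rule has_rootI[OF _ _ jordan_block_0_selfadjoint refl]) auto
  qed
  moreover have "diag_block_mat (map (\<lambda>(k, \<epsilon>). of_int \<epsilon> \<cdot>\<^sub>m antidiag_mat k) zs) = H0"
    unfolding H0_def canon_H_def by (simp add: o_def case_prod_beta')
  ultimately have root: "has_root m B0 H0" unfolding B0_def root_power_def by simp
  obtain cs l A' H' where cs: "\<forall>b \<in> set cs. valid_block b \<and> is_zero_block b"
    and A': "A' \<in> carrier_mat l l" and H': "H' \<in> carrier_mat l l"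
    and inj: "\<forall>v \<in> carrier_vec l. A' *\<^sub>v v = 0\<^sub>v l \<longrightarrow> v = 0\<^sub>v l"
    and cong: "cong_pair B0 H0 (canon_J cs \<oplus>\<^sub>m A') (canon_H cs \<oplus>\<^sub>m H')"
    using split_nilpotent_part[OF B0 H0(1,2) H0(1,3,3,4)] by blast
  obtain c where c: "canon_J cs \<in> carrier_mat c c" by (rule canon_carrier)
  \<comment> \<open>The remainder is injective, yet some power of it is a summand of a vanishing
    power of \<open>B0\<close>; both can hold only in size 0.\<close>
  have "l = 0"
  proof (rule ccontr)
    assume "l \<noteq> 0"
    obtain n' S T where st: "B0 \<in> carrier_mat n' n'" "S \<in> carrier_mat n' n'" "T \<in> carrier_mat n' n'"
      "(canon_J cs \<oplus>\<^sub>m A') ^\<^sub>m j = T * B0 ^\<^sub>m j * S" "canon_J cs \<oplus>\<^sub>m A' \<in> carrier_mat n' n'"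
      using cong_pair_pow[OF cong, of j] cong
      by (elim cong_pairE) (metis (no_types, opaque_lifting) carrier_matD(1) conj_mat_pow)
    have n': "n' = d" "n' = c + l" using st(1,5) B0 c A' by (metis carrier_matD(1), metis carrier_matD(1) dsum_carrier)
    have "(canon_J cs \<oplus>\<^sub>m A') ^\<^sub>m j = 0\<^sub>m (c + l) (c + l)"
      unfolding st(4) nil using st(2,3) n' by simp
    then have "canon_J cs ^\<^sub>m j \<oplus>\<^sub>m A' ^\<^sub>m j = 0\<^sub>m c c \<oplus>\<^sub>m 0\<^sub>m l l"
      unfolding dsum_pow[OF c A'] by simp
    then have A'j: "A' ^\<^sub>m j = 0\<^sub>m l l"
      by (rule dsum_eqD(2)[of _ _ _ _ c c l l]) (use c A' in auto)
    have "A' ^\<^sub>m j *\<^sub>v unit_vec l 0 = 0\<^sub>v l" unfolding A'j by (auto intro!: eq_vecI)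
    then have "unit_vec l 0 = (0\<^sub>v l :: complex vec)" using inj_mat_pow[OF A' inj] by simp
    with \<open>l \<noteq> 0\<close> show False by simp
  qed
  then have "A' = 0\<^sub>m 0 0" "H' = 0\<^sub>m 0 0" using A' H' by (auto intro!: eq_matI)
  with cong have cong': "cong_pair B0 H0 (canon_J cs) (canon_H cs)" by simp
  have "count (mset cs) (Real_Block \<nu> 0 \<delta>) = count (mset bs) (Real_Block \<nu> 0 \<delta>)"
    if \<nu>: "0 < \<nu>" and \<delta>: "\<delta> \<in> {1, -1}" for \<nu> \<delta>
  proof -
    have "sign_index (canon_J cs) (of_int \<delta> \<cdot>\<^sub>m canon_H cs) \<nu> (\<Sum>(k, \<epsilon>) \<leftarrow> zs. signed_half (\<delta> * \<epsilon>) (split_count m k \<nu>))"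
      using sign_index_cong[OF cong_pair_smult[OF cong'] root_power_sign_index[OF zval \<nu> \<delta>, of m, folded B0_def H0_def]] .
    moreover have "\<forall>b \<in> set cs. valid_block b" using cs by blast
    ultimately show ?thesis
      using sign_index_unique canon_sign_index_0[OF _ \<nu> \<delta>] counts[OF \<nu> \<delta>] by metis
  qed
  note eq = this
  \<comment> \<open>Both lists contain only valid blocks at 0, so the counts over positive sizes and
    the two signs determine the multisets.\<close>
  have "mset cs = mset (zero_part bs)"
  proof (rule multiset_eqI)
    fix b
    show "count (mset cs) b = count (mset (zero_part bs)) b"
    proof (cases "valid_block b \<and> is_zero_block b")
      case True
      then obtain \<nu> \<delta> where b: "b = Real_Block \<nu> 0 \<delta>" "0 < \<nu>" "\<delta> \<in> {1, -1}" by (cases b) auto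
      have "count (mset (zero_part bs)) b = count (mset bs) b"
        using True by (simp add: zero_part_def)
      then show ?thesis using eq[OF b(2,3)] b(1) by simp
    next
      case False
      then have "b \<notin> set cs" "b \<notin> set (zero_part bs)" using cs val by (auto simp: zero_part_def)
      then show ?thesis by (metis count_mset_0_iff)
    qed
  qed
  then have "cong_pair (canon_J cs) (canon_H cs) (canon_J (zero_part bs)) (canon_H (zero_part bs))"
    by (rule cong_pair_canon_perm)
  then show ?thesis by (rule has_root_cong[OF _ has_root_cong[OF cong' root]])
qed

subsection \<open>Negative eigenvalues\<close>

lemma neg_counts_of_root:
  assumes A: "A \<in> carrier_mat n n" and H: "H \<in> carrier_mat n n"
    and HA: "H * A = mat_adjoint A * H" and "even m"
    and cong: "cong_pair (A ^\<^sub>m m) H (canon_J bs) (canon_H bs)" and val: "\<forall>b \<in> set bs. valid_block b"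
    and "\<alpha> < 0" "0 < \<nu>"
  shows "count (mset bs) (Real_Block \<nu> \<alpha> 1) = count (mset bs) (Real_Block \<nu> \<alpha> (-1))"
proof -
  define C where "C = A ^\<^sub>m (m div 2)"
  have C: "C \<in> carrier_mat n n" using A by (simp add: C_def)
  have CC: "C * C = A ^\<^sub>m m"
    unfolding C_def pow_mat_add[OF A, symmetric] using \<open>even m\<close> by (metis dvd_mult_div_cancel mult_2)
  have HC: "H * C = mat_adjoint C * H" unfolding C_def by (rule selfadjoint_pow[OF A H HA])
  define N where "N = C * C - complex_of_real \<alpha> \<cdot>\<^sub>m 1\<^sub>m n"
  have sgn: "sign_index N (of_int \<delta> \<cdot>\<^sub>m H) \<nu> (count (mset bs) (Real_Block \<nu> \<alpha> \<delta>))" if "\<delta> \<in> {1, -1}" for \<delta>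
  proof -
    have "cong_pair N (of_int \<delta> \<cdot>\<^sub>m H) (canon_J bs - complex_of_real \<alpha> \<cdot>\<^sub>m 1\<^sub>m (dim_row (canon_J bs))) (of_int \<delta> \<cdot>\<^sub>m canon_H bs)"
      using cong_pair_smult[OF cong_pair_shift[OF cong, of "of_real \<alpha>"]] A unfolding N_def CC by simp
    then show ?thesis
      using sign_index_cong[OF cong_pair_sym] canon_sign_index[OF val \<open>0 < \<nu>\<close> that] by blast
  qed
  have H1: "of_int 1 \<cdot>\<^sub>m H = H" "of_int (-1) \<cdot>\<^sub>m H = - 1 \<cdot>\<^sub>m H" "- 1 \<cdot>\<^sub>m (- 1 \<cdot>\<^sub>m H) = H"
    by (auto intro!: eq_matI)
  have p: "sign_index N H \<nu> (count (mset bs) (Real_Block \<nu> \<alpha> 1))"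
    and q: "sign_index N (- 1 \<cdot>\<^sub>m H) \<nu> (count (mset bs) (Real_Block \<nu> \<alpha> (-1)))"
    using sgn[of 1] sgn[of "-1"] unfolding H1 by simp_all
  \<comment> \<open>\<open>C\<close> is selfadjoint for the negated form as well, and the same
    inequality applied to that form is the reverse one.\<close>
  have "(- 1 \<cdot>\<^sub>m H) * C = mat_adjoint C * (- 1 \<cdot>\<^sub>m H)"
    using H C HC mult_smult_assoc_mat[OF H C] mult_smult_distrib[of "mat_adjoint C" n n H n] by simp
  then show ?thesis
    using sign_index_le_of_square_root[OF C H HC \<open>\<alpha> < 0\<close> \<open>0 < \<nu>\<close> p[unfolded N_def] q[unfolded N_def]]
      sign_index_le_of_square_root[OF C _ _ \<open>\<alpha> < 0\<close> \<open>0 < \<nu>\<close> q[unfolded N_def], unfolded H1, OF _ _ p[unfolded N_def]] H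
    by simp
qed

fun pos_neg_data :: "canon_block \<Rightarrow> (nat \<times> real) list" where
  "pos_neg_data (Real_Block k a \<epsilon>) = (if a < 0 \<and> \<epsilon> = 1 then [(k, a)] else [])"
| "pos_neg_data (Pair_Block k z) = []"

text \<open>The pairs are indexed by the positive blocks at negative eigenvalues. Equality of counts
  provides each of them with a negative partner of the same size and eigenvalue, and nothing is left
  over.\<close>

lemma property3_of_counts:
  assumes val: "\<forall>b \<in> set bs. valid_block b"
    and counts: "\<And>\<nu> \<alpha>. even m \<Longrightarrow> 0 < \<nu> \<Longrightarrow> \<alpha> < 0 \<Longrightarrow>
      count (mset bs) (Real_Block \<nu> \<alpha> 1) = count (mset bs) (Real_Block \<nu> \<alpha> (-1))"
  shows "property3 m bs"
proof (cases "even m")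
  case even: True
  define ts where "ts = concat (map pos_neg_data bs)"
  define cs where "cs = concat (map (\<lambda>(k, a). [Real_Block k a 1, Real_Block k a (-1)]) ts)"
  have ts: "\<forall>(k, a) \<in> set ts. 0 < k \<and> a < 0"
  proof -
    have "\<forall>(k, a) \<in> set (pos_neg_data b). 0 < k \<and> a < 0" if "valid_block b" for b
      using that by (cases b) auto
    then show ?thesis using val by (auto simp: ts_def)
  qed
  have cts: "count (mset ts) (k, a) = (if a < 0 then count (mset bs) (Real_Block k a 1) else 0)" for k a
    unfolding ts_def
  proof (induction bs)
    case (Cons b bs)
    then show ?case by (cases b) auto
  qed simp
  have ccs: "count (mset cs) (Real_Block k a \<epsilon>) = (if \<epsilon> \<in> {1, -1} then count (mset ts) (k, a) else 0)" for k a \<epsilon>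
    unfolding cs_def by (induction ts) auto
  have ccp: "count (mset cs) (Pair_Block k z) = 0" for k z
    unfolding cs_def by (induction ts) auto
  have perm: "mset cs = mset (neg_part bs)"
  proof (rule multiset_eqI)
    fix b
    show "count (mset cs) b = count (mset (neg_part bs)) b"
    proof (cases b)
      case b: (Real_Block k a \<epsilon>)
      have n: "count (mset (neg_part bs)) b = (if a < 0 then count (mset bs) b else 0)"
        by (simp add: neg_part_def b)
      show ?thesis
      proof (cases "0 < k \<and> a < 0 \<and> \<epsilon> \<in> {1, -1}")
        case True
        then show ?thesis unfolding n unfolding b ccs cts using counts[OF even, of k a] by auto
      next
        case False
        \<comment> \<open>A size 0 or a sign other than 1 and -1 is expressible as a block but does
          not occur in \<open>bs\<close>; here both counts are 0.\<close>
        have invalid: "count (mset bs) b = 0" if "\<not> valid_block b" for b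
          using val that by (metis count_mset_0_iff)
        have e: "count (mset bs) (Real_Block k a \<epsilon>) = 0" if "\<epsilon> \<notin> {1, -1}"
          using that by (intro invalid) simp
        have z: "count (mset bs) (Real_Block k a \<delta>) = 0" if "\<not> 0 < k" for \<delta>
          using that by (intro invalid) simp
        show ?thesis
        proof (cases "0 < k")
          case True
          then show ?thesis unfolding n unfolding b ccs cts using False e by auto
        next
          case k: False
          show ?thesis unfolding n unfolding b ccs cts z[OF k] by simp
        qed
      qed
    next
      case b: (Pair_Block k z)
      then show ?thesis by (simp add: ccp neg_part_def)
    qed
  qed
  have neg: "- antidiag_mat k = of_int (-1) \<cdot>\<^sub>m antidiag_mat k" for k
    by (rule eq_matI) auto
  have one: "of_int 1 \<cdot>\<^sub>m antidiag_mat k = antidiag_mat k" for k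
    by (rule eq_matI) auto
  have "canon_J cs = diag_block_mat (map (\<lambda>(k, a :: real).
             diag_block_mat [jordan_block k (complex_of_real a), jordan_block k (complex_of_real a)]) ts)"
    unfolding cs_def by (induction ts) (auto simp: dsum_assoc)
  moreover have "canon_H cs = diag_block_mat (map (\<lambda>(k, a :: real). diag_block_mat [antidiag_mat k, - antidiag_mat k]) ts)"
    unfolding cs_def neg
  proof (induction ts)
    case (Cons x ts)
    then show ?case using one by (cases x) (simp add: dsum_assoc)
  qed simp
  ultimately show ?thesis unfolding property3_def using perm ts by blast
qed (simp add: property3_def)

lemma has_root_canon_list:
  assumes "\<And>b. b \<in> set bs \<Longrightarrow> has_root m (block_J b) (block_H b)"
  shows "has_root m (canon_J bs) (canon_H bs)"
  unfolding canon_J_def canon_H_def using assms by (rule has_root_list)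

text \<open>For odd \<open>m\<close> each block has a real root of its own. For even
  \<open>m\<close> a single block need not have one, but a positive and a negative block together
  are congruent to a pair block, which admits a complex root series next to its conjugate.\<close>

lemma has_root_neg_part:
  assumes "0 < m" and "property3 m bs"
  shows "has_root m (canon_J (neg_part bs)) (canon_H (neg_part bs))"
proof (cases "even m")
  case True
  obtain cs ts where cs: "mset cs = mset (neg_part bs)" and ts: "\<forall>(k, a) \<in> set ts. 0 < k \<and> a < 0"
    and J: "canon_J cs = diag_block_mat (map (\<lambda>(k, a :: real).
             diag_block_mat [jordan_block k (complex_of_real a), jordan_block k (complex_of_real a)]) ts)"
    and H: "canon_H cs = diag_block_mat (map (\<lambda>(k, a :: real). diag_block_mat [antidiag_mat k, - antidiag_mat k]) ts)"
    using assms(2) True unfolding property3_def by blast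
  have "has_root m (canon_J cs) (canon_H cs)"
    unfolding J H
  proof (rule has_root_list)
    fix x assume x: "x \<in> set ts"
    obtain k a where xk: "x = (k, a)" by (cases x)
    have "a \<noteq> 0" using ts x unfolding xk by auto
    then show "has_root m (case x of (k, a) \<Rightarrow> diag_block_mat [jordan_block k (complex_of_real a), jordan_block k (complex_of_real a)])
       (case x of (k, a) \<Rightarrow> diag_block_mat [antidiag_mat k, - antidiag_mat k])"
      unfolding xk using has_root_hyperbolic_block[OF assms(1)] by simp
  qed
  then show ?thesis by (rule has_root_cong[OF cong_pair_canon_perm[OF cs]])
next
  case False
  show ?thesis
  proof (rule has_root_canon_list)
    fix b assume "b \<in> set (neg_part bs)"
    then have "is_neg_block b" by (simp add: neg_part_def)
    then obtain k a \<epsilon> where "b = Real_Block k a \<epsilon>" "a < 0" by (cases b) auto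
    then show "has_root m (block_J b) (block_H b)" using has_root_real_block[OF assms(1), of a] False by simp
  qed
qed

lemma has_root_regular_part:
  assumes "0 < m" "\<forall>b \<in> set bs. valid_block b"
  shows "has_root m (canon_J (filter (\<lambda>b. \<not> is_zero_block b \<and> \<not> is_neg_block b) bs))
    (canon_H (filter (\<lambda>b. \<not> is_zero_block b \<and> \<not> is_neg_block b) bs))"
proof (rule has_root_canon_list)
  fix b assume b: "b \<in> set (filter (\<lambda>b. \<not> is_zero_block b \<and> \<not> is_neg_block b) bs)"
  show "has_root m (block_J b) (block_H b)"
  proof (cases b)
    case (Real_Block k a \<epsilon>)
    then have "0 < a" using b by auto
    then show ?thesis using has_root_real_block[OF assms(1), of a] Real_Block by simp
  next
    case (Pair_Block k z)
    then have "z \<noteq> 0" using b assms(2) by auto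
    then show ?thesis using has_root_pair_block[OF assms(1), of z k] Pair_Block by (simp add: mult_2)
  qed
qed

section \<open>The two directions of the equivalence\<close>

theorem theorem1p3:
  fixes m n :: nat and H B :: "complex mat" and bs :: "canon_block list"
  assumes "0 < m"
    and "H \<in> carrier_mat n n" and "invertible_mat H" and "hermitian_mat H"
    and "B \<in> carrier_mat n n" and "selfadjoint_wrt H B"
    and "is_canonical_form B H bs"
  shows "(\<exists>A \<in> carrier_mat n n. selfadjoint_wrt H A \<and> A ^\<^sub>m m = B) \<longleftrightarrow>
           property1 m B \<and> property2 m B bs \<and> property3 m bs"
proof -
  have val: "\<forall>b \<in> set bs. valid_block b" using assms(7) by (simp add: is_canonical_form_def)
  have cong: "cong_pair B H (canon_J bs) (canon_H bs)" by (rule cong_pair_canonical[OF assms(7,5,2)])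
  have sim: "similar_mat B (canon_J bs)"
    using assms(7) unfolding is_canonical_form_def by (auto simp: similar_mat_def dest: similar_mat_wit_sym)
  show ?thesis
  proof
    assume "\<exists>A \<in> carrier_mat n n. selfadjoint_wrt H A \<and> A ^\<^sub>m m = B"
    then obtain A where A: "A \<in> carrier_mat n n" and HA: "H * A = mat_adjoint A * H" and AB: "A ^\<^sub>m m = B"
      by (auto simp: selfadjoint_wrt_def)
    have herm: "mat_adjoint H = H" using assms(4) by (simp add: hermitian_mat_def)
    obtain K where K: "K \<in> carrier_mat n n" "H * K = 1\<^sub>m n" "K * H = 1\<^sub>m n"
    proof -
      obtain K where K: "H * K = 1\<^sub>m (dim_row H)" "K * H = 1\<^sub>m (dim_row K)"
        using assms(3) by (auto simp: invertible_mat_def inverts_mat_def)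
      \<comment> \<open>The two inverse equations carry identity matrices of sizes
        \<open>dim_row H\<close> and \<open>dim_row K\<close>; comparing the numbers of columns
        shows that \<open>K\<close> is n by n.\<close>
      have "dim_col K = n" using arg_cong[OF K(1), of dim_col] assms(2) by simp
      moreover have "dim_row K = n" using arg_cong[OF K(2), of dim_col] assms(2) by simp
      ultimately show thesis using that[of K] K assms(2) by auto
    qed
    have congA: "cong_pair (A ^\<^sub>m m) H (canon_J bs) (canon_H bs)" using cong unfolding AB .
    obtain zs where "zero_root_data m bs zs"
      using zero_root_data_of_root[OF A assms(2) herm K HA congA val] by blast
    then have "property1 m B \<and> property2 m B bs" by (rule properties_of_zero_root_data[OF assms(1) sim val])
    moreover have "property3 m bs"
      using neg_counts_of_root[OF A assms(2) HA _ congA val] by (intro property3_of_counts[OF val])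
    ultimately show "property1 m B \<and> property2 m B bs \<and> property3 m bs" by blast
  next
    assume props: "property1 m B \<and> property2 m B bs \<and> property3 m bs"
    then obtain zs where zs: "zero_root_data m bs zs"
      using zero_root_data_of_property2[OF assms(1) sim val] by blast
    \<comment> \<open>These are the blocks of (J_2, H_2); the three filters are disjoint and exhaust
      \<open>bs\<close>.\<close>
    let ?rest = "filter (\<lambda>b. \<not> is_zero_block b \<and> \<not> is_neg_block b) bs"
    have "has_root m (canon_J (zero_part bs @ neg_part bs @ ?rest)) (canon_H (zero_part bs @ neg_part bs @ ?rest))"
      unfolding canon_append
      using has_root_zero_part[OF assms(1) val zs] has_root_neg_part[OF assms(1)] has_root_regular_part[OF assms(1) val] props
      by (intro has_root_dsum) auto
    moreover have "mset (zero_part bs @ neg_part bs @ ?rest) = mset bs"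
    proof -
      have "\<not> (is_zero_block b \<and> is_neg_block b)" for b by (cases b) auto
      then show ?thesis unfolding zero_part_def neg_part_def by (induction bs) auto
    qed
    ultimately have "has_root m (canon_J bs) (canon_H bs)"
      using has_root_cong[OF cong_pair_canon_perm] by blast
    then have "has_root m B H" by (rule has_root_cong[OF cong_pair_sym[OF cong]])
    then show "\<exists>A \<in> carrier_mat n n. selfadjoint_wrt H A \<and> A ^\<^sub>m m = B"
      using assms(5) unfolding has_root_def by auto
  qed
qed

end
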